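(* Let $\phi:R\rightarrow S$ be a homomorphism of commutative rings and let $\mathscr{F}$ be the set of ideals $I$ of $R$ such that $IS=S$. Then the following hold. (i) The family $\mathscr{F}$ is an idempotent topologizing system on the ring $R$. (ii) If $\phi$ is a flat epimorphism, then for each $R$-module $M$ the map $\eta_{\mathscr{F}}:M_{\mathscr{F}}\rightarrow(S\otimes_R M)_{\mathscr{F}}$ induced by the canonical map $\eta:M\rightarrow S\otimes_R M$, $m\mapsto 1\otimes m$, is an isomorphism. In particular, the map $\phi_{\mathscr{F}}:R_{\mathscr{F}}\to S_{\mathscr{F}}$ is bijective.
   Context: All rings are commutative. A flat epimorphism is a ring map that is flat and is an epimorphism in the category of commutative rings. $IS$ denotes the ideal of $S$ generated by $\phi(I)$. A topologizing system on a ring $R$ is a non-empty family $\mathscr{F}$ of ideals of $R$ such that every ideal containing a member of $\mathscr{F}$ belongs to $\mathscr{F}$, and $\mathscr{F}$ is stable under finite intersections. An $R$-module $M$ is $\mathscr{F}$-negligible if $\operatorname{Ann}_R(m)\in\mathscr{F}$ for every $m\in M$. For topologizing systems $\mathscr{F},\mathscr{G}$ on $R$, $\mathscr{F}.\mathscr{G}$ is the set of ideals $I$ of $R$ for which there is $J\in\mathscr{G}$ with $I\subseteq J$ and $J/I$ $\mathscr{F}$-negligible; $\mathscr{F}$ is idempotent if $\mathscr{F}.\mathscr{F}=\mathscr{F}$. For an $R$-module $M$, $\mathscr{F}(M)=\{m\in M:\operatorname{Ann}_R(m)\in\mathscr{F}\}$ (a submodule), and the Gabriel localization is $M_{\mathscr{F}}=\operatorname{colim}_{I\in\mathscr{F}}\operatorname{Hom}_R(I,M/\mathscr{F}(M))$,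 where $\mathscr{F}$ is directed by reverse inclusion and the transition maps are restrictions; $[f]$ denotes the class of $f:I\to M/\mathscr{F}(M)$. For an $R$-linear map $u:M\to N$, the map $u_{\mathscr{F}}:M_{\mathscr{F}}\to N_{\mathscr{F}}$ is $[f]\mapsto[\overline{u}\circ f]$, where $\overline{u}:M/\mathscr{F}(M)\to N/\mathscr{F}(N)$ is induced by $u$. $S$ and $S\otimes_R M$ are regarded as $R$-modules. *)

theory Defs
  imports "HOL-Algebra.Free_Abelian_Groups" "HOL-Algebra.Weak_Morphisms" "HOL-Algebra.Subrings"
    "HOL-Algebra.Module"
begin

section \<open>Modules over a commutative ring\<close>

text \<open>
  Modules are the records of \<^theory>\<open>HOL-Algebra.Module\<close>. The fields \<open>mult\<close> and \<open>one\<close>, which such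
  a record inherits from rings, play no role for the locale \<^locale>\<open>module\<close>; they are left
  \<^const>\<open>undefined\<close> in the modules constructed below.
\<close>

definition restr_module :: "('r \<Rightarrow> 's) \<Rightarrow> ('s, 'q) ring_scheme \<Rightarrow> ('r, 's) module" where
  "restr_module \<phi> S =
     \<lparr>carrier = carrier S, mult = undefined, one = undefined, zero = \<zero>\<^bsub>S\<^esub>, add = add S,
      smult = (\<lambda>r s. \<phi> r \<otimes>\<^bsub>S\<^esub> s)\<rparr>"

definition self_module :: "('r, 'p) ring_scheme \<Rightarrow> ('r, 'r) module" where
  "self_module R = restr_module (\<lambda>r. r) R"

definition ideal_module :: "('r, 'p) ring_scheme \<Rightarrow> 'r set \<Rightarrow> ('r, 'r) module" where
  "ideal_module R I = self_module R\<lparr>carrier := I\<rparr>"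

definition quot_module :: "('r, 'm, 'k) module_scheme \<Rightarrow> 'm set \<Rightarrow> ('r, 'm set) module" where
  "quot_module M N =
     \<lparr>carrier = a_rcosets\<^bsub>M\<^esub> N, mult = undefined, one = undefined,
      zero = N, add = set_add M,
      smult = (\<lambda>r X. \<Union>x\<in>X. N +>\<^bsub>M\<^esub> (r \<odot>\<^bsub>M\<^esub> x))\<rparr>"

definition is_linear ::
  "('r, 'p) ring_scheme \<Rightarrow> ('r, 'm, 'k) module_scheme \<Rightarrow> ('r, 'n, 'l) module_scheme \<Rightarrow> ('m \<Rightarrow> 'n) \<Rightarrow> bool"
  where
  "is_linear R M N f \<longleftrightarrow>
     f \<in> carrier M \<rightarrow> carrier N \<and>
     (\<forall>x\<in>carrier M. \<forall>y\<in>carrier M. f (x \<oplus>\<^bsub>M\<^esub> y) = f x \<oplus>\<^bsub>N\<^esub> f y) \<and>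
     (\<forall>r\<in>carrier R. \<forall>x\<in>carrier M. f (r \<odot>\<^bsub>M\<^esub> x) = r \<odot>\<^bsub>N\<^esub> f x)"

text \<open>
  The elements of \<open>Hom\<^sub>R (M, N)\<close> are taken extensional (\<^const>\<open>undefined\<close> outside the domain), so that
  equality of functions is equality of linear maps.
\<close>

definition linear_maps ::
  "('r, 'p) ring_scheme \<Rightarrow> ('r, 'm, 'k) module_scheme \<Rightarrow> ('r, 'n, 'l) module_scheme \<Rightarrow> ('m \<Rightarrow> 'n) set"
  where
  "linear_maps R M N = {f \<in> extensional (carrier M). is_linear R M N f}"

definition linear_iso ::
  "('r, 'p) ring_scheme \<Rightarrow> ('r, 'm, 'k) module_scheme \<Rightarrow> ('r, 'n, 'l) module_scheme \<Rightarrow> ('m \<Rightarrow> 'n) \<Rightarrow> bool"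
  where
  "linear_iso R M N f \<longleftrightarrow> f \<in> linear_maps R M N \<and> bij_betw f (carrier M) (carrier N)"

definition ann :: "('r, 'p) ring_scheme \<Rightarrow> ('r, 'm, 'k) module_scheme \<Rightarrow> 'm \<Rightarrow> 'r set" where
  "ann R M m = {r \<in> carrier R. r \<odot>\<^bsub>M\<^esub> m = \<zero>\<^bsub>M\<^esub>}"


section \<open>Tensor products\<close>

text \<open>
  The tensor product \<open>A \<otimes>\<^sub>R B\<close> is the free abelian group on \<open>A \<times> B\<close> modulo the subgroup generated
  by the usual relators, with \<open>r (a \<otimes> b) = (r a) \<otimes> b\<close>. The record \<open>tensor_free\<close> carries that
  operation on formal sums. It is not a module: the distributive law in the scalar only holds
  modulo the relators.
\<close>

definition tensor_free ::
  "('r, 'a, 'k) module_scheme \<Rightarrow> ('r, 'b, 'l) module_scheme \<Rightarrow> ('r, 'a \<times> 'b \<Rightarrow>\<^sub>0 int) module"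
  where
  "tensor_free A B =
     \<lparr>carrier = carrier (free_Abelian_group (carrier A \<times> carrier B)),
      mult = undefined, one = undefined, zero = 0, add = (+),
      smult = (\<lambda>r. frag_extend (\<lambda>(a, b). frag_of (r \<odot>\<^bsub>A\<^esub> a, b)))\<rparr>"

definition tensor_relators ::
  "('r, 'p) ring_scheme \<Rightarrow> ('r, 'a, 'k) module_scheme \<Rightarrow> ('r, 'b, 'l) module_scheme
     \<Rightarrow> ('a \<times> 'b \<Rightarrow>\<^sub>0 int) set"
  where
  "tensor_relators R A B =
     {frag_of (a \<oplus>\<^bsub>A\<^esub> a', b) - frag_of (a, b) - frag_of (a', b) | a a' b.
        a \<in> carrier A \<and> a' \<in> carrier A \<and> b \<in> carrier B}
   \<union> {frag_of (a, b \<oplus>\<^bsub>B\<^esub> b') - frag_of (a, b) - frag_of (a, b') | a b b'.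
        a \<in> carrier A \<and> b \<in> carrier B \<and> b' \<in> carrier B}
   \<union> {frag_of (r \<odot>\<^bsub>A\<^esub> a, b) - frag_of (a, r \<odot>\<^bsub>B\<^esub> b) | r a b.
        r \<in> carrier R \<and> a \<in> carrier A \<and> b \<in> carrier B}"

definition tensor_null ::
  "('r, 'p) ring_scheme \<Rightarrow> ('r, 'a, 'k) module_scheme \<Rightarrow> ('r, 'b, 'l) module_scheme
     \<Rightarrow> ('a \<times> 'b \<Rightarrow>\<^sub>0 int) set"
  where
  "tensor_null R A B =
     generate (free_Abelian_group (carrier A \<times> carrier B)) (tensor_relators R A B)"

definition tensor ::
  "('r, 'p) ring_scheme \<Rightarrow> ('r, 'a, 'k) module_scheme \<Rightarrow> ('r, 'b, 'l) module_scheme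
     \<Rightarrow> ('r, ('a \<times> 'b \<Rightarrow>\<^sub>0 int) set) module"
  where
  "tensor R A B = quot_module (tensor_free A B) (tensor_null R A B)"

definition tensor_elem ::
  "('r, 'p) ring_scheme \<Rightarrow> ('r, 'a, 'k) module_scheme \<Rightarrow> ('r, 'b, 'l) module_scheme
     \<Rightarrow> 'a \<Rightarrow> 'b \<Rightarrow> ('a \<times> 'b \<Rightarrow>\<^sub>0 int) set"
  where
  "tensor_elem R A B a b = tensor_null R A B +>\<^bsub>tensor_free A B\<^esub> frag_of (a, b)"

text \<open>
  The map \<open>A \<otimes> u : A \<otimes>\<^sub>R B \<rightarrow> A \<otimes>\<^sub>R C\<close>, \<open>a \<otimes> b \<mapsto> a \<otimes> u b\<close>, for \<open>u : B \<rightarrow> C\<close>, and the map on formal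
  sums that induces it.
\<close>

abbreviation free_map :: "('b \<Rightarrow> 'c) \<Rightarrow> ('a \<times> 'b \<Rightarrow>\<^sub>0 int) \<Rightarrow> ('a \<times> 'c \<Rightarrow>\<^sub>0 int)" where
  "free_map u \<equiv> frag_extend (\<lambda>(a, b). frag_of (a, u b))"

definition tensor_map ::
  "('r, 'p) ring_scheme \<Rightarrow> ('r, 'a, 'k) module_scheme \<Rightarrow> ('r, 'b, 'l) module_scheme
     \<Rightarrow> ('r, 'c, 'o) module_scheme \<Rightarrow> ('b \<Rightarrow> 'c)
     \<Rightarrow> ('a \<times> 'b \<Rightarrow>\<^sub>0 int) set \<Rightarrow> ('a \<times> 'c \<Rightarrow>\<^sub>0 int) set"
  where
  "tensor_map R A B C u =
     (\<lambda>X\<in>carrier (tensor R A B).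
        \<Union>x\<in>X. tensor_null R A C +>\<^bsub>tensor_free A C\<^esub> free_map u x)"


section \<open>Flat epimorphisms\<close>

text \<open>
  Flatness and the epimorphism property quantify over all modules and all rings. A formula of HOL
  quantifies over structures on one fixed type only, so both definitions fix a type that is large
  enough. The lemmas \<open>flat_module_inj\<close> and \<open>ring_epi_eq\<close> below show that nothing is lost:
  the property then holds for test objects over arbitrary types.

  For flatness the type is that of subsets of \<open>'r list\<close>: a relation in a tensor product involves
  finitely many elements, and a finitely generated module is isomorphic to one whose elements are
  sets of lists of coefficients. For epimorphisms only the subring generated by the images of the
  two maps matters; its elements are finite sums \<open>\<Sum> g a\<^sub>i \<cdot> h b\<^sub>i\<close>, and can be represented by the
  sets of lists of pairs \<open>(a\<^sub>i, b\<^sub>i)\<close> that evaluate to them.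
\<close>

definition flat_module :: "('r, 'p) ring_scheme \<Rightarrow> ('r, 'a, 'k) module_scheme \<Rightarrow> bool" where
  "flat_module R A \<longleftrightarrow>
     (\<forall>(N :: ('r, 'r list set) module) (N' :: ('r, 'r list set) module) u.
        module R N \<and> module R N' \<and> u \<in> linear_maps R N N' \<and> inj_on u (carrier N)
        \<longrightarrow> inj_on (tensor_map R A N N' u) (carrier (tensor R A N)))"

definition flat_ring_hom ::
  "('r, 'p) ring_scheme \<Rightarrow> ('s, 'q) ring_scheme \<Rightarrow> ('r \<Rightarrow> 's) \<Rightarrow> bool" where
  "flat_ring_hom R S \<phi> \<longleftrightarrow> \<phi> \<in> ring_hom R S \<and> flat_module R (restr_module \<phi> S)"

definition ring_epi ::
  "('r, 'p) ring_scheme \<Rightarrow> ('s, 'q) ring_scheme \<Rightarrow> ('r \<Rightarrow> 's) \<Rightarrow> bool" where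
  "ring_epi R S \<phi> \<longleftrightarrow> \<phi> \<in> ring_hom R S \<and>
     (\<forall>T :: ('s \<times> 's) list set ring. \<forall>g\<in>ring_hom S T. \<forall>h\<in>ring_hom S T.
        cring T \<and> (\<forall>r\<in>carrier R. g (\<phi> r) = h (\<phi> r)) \<longrightarrow> (\<forall>s\<in>carrier S. g s = h s))"

definition flat_epi ::
  "('r, 'p) ring_scheme \<Rightarrow> ('s, 'q) ring_scheme \<Rightarrow> ('r \<Rightarrow> 's) \<Rightarrow> bool" where
  "flat_epi R S \<phi> \<longleftrightarrow> flat_ring_hom R S \<phi> \<and> ring_epi R S \<phi>"


subsection \<open>The test types suffice\<close>

lemma ring_epi_eq:
  fixes S :: "('s, 'q) ring_scheme" and T :: "('t, 'o) ring_scheme"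
  assumes epi: "ring_epi R S \<phi>" and S: "cring S" and T: "cring T"
    and g: "g \<in> ring_hom S T" and h: "h \<in> ring_hom S T"
    and eq: "\<And>r. r \<in> carrier R \<Longrightarrow> g (\<phi> r) = h (\<phi> r)" and s: "s \<in> carrier S"
  shows "g s = h s"
proof -
  interpret S: cring S by fact
  interpret T: cring T by fact
  interpret g: ring_hom_cring S T g by unfold_locales (rule g)
  interpret h: ring_hom_cring S T h by unfold_locales (rule h)
  define ev :: "('s \<times> 's) list \<Rightarrow> 't" where
    "ev = (\<lambda>xs. foldr (\<lambda>(a, b) t. g a \<otimes>\<^bsub>T\<^esub> h b \<oplus>\<^bsub>T\<^esub> t) xs \<zero>\<^bsub>T\<^esub>)"
  have ev_simps [simp]: "ev [] = \<zero>\<^bsub>T\<^esub>" "ev ((a, b) # xs) = g a \<otimes>\<^bsub>T\<^esub> h b \<oplus>\<^bsub>T\<^esub> ev xs" for a b xs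
    by (simp_all add: ev_def)
  define L where "L = {xs. set xs \<subseteq> carrier S \<times> carrier S}"
  have L_simps [simp]: "[] \<in> L" "(a, b) # xs \<in> L \<longleftrightarrow> a \<in> carrier S \<and> b \<in> carrier S \<and> xs \<in> L" for a b xs
    by (auto simp: L_def)
  have ev_closed [simp]: "xs \<in> L \<Longrightarrow> ev xs \<in> carrier T" for xs
    by (induction xs) auto
  have add: "xs @ ys \<in> L \<and> ev (xs @ ys) = ev xs \<oplus>\<^bsub>T\<^esub> ev ys" if "xs \<in> L" "ys \<in> L" for xs ys
    using that by (induction xs) (auto simp: T.a_assoc)
  have mult1: "\<exists>zs\<in>L. ev zs = (g a \<otimes>\<^bsub>T\<^esub> h b) \<otimes>\<^bsub>T\<^esub> ev ys"
    if "ys \<in> L" "a \<in> carrier S" "b \<in> carrier S" for a b ys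
    using that(1)
  proof (induction ys)
    case Nil
    then show ?case using that by (intro bexI[of _ "[]"]) auto
  next
    case (Cons p ys)
    obtain c d where p: "p = (c, d)" by (cases p)
    from Cons obtain zs where zs: "zs \<in> L" "ev zs = (g a \<otimes>\<^bsub>T\<^esub> h b) \<otimes>\<^bsub>T\<^esub> ev ys" by (auto simp: p)
    show ?case using Cons.prems that zs p
      by (intro bexI[of _ "(a \<otimes>\<^bsub>S\<^esub> c, b \<otimes>\<^bsub>S\<^esub> d) # zs"]) (auto simp: T.r_distr T.m_ac)
  qed
  have mult: "\<exists>zs\<in>L. ev zs = ev xs \<otimes>\<^bsub>T\<^esub> ev ys" if "xs \<in> L" "ys \<in> L" for xs ys
    using that(1)
  proof (induction xs)
    case Nil
    then show ?case using that by (intro bexI[of _ "[]"]) auto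
  next
    case (Cons p xs)
    obtain a b where p: "p = (a, b)" by (cases p)
    from Cons obtain zs where zs: "zs \<in> L" "ev zs = ev xs \<otimes>\<^bsub>T\<^esub> ev ys" by (auto simp: p)
    from Cons.prems p mult1[OF that(2), of a b] obtain ws
      where ws: "ws \<in> L" "ev ws = (g a \<otimes>\<^bsub>T\<^esub> h b) \<otimes>\<^bsub>T\<^esub> ev ys" by auto
    show ?case using Cons.prems that zs ws p add[of ws zs]
      by (intro bexI[of _ "ws @ zs"]) (auto simp: T.l_distr)
  qed
  have one: "\<exists>zs\<in>L. ev zs = \<one>\<^bsub>T\<^esub>"
    by (intro bexI[of _ "[(\<one>\<^bsub>S\<^esub>, \<one>\<^bsub>S\<^esub>)]"]) auto
  have neg: "\<exists>zs\<in>L. ev zs = \<ominus>\<^bsub>T\<^esub> ev xs" if "xs \<in> L" for xs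
    using mult1[OF that, of "\<ominus>\<^bsub>S\<^esub> \<one>\<^bsub>S\<^esub>" "\<one>\<^bsub>S\<^esub>"] that by (auto simp: T.l_minus)
  define T' where "T' = ev ` L"
  have sub: "subcring T' T"
  proof (intro T.subcringI' T.subringI)
    show "T' \<subseteq> carrier T" by (auto simp: T'_def)
    show "\<one>\<^bsub>T\<^esub> \<in> T'" using one by (force simp: T'_def)
    show "\<ominus>\<^bsub>T\<^esub> x \<in> T'" if "x \<in> T'" for x using that neg by (force simp: T'_def)
    show "x \<otimes>\<^bsub>T\<^esub> y \<in> T'" if "x \<in> T'" "y \<in> T'" for x y using that mult by (force simp: T'_def)
    show "x \<oplus>\<^bsub>T\<^esub> y \<in> T'" if "x \<in> T'" "y \<in> T'" for x y using that add by (force simp: T'_def)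
  qed
  let ?T = "T\<lparr>carrier := T'\<rparr>"
  interpret T': cring ?T using T.subcring_iff[OF subcringE(1)[OF sub]] sub by simp
  define \<rho> where "\<rho> = (\<lambda>t. {xs \<in> L. ev xs = t})"
  have inj: "inj_on \<rho> (carrier ?T)" by (auto simp: inj_on_def \<rho>_def T'_def)
  note iso = inj_imp_image_ring_iso[OF inj]
  have cr: "cring (image_ring \<rho> ?T)"
    using T'.ring_iso_imp_img_cring[OF iso] by (simp add: image_ring_def image_group_def monoid.defs)
  have gT: "g a \<in> T'" if "a \<in> carrier S" for a
    using that unfolding T'_def by (intro image_eqI[of _ _ "[(a, \<one>\<^bsub>S\<^esub>)]"]) auto
  have hT: "h a \<in> T'" if "a \<in> carrier S" for a
    using that unfolding T'_def by (intro image_eqI[of _ _ "[(\<one>\<^bsub>S\<^esub>, a)]"]) auto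
  have gh: "g \<in> ring_hom S ?T" "h \<in> ring_hom S ?T"
    using g h gT hT by (auto simp: ring_hom_def)
  have "\<rho> \<in> ring_hom ?T (image_ring \<rho> ?T)" using iso by (simp add: ring_iso_def)
  then have "\<rho> \<circ> g \<in> ring_hom S (image_ring \<rho> ?T)" "\<rho> \<circ> h \<in> ring_hom S (image_ring \<rho> ?T)"
    using gh ring_hom_trans by blast+
  moreover have "\<forall>r\<in>carrier R. (\<rho> \<circ> g) (\<phi> r) = (\<rho> \<circ> h) (\<phi> r)" using eq by simp
  ultimately have "(\<rho> \<circ> g) s = (\<rho> \<circ> h) s"
    using epi cr s unfolding ring_epi_def by blast
  then show ?thesis using inj_onD[OF inj, of "g s" "h s"] gT[OF s] hT[OF s] by simp
qed

lemma is_linearD: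
  assumes "is_linear R M N f"
  shows "x \<in> carrier M \<Longrightarrow> f x \<in> carrier N"
    "x \<in> carrier M \<Longrightarrow> y \<in> carrier M \<Longrightarrow> f (x \<oplus>\<^bsub>M\<^esub> y) = f x \<oplus>\<^bsub>N\<^esub> f y"
    "r \<in> carrier R \<Longrightarrow> x \<in> carrier M \<Longrightarrow> f (r \<odot>\<^bsub>M\<^esub> x) = r \<odot>\<^bsub>N\<^esub> f x"
  using assms by (auto simp: is_linear_def)

lemma is_linear_comp:
  "is_linear R M N f \<Longrightarrow> is_linear R N P g \<Longrightarrow> is_linear R M P (\<lambda>x. g (f x))"
  unfolding is_linear_def by (auto simp: Pi_iff)

lemma is_linear_cong:
  assumes "module R M" "\<And>x. x \<in> carrier M \<Longrightarrow> f x = g x"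
  shows "is_linear R M N f \<longleftrightarrow> is_linear R M N g"
proof -
  interpret module R M by fact
  show ?thesis using assms(2) by (auto simp: is_linear_def Pi_iff)
qed

lemma is_linear_uminus:
  assumes "module R M" "module R N" "is_linear R M N f" "x \<in> carrier M"
  shows "f (\<ominus>\<^bsub>M\<^esub> x) = \<ominus>\<^bsub>N\<^esub> f x"
proof -
  interpret M: module R M by fact
  interpret N: module R N by fact
  have "f (\<ominus>\<^bsub>M\<^esub> x) = f ((\<ominus>\<^bsub>R\<^esub> \<one>\<^bsub>R\<^esub>) \<odot>\<^bsub>M\<^esub> x)"
    using assms(4) by (simp add: M.smult_l_minus)
  also have "\<dots> = \<ominus>\<^bsub>N\<^esub> f x"
    using assms by (simp add: is_linearD N.smult_l_minus)
  finally show ?thesis .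
qed

lemma module_image:
  assumes "module R M" "inj_on \<rho> (carrier M)"
  obtains N :: "('r, 'n) module"
  where "module R N" "carrier N = \<rho> ` carrier M" "is_linear R M N \<rho>"
    "is_linear R N M (inv_into (carrier M) \<rho>)"
proof -
  interpret module R M by fact
  let ?i = "inv_into (carrier M) \<rho>"
  define N :: "('r, 'n) module" where
    "N = \<lparr>carrier = \<rho> ` carrier M, mult = undefined, one = undefined, zero = \<rho> \<zero>\<^bsub>M\<^esub>,
       add = (\<lambda>x y. \<rho> (?i x \<oplus>\<^bsub>M\<^esub> ?i y)), smult = (\<lambda>r x. \<rho> (r \<odot>\<^bsub>M\<^esub> ?i x))\<rparr>"
  have i [simp]: "?i (\<rho> x) = x" if "x \<in> carrier M" for x using assms(2) that by simp
  have "module R N"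
  proof (rule moduleI)
    show "cring R" by (rule R.is_cring)
    show "abelian_group N"
    proof (rule abelian_groupI)
      fix x assume "x \<in> carrier N"
      then show "\<exists>y\<in>carrier N. y \<oplus>\<^bsub>N\<^esub> x = \<zero>\<^bsub>N\<^esub>"
        by (auto simp: N_def M.l_neg intro!: bexI[of _ "\<ominus>\<^bsub>M\<^esub> (?i x)"])
    qed (auto simp: N_def M.a_ac)
  qed (auto simp: N_def smult_l_distr smult_r_distr smult_assoc1)
  then show ?thesis
    by (rule that) (auto simp: N_def is_linear_def)
qed

lemma tensor_null_closed:
  shows tensor_null_zero: "0 \<in> tensor_null R A B"
    and tensor_null_add: "x \<in> tensor_null R A B \<Longrightarrow> y \<in> tensor_null R A B \<Longrightarrow> x + y \<in> tensor_null R A B"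
  unfolding tensor_null_def
  using generate.one[of "free_Abelian_group (carrier A \<times> carrier B)"]
    generate.eng[of _ "free_Abelian_group (carrier A \<times> carrier B)"] by auto

lemma tensor_relators_keys:
  assumes "module R A" "module R B" "x \<in> tensor_relators R A B"
  shows "Poly_Mapping.keys x \<subseteq> carrier A \<times> carrier B"
proof -
  interpret A: module R A by fact
  interpret B: module R B by fact
  show ?thesis using assms(3) unfolding tensor_relators_def
    by (auto dest!: subsetD[OF keys_diff])
qed

lemma tensor_null_keys:
  assumes "module R A" "module R B" "x \<in> tensor_null R A B"
  shows "Poly_Mapping.keys x \<subseteq> carrier A \<times> carrier B"
proof -
  have "tensor_null R A B \<subseteq> carrier (free_Abelian_group (carrier A \<times> carrier B))"
    unfolding tensor_null_def
    by (rule group.generate_incl) (use tensor_relators_keys[OF assms(1,2)] in auto)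
  from subsetD[OF this assms(3)] show ?thesis by simp
qed

lemma tensor_null_uminus:
  assumes "module R A" "module R B" "x \<in> tensor_null R A B"
  shows "- x \<in> tensor_null R A B"
proof -
  let ?G = "free_Abelian_group (carrier A \<times> carrier B)"
  have "inv\<^bsub>?G\<^esub> x \<in> tensor_null R A B"
    unfolding tensor_null_def
  proof (rule group.generate_m_inv_closed)
    show "tensor_relators R A B \<subseteq> carrier ?G" using tensor_relators_keys[OF assms(1,2)] by auto
    show "x \<in> generate ?G (tensor_relators R A B)" using assms(3) by (simp add: tensor_null_def)
  qed simp
  with tensor_null_keys[OF assms] show ?thesis by simp
qed

lemma tensor_null_induct [consumes 3, case_names relator zero add uminus]:
  assumes "module R A" "module R B" "x \<in> tensor_null R A B"
    and r: "\<And>x. x \<in> tensor_relators R A B \<Longrightarrow> P x" and z: "P 0"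
    and a: "\<And>x y. P x \<Longrightarrow> P y \<Longrightarrow> P (x + y)" and m: "\<And>x. P x \<Longrightarrow> P (- x)"
  shows "P x"
  using assms(3) unfolding tensor_null_def
proof (induction rule: generate.induct)
  case one
  then show ?case using z by simp
next
  case (incl h)
  then show ?case by (rule r)
next
  case (inv h)
  then show ?case using tensor_relators_keys[OF assms(1,2) inv] m[OF r[OF inv]] by simp
next
  case (eng x y)
  then show ?case using a by simp
qed

lemma free_map_keys:
  assumes "Poly_Mapping.keys x \<subseteq> K \<times> L" "u ` L \<subseteq> L'"
  shows "Poly_Mapping.keys (free_map u x) \<subseteq> K \<times> L'"
proof -
  have "Poly_Mapping.keys (free_map u x)
      \<subseteq> (\<Union>p\<in>Poly_Mapping.keys x. Poly_Mapping.keys (case p of (a, b) \<Rightarrow> frag_of (a, u b)))"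
    by (rule keys_frag_extend)
  also have "\<dots> \<subseteq> K \<times> L'" using assms by fastforce
  finally show ?thesis .
qed

lemma free_map_comp: "free_map v (free_map u x) = free_map (\<lambda>b. v (u b)) x"
proof -
  have *: "(\<lambda>(a, b). frag_of (a, u b)) = frag_of \<circ> (\<lambda>(a, b). (a, u b))" by auto
  show ?thesis unfolding * frag_extend_compose by (rule frag_extend_eq) auto
qed

lemma free_map_id:
  assumes "Poly_Mapping.keys x \<subseteq> K \<times> L" "\<And>b. b \<in> L \<Longrightarrow> u b = b"
  shows "free_map u x = x"
proof -
  have "free_map u x = frag_extend frag_of x"
    using assms by (intro frag_extend_eq) auto
  then show ?thesis by (metis frag_expansion)
qed

lemma free_map_null:
  assumes "module R A" "module R B" "module R C" "is_linear R B C u" "x \<in> tensor_null R A B"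
  shows "free_map u x \<in> tensor_null R A C"
  using assms(1,2,5)
proof (induction x rule: tensor_null_induct)
  case (relator x)
  note lin = is_linearD[OF assms(4)]
  have "free_map u x \<in> tensor_relators R A C"
    using relator[unfolded tensor_relators_def]
  proof (elim UnE CollectE exE conjE)
    fix a a' b assume x: "x = frag_of (a \<oplus>\<^bsub>A\<^esub> a', b) - frag_of (a, b) - frag_of (a', b)"
      and *: "a \<in> carrier A" "a' \<in> carrier A" "b \<in> carrier B"
    have "free_map u x = frag_of (a \<oplus>\<^bsub>A\<^esub> a', u b) - frag_of (a, u b) - frag_of (a', u b)"
      by (simp add: x frag_extend_diff)
    with * lin(1) show ?thesis unfolding tensor_relators_def by blast
  next
    fix a b b' assume x: "x = frag_of (a, b \<oplus>\<^bsub>B\<^esub> b') - frag_of (a, b) - frag_of (a, b')"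
      and *: "a \<in> carrier A" "b \<in> carrier B" "b' \<in> carrier B"
    have "free_map u x = frag_of (a, u b \<oplus>\<^bsub>C\<^esub> u b') - frag_of (a, u b) - frag_of (a, u b')"
      using * by (simp add: x frag_extend_diff lin(2))
    with * lin(1) show ?thesis unfolding tensor_relators_def by blast
  next
    fix r a b assume x: "x = frag_of (r \<odot>\<^bsub>A\<^esub> a, b) - frag_of (a, r \<odot>\<^bsub>B\<^esub> b)"
      and *: "r \<in> carrier R" "a \<in> carrier A" "b \<in> carrier B"
    have "free_map u x = frag_of (r \<odot>\<^bsub>A\<^esub> a, u b) - frag_of (a, r \<odot>\<^bsub>C\<^esub> u b)"
      using * by (simp add: x frag_extend_diff lin(3))
    with * lin(1) show ?thesis unfolding tensor_relators_def by blast
  qed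
  then show ?case unfolding tensor_null_def by (rule generate.incl)
next
  case zero
  then show ?case by (simp add: tensor_null_zero)
next
  case (add x y)
  then show ?case by (simp add: frag_extend_add tensor_null_add)
next
  case (uminus x)
  then show ?case using tensor_null_uminus[OF assms(1,3)] by (simp add: frag_extend_minus)
qed

lemma tensor_coset: "tensor_null R A B +>\<^bsub>tensor_free A B\<^esub> x = (\<lambda>n. n + x) ` tensor_null R A B"
  by (auto simp: a_r_coset_def' tensor_free_def)

lemma tensor_coset_eq_iff:
  assumes "module R A" "module R B"
  shows "tensor_null R A B +>\<^bsub>tensor_free A B\<^esub> x = tensor_null R A B +>\<^bsub>tensor_free A B\<^esub> y
    \<longleftrightarrow> x - y \<in> tensor_null R A B"
proof
  assume "tensor_null R A B +>\<^bsub>tensor_free A B\<^esub> x = tensor_null R A B +>\<^bsub>tensor_free A B\<^esub> y"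
  moreover have "x \<in> (\<lambda>n. n + x) ` tensor_null R A B"
    using tensor_null_zero by (rule rev_image_eqI) simp
  ultimately obtain n where "n \<in> tensor_null R A B" "x = n + y" by (auto simp: tensor_coset)
  then show "x - y \<in> tensor_null R A B" by simp
next
  assume *: "x - y \<in> tensor_null R A B"
  have sub: "(\<lambda>n. n + x) ` tensor_null R A B \<subseteq> (\<lambda>n. n + y) ` tensor_null R A B"
    if "x - y \<in> tensor_null R A B" for x y
  proof (rule image_subsetI)
    fix n assume "n \<in> tensor_null R A B"
    then show "n + x \<in> (\<lambda>n. n + y) ` tensor_null R A B"
      by (intro image_eqI[of _ _ "n + (x - y)"]) (auto intro: tensor_null_add that)
  qed
  have "y - x \<in> tensor_null R A B" using tensor_null_uminus[OF assms *] by simp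
  with sub[OF *] sub[of y x]
  show "tensor_null R A B +>\<^bsub>tensor_free A B\<^esub> x = tensor_null R A B +>\<^bsub>tensor_free A B\<^esub> y"
    unfolding tensor_coset by (intro subset_antisym)
qed

lemma carrier_tensor:
  "carrier (tensor R A B) =
     (\<lambda>x. tensor_null R A B +>\<^bsub>tensor_free A B\<^esub> x) ` {x. Poly_Mapping.keys x \<subseteq> carrier A \<times> carrier B}"
  by (auto simp: tensor_def quot_module_def A_RCOSETS_def' tensor_free_def free_Abelian_group_def)

lemma tensor_map_coset:
  assumes "module R A" "module R B" "module R C" "is_linear R B C u"
    and "Poly_Mapping.keys x \<subseteq> carrier A \<times> carrier B"
  shows "tensor_map R A B C u (tensor_null R A B +>\<^bsub>tensor_free A B\<^esub> x)
    = tensor_null R A C +>\<^bsub>tensor_free A C\<^esub> free_map u x"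
proof -
  have *: "tensor_null R A C +>\<^bsub>tensor_free A C\<^esub> free_map u (n + x)
      = tensor_null R A C +>\<^bsub>tensor_free A C\<^esub> free_map u x" if "n \<in> tensor_null R A B" for n
    using free_map_null[OF assms(1-4) that]
    by (simp add: tensor_coset_eq_iff[OF assms(1,3)] frag_extend_add)
  have "tensor_null R A B +>\<^bsub>tensor_free A B\<^esub> x \<in> carrier (tensor R A B)"
    using assms(5) by (auto simp: carrier_tensor)
  then have "tensor_map R A B C u (tensor_null R A B +>\<^bsub>tensor_free A B\<^esub> x)
    = (\<Union>y\<in>tensor_null R A B +>\<^bsub>tensor_free A B\<^esub> x.
         tensor_null R A C +>\<^bsub>tensor_free A C\<^esub> free_map u y)"
    unfolding tensor_map_def by (rule restrict_apply')
  also have "\<dots> = (\<Union>n\<in>tensor_null R A B. tensor_null R A C +>\<^bsub>tensor_free A C\<^esub> free_map u (n + x))"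
    unfolding tensor_coset[where A = A and B = B] by (simp only: image_image)
  also have "\<dots> = (\<Union>n\<in>tensor_null R A B. tensor_null R A C +>\<^bsub>tensor_free A C\<^esub> free_map u x)"
    by (rule SUP_cong[OF refl]) (rule *)
  also have "\<dots> = tensor_null R A C +>\<^bsub>tensor_free A C\<^esub> free_map u x"
  proof -
    have "tensor_null R A B \<noteq> {}" using tensor_null_zero[of R A B] by auto
    then show ?thesis by (simp only: UN_constant if_False)
  qed
  finally show ?thesis .
qed

lemma tensor_map_inj_iff:
  assumes "module R A" "module R B" "module R C" "is_linear R B C u"
  shows "inj_on (tensor_map R A B C u) (carrier (tensor R A B)) \<longleftrightarrow>
    (\<forall>x. Poly_Mapping.keys x \<subseteq> carrier A \<times> carrier B \<and> free_map u x \<in> tensor_null R A C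
       \<longrightarrow> x \<in> tensor_null R A B)" (is "?L \<longleftrightarrow> ?R")
proof
  assume L: ?L
  show ?R
  proof (intro allI impI, elim conjE)
    fix x assume x: "Poly_Mapping.keys x \<subseteq> carrier A \<times> carrier B" "free_map u x \<in> tensor_null R A C"
    let ?c = "\<lambda>x. tensor_null R A B +>\<^bsub>tensor_free A B\<^esub> x"
    have "tensor_map R A B C u (?c x) = tensor_map R A B C u (?c 0)"
      using x by (simp add: tensor_map_coset[OF assms] tensor_coset_eq_iff[OF assms(1,3)])
    moreover have "?c x \<in> carrier (tensor R A B)" "?c 0 \<in> carrier (tensor R A B)"
      using x by (auto simp: carrier_tensor)
    ultimately have "?c x = ?c 0" using L by (auto dest: inj_onD)
    then show "x \<in> tensor_null R A B" by (simp add: tensor_coset_eq_iff[OF assms(1,2)])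
  qed
next
  assume R: ?R
  show ?L
  proof (rule inj_onI)
    fix X Y assume "X \<in> carrier (tensor R A B)" "Y \<in> carrier (tensor R A B)"
      and eq: "tensor_map R A B C u X = tensor_map R A B C u Y"
    then obtain x y where X: "X = tensor_null R A B +>\<^bsub>tensor_free A B\<^esub> x"
      "Y = tensor_null R A B +>\<^bsub>tensor_free A B\<^esub> y"
      and k: "Poly_Mapping.keys x \<subseteq> carrier A \<times> carrier B" "Poly_Mapping.keys y \<subseteq> carrier A \<times> carrier B"
      by (auto simp: carrier_tensor)
    have "free_map u (x - y) \<in> tensor_null R A C"
      using eq k unfolding X
      by (simp add: tensor_map_coset[OF assms] tensor_coset_eq_iff[OF assms(1,3)] frag_extend_diff)
    moreover have "Poly_Mapping.keys (x - y) \<subseteq> carrier A \<times> carrier B"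
      using keys_diff[of x y] k by (rule subset_trans[OF _ Un_least])
    ultimately have "x - y \<in> tensor_null R A B" using R by blast
    then show "X = Y" unfolding X by (simp add: tensor_coset_eq_iff[OF assms(1,2)])
  qed
qed

lemma tensor_null_finite:
  assumes "module R A" "module R C" "x \<in> tensor_null R A C"
  shows "\<exists>X. finite X \<and> X \<subseteq> carrier C \<and>
    (\<forall>H. submodule H R C \<and> X \<subseteq> H \<longrightarrow> x \<in> tensor_null R A (C\<lparr>carrier := H\<rparr>))"
  using assms(1,2,3)
proof (induction x rule: tensor_null_induct)
  case (relator x)
  interpret C: module R C by fact
  have "\<exists>X. finite X \<and> X \<subseteq> carrier C \<and>
    (\<forall>H. submodule H R C \<and> X \<subseteq> H \<longrightarrow> x \<in> tensor_relators R A (C\<lparr>carrier := H\<rparr>))"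
    using relator[unfolded tensor_relators_def]
  proof (elim UnE CollectE exE conjE)
    fix a a' b assume "x = frag_of (a \<oplus>\<^bsub>A\<^esub> a', b) - frag_of (a, b) - frag_of (a', b)"
      "a \<in> carrier A" "a' \<in> carrier A" "b \<in> carrier C"
    then show ?thesis
      by (intro exI[of _ "{b}"]) (simp add: tensor_relators_def, blast)
  next
    fix a b b' assume "x = frag_of (a, b \<oplus>\<^bsub>C\<^esub> b') - frag_of (a, b) - frag_of (a, b')"
      "a \<in> carrier A" "b \<in> carrier C" "b' \<in> carrier C"
    then show ?thesis
      by (intro exI[of _ "{b, b'}"]) (simp add: tensor_relators_def, blast)
  next
    fix r a b assume "x = frag_of (r \<odot>\<^bsub>A\<^esub> a, b) - frag_of (a, r \<odot>\<^bsub>C\<^esub> b)"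
      "r \<in> carrier R" "a \<in> carrier A" "b \<in> carrier C"
    then show ?thesis
      by (intro exI[of _ "{b}"]) (simp add: tensor_relators_def, blast)
  qed
  then obtain X where "finite X" "X \<subseteq> carrier C"
    "\<forall>H. submodule H R C \<and> X \<subseteq> H \<longrightarrow> x \<in> tensor_relators R A (C\<lparr>carrier := H\<rparr>)"
    by (elim exE conjE)
  then show ?case unfolding tensor_null_def by (intro exI[of _ X]) (auto intro: generate.incl)
next
  case zero
  then show ?case by (auto simp: tensor_null_zero)
next
  case (add x y)
  from add(1) obtain X where X: "finite X" "X \<subseteq> carrier C"
    "\<forall>H. submodule H R C \<and> X \<subseteq> H \<longrightarrow> x \<in> tensor_null R A (C\<lparr>carrier := H\<rparr>)"
    by (elim exE conjE)
  from add(2) obtain Y where Y: "finite Y" "Y \<subseteq> carrier C"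
    "\<forall>H. submodule H R C \<and> Y \<subseteq> H \<longrightarrow> y \<in> tensor_null R A (C\<lparr>carrier := H\<rparr>)"
    by (elim exE conjE)
  have "x + y \<in> tensor_null R A (C\<lparr>carrier := H\<rparr>)" if "submodule H R C" "X \<union> Y \<subseteq> H" for H
    using X(3) Y(3) that by (intro tensor_null_add) auto
  then show ?case using X(1,2) Y(1,2) by (intro exI[of _ "X \<union> Y"]) simp
next
  case (uminus x)
  then obtain X where X: "finite X" "X \<subseteq> carrier C"
    "\<forall>H. submodule H R C \<and> X \<subseteq> H \<longrightarrow> x \<in> tensor_null R A (C\<lparr>carrier := H\<rparr>)"
    by (elim exE conjE)
  have "- x \<in> tensor_null R A (C\<lparr>carrier := H\<rparr>)" if "submodule H R C" "X \<subseteq> H" for H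
    using tensor_null_uminus[OF assms(1) submodule.submodule_is_module[OF that(1) assms(2)]] X(3) that
    by blast
  then show ?case using X(1,2) by (intro exI[of _ X]) simp
qed

lemma finite_subset_small_submodule:
  fixes C :: "('r, 'c, 'k) module_scheme"
  assumes "module R C" "finite X" "X \<subseteq> carrier C"
  shows "\<exists>H (e :: 'r list \<Rightarrow> 'c). submodule H R C \<and> X \<subseteq> H \<and> H \<subseteq> range e"
  using assms(2,3)
proof (induction X rule: finite_induct)
  case empty
  interpret C: module R C by fact
  show ?case
    by (intro exI[of _ "{\<zero>\<^bsub>C\<^esub>}"] exI[of _ "\<lambda>_. \<zero>\<^bsub>C\<^esub>"] conjI C.submoduleI) auto
next
  case (insert x X)
  interpret C: module R C by fact
  from insert obtain H and e :: "'r list \<Rightarrow> 'c"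
    where H: "submodule H R C" "X \<subseteq> H" "H \<subseteq> range e" by auto
  note E = C.submoduleE[OF H(1)]
  have x: "x \<in> carrier C" using insert by simp
  have z: "\<zero>\<^bsub>C\<^esub> \<in> H" using subgroup.one_closed[OF submodule.axioms(1)[OF H(1)]] by simp
  have HC: "h \<in> carrier C" if "h \<in> H" for h using E(1) that by blast
  define H' where "H' = {r \<odot>\<^bsub>C\<^esub> x \<oplus>\<^bsub>C\<^esub> h | r h. r \<in> carrier R \<and> h \<in> H}"
  have mem: "y \<in> H'" if "y = r \<odot>\<^bsub>C\<^esub> x \<oplus>\<^bsub>C\<^esub> h" "r \<in> carrier R" "h \<in> H" for y r h
    using that by (auto simp: H'_def)
  have "submodule H' R C"
  proof (rule C.submoduleI)
    show "H' \<subseteq> carrier C" using x HC by (auto simp: H'_def)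
    show "\<zero>\<^bsub>C\<^esub> \<in> H'" using x z by (intro mem[of _ "\<zero>\<^bsub>R\<^esub>" "\<zero>\<^bsub>C\<^esub>"]) auto
  next
    fix a assume "a \<in> H'"
    then obtain r h where a: "a = r \<odot>\<^bsub>C\<^esub> x \<oplus>\<^bsub>C\<^esub> h" "r \<in> carrier R" "h \<in> H" by (auto simp: H'_def)
    then show "\<ominus>\<^bsub>C\<^esub> a \<in> H'" using x HC E(3)
      by (intro mem[of _ "\<ominus>\<^bsub>R\<^esub> r" "\<ominus>\<^bsub>C\<^esub> h"]) (auto simp: C.M.minus_add C.smult_l_minus)
  next
    fix a b assume "a \<in> H'" "b \<in> H'"
    then obtain r h s k where a: "a = r \<odot>\<^bsub>C\<^esub> x \<oplus>\<^bsub>C\<^esub> h" "r \<in> carrier R" "h \<in> H"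
      "b = s \<odot>\<^bsub>C\<^esub> x \<oplus>\<^bsub>C\<^esub> k" "s \<in> carrier R" "k \<in> H" by (auto simp: H'_def)
    then show "a \<oplus>\<^bsub>C\<^esub> b \<in> H'" using x HC E(5)
      by (intro mem[of _ "r \<oplus>\<^bsub>R\<^esub> s" "h \<oplus>\<^bsub>C\<^esub> k"]) (auto simp: C.smult_l_distr C.M.a_ac)
  next
    fix t a assume t: "t \<in> carrier R" and "a \<in> H'"
    then obtain r h where a: "a = r \<odot>\<^bsub>C\<^esub> x \<oplus>\<^bsub>C\<^esub> h" "r \<in> carrier R" "h \<in> H" by (auto simp: H'_def)
    then show "t \<odot>\<^bsub>C\<^esub> a \<in> H'" using x HC E(4) t
      by (intro mem[of _ "t \<otimes>\<^bsub>R\<^esub> r" "t \<odot>\<^bsub>C\<^esub> h"]) (auto simp: C.smult_r_distr C.smult_assoc1)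
  qed
  moreover have "insert x X \<subseteq> H'"
  proof (rule insert_subsetI)
    show "x \<in> H'" using x z by (intro mem[of _ "\<one>\<^bsub>R\<^esub>" "\<zero>\<^bsub>C\<^esub>"]) auto
    show "X \<subseteq> H'"
    proof
      fix y assume "y \<in> X"
      then show "y \<in> H'" using H(2) HC x by (intro mem[of _ "\<zero>\<^bsub>R\<^esub>" y]) auto
    qed
  qed
  moreover have "H' \<subseteq> range (\<lambda>cs. hd cs \<odot>\<^bsub>C\<^esub> x \<oplus>\<^bsub>C\<^esub> e (tl cs))"
  proof
    fix y assume "y \<in> H'"
    then obtain r h where y: "y = r \<odot>\<^bsub>C\<^esub> x \<oplus>\<^bsub>C\<^esub> h" "h \<in> H" by (auto simp: H'_def)
    then obtain cs where "h = e cs" using H(3) by blast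
    with y show "y \<in> range (\<lambda>cs. hd cs \<odot>\<^bsub>C\<^esub> x \<oplus>\<^bsub>C\<^esub> e (tl cs))"
      by (intro range_eqI[of _ _ "r # cs"]) simp
  qed
  ultimately show ?case by blast
qed

lemma flat_module_inj:
  fixes N :: "('r, 'n, 'k) module_scheme" and N' :: "('r, 'o, 'l) module_scheme"
  assumes flat: "flat_module R A" and A: "module R A" and N: "module R N" and N': "module R N'"
    and u: "u \<in> linear_maps R N N'" and inj: "inj_on u (carrier N)"
  shows "inj_on (tensor_map R A N N' u) (carrier (tensor R A N))"
proof -
  interpret N: module R N by fact
  interpret N': module R N' by fact
  have lin: "is_linear R N N' u" using u by (simp add: linear_maps_def)
  show ?thesis unfolding tensor_map_inj_iff[OF A N N' lin]
  proof (intro allI impI, elim conjE)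
    fix x assume kx: "Poly_Mapping.keys x \<subseteq> carrier A \<times> carrier N" and x: "free_map u x \<in> tensor_null R A N'"
    from tensor_null_finite[OF A N' x] obtain X0 where X0: "finite X0" "X0 \<subseteq> carrier N'"
      "\<And>H. submodule H R N' \<Longrightarrow> X0 \<subseteq> H \<Longrightarrow> free_map u x \<in> tensor_null R A (N'\<lparr>carrier := H\<rparr>)" by blast
    let ?X = "X0 \<union> u ` snd ` Poly_Mapping.keys x"
    have "finite ?X" "?X \<subseteq> carrier N'" using X0 kx is_linearD(1)[OF lin] by auto
    from finite_subset_small_submodule[OF N' this] obtain H' and e :: "'r list \<Rightarrow> 'o"
      where H': "submodule H' R N'" "?X \<subseteq> H'" "H' \<subseteq> range e" by blast
    note E' = N'.submoduleE[OF H'(1)]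
    let ?N' = "N'\<lparr>carrier := H'\<rparr>"
    have mN': "module R ?N'" by (rule submodule.submodule_is_module[OF H'(1) N'])
    define H where "H = {n \<in> carrier N. u n \<in> H'}"
    have z: "\<zero>\<^bsub>N'\<^esub> \<in> H'" using subgroup.one_closed[OF submodule.axioms(1)[OF H'(1)]] by simp
    have "u \<zero>\<^bsub>N\<^esub> = \<zero>\<^bsub>N'\<^esub>"
      using is_linearD(3)[OF lin, of "\<zero>\<^bsub>R\<^esub>" "\<zero>\<^bsub>N\<^esub>"] is_linearD(1)[OF lin, of "\<zero>\<^bsub>N\<^esub>"] by simp
    then have H: "submodule H R N"
      using z E' is_linearD[OF lin] is_linear_uminus[OF N N' lin]
      by (intro N.submoduleI) (auto simp: H_def)
    let ?N = "N\<lparr>carrier := H\<rparr>"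
    have mN: "module R ?N" by (rule submodule.submodule_is_module[OF H N])
    have HN: "H \<subseteq> carrier N" by (auto simp: H_def)
    have uH: "is_linear R ?N ?N' u" using lin by (auto simp: is_linear_def H_def Pi_iff)
    have kxH: "Poly_Mapping.keys x \<subseteq> carrier A \<times> H"
      using kx H'(2) by (force simp: H_def)
    have xH: "free_map u x \<in> tensor_null R A ?N'" using X0(3) H' by blast
    define \<rho>' where "\<rho>' = (\<lambda>h. {cs. e cs = h})"
    have "inj_on \<rho>' H'" using H'(3) by (fastforce simp: inj_on_def \<rho>'_def)
    then have inj': "inj_on \<rho>' (carrier ?N')" by simp
    define \<rho> where "\<rho> = (\<lambda>n. \<rho>' (u n))"
    have inj\<rho>: "inj_on \<rho> (carrier ?N)"
      using inj inj' by (auto simp: inj_on_def \<rho>_def H_def)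
    obtain P' :: "('r, 'r list set) module" where P': "module R P'" "carrier P' = \<rho>' ` carrier ?N'"
      "is_linear R ?N' P' \<rho>'" by (rule module_image[OF mN' inj'])
    let ?i = "inv_into (carrier ?N) \<rho>"
    obtain P :: "('r, 'r list set) module" where P: "module R P" "carrier P = \<rho> ` carrier ?N"
      "is_linear R ?N P \<rho>" "is_linear R P ?N ?i" by (rule module_image[OF mN inj\<rho>])
    define v where "v = restrict (\<lambda>p. p) (carrier P)"
    have ui: "\<rho>' (u (?i p)) = p" if "p \<in> carrier P" for p
      using f_inv_into_f[of p \<rho> "carrier ?N"] that P(2) by (simp add: \<rho>_def)
    have "is_linear R P P' (\<lambda>p. \<rho>' (u (?i p)))"
      by (rule is_linear_comp[OF is_linear_comp[OF P(4) uH] P'(3)])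
    moreover have "v p = \<rho>' (u (?i p))" if "p \<in> carrier P" for p
      using that unfolding ui[OF that] by (simp add: v_def)
    ultimately have v_lin: "is_linear R P P' v"
      using is_linear_cong[OF P(1), of v "\<lambda>p. \<rho>' (u (?i p))"] by blast
    have "v \<in> linear_maps R P P'" "inj_on v (carrier P)"
      using v_lin by (auto simp: linear_maps_def v_def inj_on_def)
    then have "inj_on (tensor_map R A P P' v) (carrier (tensor R A P))"
      using flat P(1) P'(1) unfolding flat_module_def by blast
    then have key: "\<And>y. Poly_Mapping.keys y \<subseteq> carrier A \<times> carrier P \<Longrightarrow> free_map v y \<in> tensor_null R A P'
        \<Longrightarrow> y \<in> tensor_null R A P"
      unfolding tensor_map_inj_iff[OF A P(1) P'(1) v_lin] by blast
    have ky: "Poly_Mapping.keys (free_map \<rho> x) \<subseteq> carrier A \<times> carrier P"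
      by (rule free_map_keys[OF kxH]) (simp add: P(2))
    have "free_map v (free_map \<rho> x) = free_map \<rho> x"
      by (rule free_map_id[OF ky]) (simp add: v_def)
    also have "\<dots> = free_map \<rho>' (free_map u x)" by (simp add: free_map_comp \<rho>_def)
    also have "\<dots> \<in> tensor_null R A P'" by (rule free_map_null[OF A mN' P'(1) P'(3) xH])
    finally have "free_map \<rho> x \<in> tensor_null R A P" by (rule key[OF ky])
    then have "free_map ?i (free_map \<rho> x) \<in> tensor_null R A ?N"
      by (rule free_map_null[OF A P(1) mN P(4)])
    moreover have "free_map ?i (free_map \<rho> x) = x"
      unfolding free_map_comp by (rule free_map_id[OF kxH]) (use inj\<rho> in auto)
    ultimately have "x \<in> tensor_null R A ?N" by simp
    then have "free_map (\<lambda>n. n) x \<in> tensor_null R A N"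
      by (rule free_map_null[OF A mN N, rotated]) (use HN in \<open>auto simp: is_linear_def\<close>)
    then show "x \<in> tensor_null R A N" by (simp add: free_map_id[OF kx])
  qed
qed


section \<open>Topologizing systems\<close>

definition topologizing_system :: "('r, 'p) ring_scheme \<Rightarrow> 'r set set \<Rightarrow> bool" where
  "topologizing_system R \<F> \<longleftrightarrow>
     \<F> \<noteq> {} \<and> (\<forall>I\<in>\<F>. ideal I R) \<and>
     (\<forall>I\<in>\<F>. \<forall>J. ideal J R \<and> I \<subseteq> J \<longrightarrow> J \<in> \<F>) \<and>
     (\<forall>I\<in>\<F>. \<forall>J\<in>\<F>. I \<inter> J \<in> \<F>)"

definition negligible ::
  "('r, 'p) ring_scheme \<Rightarrow> 'r set set \<Rightarrow> ('r, 'm, 'k) module_scheme \<Rightarrow> bool" where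
  "negligible R \<F> M \<longleftrightarrow> (\<forall>m\<in>carrier M. ann R M m \<in> \<F>)"

definition system_prod :: "('r, 'p) ring_scheme \<Rightarrow> 'r set set \<Rightarrow> 'r set set \<Rightarrow> 'r set set" where
  "system_prod R \<F> \<G> =
     {I. ideal I R \<and> (\<exists>J\<in>\<G>. I \<subseteq> J \<and> negligible R \<F> (quot_module (ideal_module R J) I))}"

definition idempotent_system :: "('r, 'p) ring_scheme \<Rightarrow> 'r set set \<Rightarrow> bool" where
  "idempotent_system R \<F> \<longleftrightarrow> system_prod R \<F> \<F> = \<F>"

text \<open>The ideals \<open>I\<close> of \<open>R\<close> with \<open>I S = S\<close>.\<close>

definition extension_system ::
  "('r, 'p) ring_scheme \<Rightarrow> ('s, 'q) ring_scheme \<Rightarrow> ('r \<Rightarrow> 's) \<Rightarrow> 'r set set" where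
  "extension_system R S \<phi> = {I. ideal I R \<and> Idl\<^bsub>S\<^esub> (\<phi> ` I) = carrier S}"


section \<open>Gabriel localization\<close>

definition torsion ::
  "('r, 'p) ring_scheme \<Rightarrow> 'r set set \<Rightarrow> ('r, 'm, 'k) module_scheme \<Rightarrow> 'm set" where
  "torsion R \<F> M = {m \<in> carrier M. ann R M m \<in> \<F>}"

definition torsion_quot ::
  "('r, 'p) ring_scheme \<Rightarrow> 'r set set \<Rightarrow> ('r, 'm, 'k) module_scheme \<Rightarrow> ('r, 'm set) module" where
  "torsion_quot R \<F> M = quot_module M (torsion R \<F> M)"

text \<open>
  The filtered colimit is the disjoint union of the \<open>Hom\<^sub>R (I, M / \<F>(M))\<close>, that is, the set of
  pairs \<open>(I, f)\<close>, modulo agreement on some smaller member of \<open>\<F>\<close>. Operations on equivalence classes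
  are unions over all representatives.
\<close>

definition loc_pairs ::
  "('r, 'p) ring_scheme \<Rightarrow> 'r set set \<Rightarrow> ('r, 'm, 'k) module_scheme \<Rightarrow> ('r set \<times> ('r \<Rightarrow> 'm set)) set"
  where
  "loc_pairs R \<F> M = (SIGMA I:\<F>. linear_maps R (ideal_module R I) (torsion_quot R \<F> M))"

definition loc_rel ::
  "('r, 'p) ring_scheme \<Rightarrow> 'r set set \<Rightarrow> ('r, 'm, 'k) module_scheme
     \<Rightarrow> (('r set \<times> ('r \<Rightarrow> 'm set)) \<times> ('r set \<times> ('r \<Rightarrow> 'm set))) set"
  where
  "loc_rel R \<F> M =
     {((I, f), (J, g)). (I, f) \<in> loc_pairs R \<F> M \<and> (J, g) \<in> loc_pairs R \<F> M \<and>
        (\<exists>K\<in>\<F>. K \<subseteq> I \<inter> J \<and> restrict f K = restrict g K)}"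

definition loc_class ::
  "('r, 'p) ring_scheme \<Rightarrow> 'r set set \<Rightarrow> ('r, 'm, 'k) module_scheme
     \<Rightarrow> 'r set \<Rightarrow> ('r \<Rightarrow> 'm set) \<Rightarrow> ('r set \<times> ('r \<Rightarrow> 'm set)) set"
  where
  "loc_class R \<F> M I f = loc_rel R \<F> M `` {(I, f)}"

definition loc ::
  "('r, 'p) ring_scheme \<Rightarrow> 'r set set \<Rightarrow> ('r, 'm, 'k) module_scheme
     \<Rightarrow> ('r, ('r set \<times> ('r \<Rightarrow> 'm set)) set) module"
  where
  "loc R \<F> M =
     \<lparr>carrier = loc_pairs R \<F> M // loc_rel R \<F> M,
      mult = undefined, one = undefined,
      zero = loc_class R \<F> M (carrier R) (\<lambda>x\<in>carrier R. \<zero>\<^bsub>torsion_quot R \<F> M\<^esub>),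
      add = (\<lambda>X Y. \<Union>(I, f)\<in>X. \<Union>(J, g)\<in>Y.
               loc_class R \<F> M (I \<inter> J) (\<lambda>x\<in>I \<inter> J. f x \<oplus>\<^bsub>torsion_quot R \<F> M\<^esub> g x)),
      smult = (\<lambda>r X. \<Union>(I, f)\<in>X.
               loc_class R \<F> M I (\<lambda>x\<in>I. r \<odot>\<^bsub>torsion_quot R \<F> M\<^esub> f x))\<rparr>"

definition torsion_quot_map ::
  "('r, 'p) ring_scheme \<Rightarrow> 'r set set \<Rightarrow> ('r, 'm, 'k) module_scheme \<Rightarrow> ('r, 'n, 'l) module_scheme
     \<Rightarrow> ('m \<Rightarrow> 'n) \<Rightarrow> 'm set \<Rightarrow> 'n set"
  where
  "torsion_quot_map R \<F> M N u =
     (\<lambda>X\<in>carrier (torsion_quot R \<F> M). \<Union>x\<in>X. torsion R \<F> N +>\<^bsub>N\<^esub> u x)"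

definition loc_map ::
  "('r, 'p) ring_scheme \<Rightarrow> 'r set set \<Rightarrow> ('r, 'm, 'k) module_scheme \<Rightarrow> ('r, 'n, 'l) module_scheme
     \<Rightarrow> ('m \<Rightarrow> 'n) \<Rightarrow> ('r set \<times> ('r \<Rightarrow> 'm set)) set \<Rightarrow> ('r set \<times> ('r \<Rightarrow> 'n set)) set"
  where
  "loc_map R \<F> M N u =
     (\<lambda>X\<in>carrier (loc R \<F> M).
        \<Union>(I, f)\<in>X. loc_class R \<F> N I (\<lambda>x\<in>I. torsion_quot_map R \<F> M N u (f x)))"


section \<open>Extension of scalars\<close>

definition ext_scalars ::
  "('r, 'p) ring_scheme \<Rightarrow> ('s, 'q) ring_scheme \<Rightarrow> ('r \<Rightarrow> 's) \<Rightarrow> ('r, 'm, 'k) module_scheme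
     \<Rightarrow> ('r, ('s \<times> 'm \<Rightarrow>\<^sub>0 int) set) module"
  where
  "ext_scalars R S \<phi> M = tensor R (restr_module \<phi> S) M"

definition ext_unit ::
  "('r, 'p) ring_scheme \<Rightarrow> ('s, 'q) ring_scheme \<Rightarrow> ('r \<Rightarrow> 's) \<Rightarrow> ('r, 'm, 'k) module_scheme
     \<Rightarrow> 'm \<Rightarrow> ('s \<times> 'm \<Rightarrow>\<^sub>0 int) set"
  where
  "ext_unit R S \<phi> M = (\<lambda>m\<in>carrier M. tensor_elem R (restr_module \<phi> S) M \<one>\<^bsub>S\<^esub> m)"

end

theory Submission
  imports Defs
begin

text \<open>
  Let \<open>\<F>\<close> be the set of ideals \<open>I\<close> of \<open>R\<close> with \<open>I S = S\<close>. Its closure properties rest on one observation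
  (\<open>image_subset_by_colon\<close>): if \<open>C S = S\<close> and \<open>\<phi>(C j)\<close> lies in an ideal \<open>K\<close> of \<open>S\<close>, then \<open>\<phi>(j)\<close> lies in
  \<open>K\<close>. With \<open>C = I\<close> it shows that \<open>\<F>\<close> is closed under intersections, and with \<open>C = (I : j)\<close> that
  \<open>\<F>.\<F> \<subseteq> \<F>\<close>; the reverse inclusion holds since \<open>R \<in> \<F>\<close>.

  Idempotence amounts to Gabriel's condition (\<open>mem_trans\<close>): an ideal \<open>I\<close> belongs to
  \<open>\<F>\<close> as soon as \<open>(I : j) \<in> \<F>\<close> for all \<open>j\<close> in some member of \<open>\<F>\<close>. It makes \<open>M / \<F>(M)\<close> torsion-free, and it
  implies that localization turns every linear map with torsion kernel and torsion cokernel into an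
  isomorphism (\<open>loc_map_iso\<close>). This holds for every idempotent topologizing system.

  It remains to see that the kernel and the cokernel of \<open>\<eta> : M \<rightarrow> S \<otimes> M\<close> are torsion when \<open>\<phi>\<close> is a flat
  epimorphism. Flatness controls the kernel (\<open>flat_ann_mem\<close>): if \<open>1 \<otimes> m = 0\<close>, then \<open>1\<close> is zero in
  \<open>S \<otimes> R m = S / Ann(m) S\<close>, so \<open>Ann(m) \<in> \<F>\<close>. For the cokernel, \<open>\<phi>\<close> being an epimorphism means that
  \<open>s \<otimes> 1 = 1 \<otimes> s\<close> in \<open>S \<otimes>\<^sub>R S\<close> (\<open>epi_tensor_symmetric\<close>). Hence \<open>1 \<otimes> [s] = s \<otimes> [1] = 0\<close> in \<open>S \<otimes> S/\<phi>(R)\<close>, and the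
  result on kernels, applied to the module \<open>S / \<phi>(R)\<close>, shows that the ideal of all \<open>r\<close> with
  \<open>\<phi>(r) s \<in> \<phi>(R)\<close> is in \<open>\<F>\<close> (\<open>flat_epi_fractions\<close>). As \<open>r (s \<otimes> m) = 1 \<otimes> r' m\<close> whenever \<open>\<phi>(r) s = \<phi>(r')\<close>, the
  cokernel of \<open>\<eta>\<close> is torsion for every \<open>M\<close>. The same two facts say that \<open>\<phi>\<close> itself, as a map
  \<open>R \<rightarrow> S\<close>, has torsion kernel and cokernel, which gives the last assertion.
\<close>

section \<open>Quotient modules\<close>

text \<open>
  The laws that relate different scalars are required modulo \<open>N\<close> instead of in \<open>M\<close>, in order to treat two quotients at once: a
  module modulo a submodule, and formal sums modulo the tensor relators, where \<open>M\<close> is not a module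
  before the quotient is taken.
\<close>

locale module_modulo =
  abelian_subgroup N M + R: cring R
  for R :: "('r, 'p) ring_scheme" and M :: "('r, 'm, 'k) module_scheme" (structure) and N :: "'m set" +
  assumes smult_closed: "r \<in> carrier R \<Longrightarrow> x \<in> carrier M \<Longrightarrow> r \<odot> x \<in> carrier M"
    and smult_add:
      "r \<in> carrier R \<Longrightarrow> x \<in> carrier M \<Longrightarrow> y \<in> carrier M \<Longrightarrow> r \<odot> (x \<oplus> y) = r \<odot> x \<oplus> r \<odot> y"
    and smult_stable: "r \<in> carrier R \<Longrightarrow> x \<in> N \<Longrightarrow> r \<odot> x \<in> N"
    and smult_distr_mod:
      "r \<in> carrier R \<Longrightarrow> s \<in> carrier R \<Longrightarrow> x \<in> carrier M
        \<Longrightarrow> (r \<oplus>\<^bsub>R\<^esub> s) \<odot> x \<ominus> (r \<odot> x \<oplus> s \<odot> x) \<in> N"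
    and smult_assoc_mod:
      "r \<in> carrier R \<Longrightarrow> s \<in> carrier R \<Longrightarrow> x \<in> carrier M
        \<Longrightarrow> (r \<otimes>\<^bsub>R\<^esub> s) \<odot> x \<ominus> r \<odot> (s \<odot> x) \<in> N"
    and smult_one_mod: "x \<in> carrier M \<Longrightarrow> \<one>\<^bsub>R\<^esub> \<odot> x \<ominus> x \<in> N"
begin

lemma coset_eq_iff:
  assumes "x \<in> carrier M" "y \<in> carrier M"
  shows "N +> x = N +> y \<longleftrightarrow> x \<ominus> y \<in> N"
  using a_rcos_module[OF assms(2,1)] a_repr_independence'[of x y] a_rcos_self[of x] assms
  by (auto simp: a_minus_def)

lemma carrier_quot: "carrier (quot_module M N) = (\<lambda>x. N +> x) ` carrier M"
  by (auto simp: quot_module_def A_RCOSETS_def')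

lemma quot_add:
  assumes "x \<in> carrier M" "y \<in> carrier M"
  shows "(N +> x) \<oplus>\<^bsub>quot_module M N\<^esub> (N +> y) = N +> (x \<oplus> y)"
  using a_rcos_sum[OF assms] by (simp add: quot_module_def)

lemma quot_zero: "\<zero>\<^bsub>quot_module M N\<^esub> = N +> \<zero>"
  using a_coset_add_zero[OF a_subset] by (simp add: quot_module_def)

lemma coset_eq_zero_iff:
  assumes "x \<in> carrier M"
  shows "N +> x = \<zero>\<^bsub>quot_module M N\<^esub> \<longleftrightarrow> x \<in> N"
  using a_coset_join1[OF _ assms a_subgroup] a_coset_join2[OF assms a_subgroup]
  by (auto simp: quot_module_def)

lemma quot_smult:
  assumes r: "r \<in> carrier R" and x: "x \<in> carrier M"
  shows "r \<odot>\<^bsub>quot_module M N\<^esub> (N +> x) = N +> (r \<odot> x)"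
proof -
  have "N +> (r \<odot> y) = N +> (r \<odot> x)" if "y \<in> N +> x" for y
  proof -
    obtain n where n: "n \<in> N" "y = n \<oplus> x" using \<open>y \<in> N +> x\<close> by (auto simp: a_r_coset_def')
    have nM: "n \<in> carrier M" "r \<odot> n \<in> carrier M" using n r smult_closed by auto
    have "r \<odot> y \<ominus> r \<odot> x = r \<odot> n"
      using nM n x r smult_closed[OF r x] by (simp add: smult_add a_minus_def a_assoc r_neg)
    then show ?thesis
      using coset_eq_iff[of "r \<odot> y" "r \<odot> x"] smult_stable[OF r n(1)] n nM x smult_closed[OF r] by simp
  qed
  then have "(\<Union>y\<in>N +> x. N +> (r \<odot> y)) = (\<Union>y\<in>N +> x. N +> (r \<odot> x))"
    by (intro SUP_cong refl)
  also have "\<dots> = N +> (r \<odot> x)"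
    using a_rcos_self[OF x] by (subst UN_constant) auto
  finally show ?thesis by (simp add: quot_module_def)
qed

lemma quot_is_module: "module R (quot_module M N)"
proof (rule moduleI)
  show "cring R" by (rule R.is_cring)
  show "abelian_group (quot_module M N)"
  proof (rule abelian_groupI)
    fix X assume "X \<in> carrier (quot_module M N)"
    then obtain x where x: "x \<in> carrier M" "X = N +> x" by (auto simp: carrier_quot)
    then show "\<exists>Y\<in>carrier (quot_module M N). Y \<oplus>\<^bsub>quot_module M N\<^esub> X = \<zero>\<^bsub>quot_module M N\<^esub>"
      by (intro bexI[of _ "N +> \<ominus> x"]) (auto simp: carrier_quot quot_add quot_zero l_neg)
  qed (auto simp: carrier_quot quot_add quot_zero a_ac)
qed (clarsimp simp: carrier_quot quot_add quot_smult smult_closed smult_add coset_eq_iff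
    smult_distr_mod smult_assoc_mod smult_one_mod)+

lemma coset_linear: "is_linear R M (quot_module M N) (\<lambda>x. N +> x)"
  by (auto simp: is_linear_def carrier_quot quot_add quot_smult)

end

lemma submodule_module_modulo:
  assumes "module R M" "submodule N R M"
  shows "module_modulo R M N"
proof -
  interpret module R M by fact
  interpret N: submodule N R M by fact
  interpret abelian_subgroup N M
    by (rule abelian_subgroupI2[OF a_comm_group N.subgroup_axioms])
  show ?thesis
    by unfold_locales
      (auto simp: smult_l_distr smult_r_distr smult_assoc1 a_minus_def M.r_neg N.smult_closed)
qed

section \<open>Linear maps, and ideals as submodules\<close>

lemma is_linear_zero:
  assumes "module R M" "module R N" "is_linear R M N u"
  shows "u \<zero>\<^bsub>M\<^esub> = \<zero>\<^bsub>N\<^esub>"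
proof -
  interpret M: module R M by fact
  interpret N: module R N by fact
  show ?thesis
    using is_linearD(3)[OF assms(3), of "\<zero>\<^bsub>R\<^esub>" "\<zero>\<^bsub>M\<^esub>"] is_linearD(1)[OF assms(3), of "\<zero>\<^bsub>M\<^esub>"] by simp
qed

lemma is_linear_diff:
  assumes "module R M" "module R N" "is_linear R M N u" "x \<in> carrier M" "y \<in> carrier M"
  shows "u (x \<ominus>\<^bsub>M\<^esub> y) = u x \<ominus>\<^bsub>N\<^esub> u y"
proof -
  interpret M: module R M by fact
  show ?thesis using assms(4,5) is_linearD(2)[OF assms(3), of x "\<ominus>\<^bsub>M\<^esub> y"]
    is_linear_uminus[OF assms(1-3), of y] by (simp add: a_minus_def)
qed

lemma linear_image_submodule:
  assumes M: "module R M" and N: "module R N" and u: "is_linear R M N u"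
  shows "submodule (u ` carrier M) R N"
proof -
  interpret M: module R M by fact
  interpret N: module R N by fact
  note uD = is_linearD[OF u]
  show ?thesis
  proof (rule N.submoduleI)
    show "\<zero>\<^bsub>N\<^esub> \<in> u ` carrier M"
      using is_linear_zero[OF M N u] by (auto intro: rev_image_eqI[of "\<zero>\<^bsub>M\<^esub>"])
    show "\<ominus>\<^bsub>N\<^esub> a \<in> u ` carrier M" if "a \<in> u ` carrier M" for a
    proof -
      from that obtain x where "a = u x" "x \<in> carrier M" by auto
      then show ?thesis using is_linear_uminus[OF M N u, of x] by (intro rev_image_eqI[of "\<ominus>\<^bsub>M\<^esub> x"]) auto
    qed
    show "a \<oplus>\<^bsub>N\<^esub> b \<in> u ` carrier M" if "a \<in> u ` carrier M" "b \<in> u ` carrier M" for a b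
    proof -
      from that obtain x y where "a = u x" "x \<in> carrier M" "b = u y" "y \<in> carrier M" by auto
      then show ?thesis using uD(2)[of x y] by (intro rev_image_eqI[of "x \<oplus>\<^bsub>M\<^esub> y"]) auto
    qed
    show "r \<odot>\<^bsub>N\<^esub> a \<in> u ` carrier M" if "r \<in> carrier R" "a \<in> u ` carrier M" for r a
    proof -
      from that obtain x where "a = u x" "x \<in> carrier M" by auto
      then show ?thesis using that(1) uD(3)[of r x] by (intro rev_image_eqI[of "r \<odot>\<^bsub>M\<^esub> x"]) auto
    qed
  qed (use uD(1) in auto)
qed

lemma restr_module_is_module:
  assumes "cring R" "cring S" "\<phi> \<in> ring_hom R S"
  shows "module R (restr_module \<phi> S)"
proof -
  interpret R: cring R by fact
  interpret S: cring S by fact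
  note hom = ring_hom_closed[OF assms(3)] ring_hom_add[OF assms(3)] ring_hom_mult[OF assms(3)]
    ring_hom_one[OF assms(3)]
  show ?thesis
  proof (rule moduleI)
    show "abelian_group (restr_module \<phi> S)"
    proof (rule abelian_groupI)
      fix x assume "x \<in> carrier (restr_module \<phi> S)"
      then show "\<exists>y\<in>carrier (restr_module \<phi> S). y \<oplus>\<^bsub>restr_module \<phi> S\<^esub> x = \<zero>\<^bsub>restr_module \<phi> S\<^esub>"
        by (intro bexI[of _ "\<ominus>\<^bsub>S\<^esub> x"]) (auto simp: restr_module_def S.l_neg)
    qed (auto simp: restr_module_def S.a_ac)
  qed (auto simp: restr_module_def hom S.l_distr S.r_distr S.m_assoc assms(1))
qed

lemma self_module_is_module: "cring R \<Longrightarrow> module R (self_module R)"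
  unfolding self_module_def by (intro restr_module_is_module) (auto simp: ring_hom_def)

lemma restr_module_simps [simp]:
  "carrier (restr_module \<phi> S) = carrier S" "add (restr_module \<phi> S) = add S"
  "zero (restr_module \<phi> S) = zero S" "r \<odot>\<^bsub>restr_module \<phi> S\<^esub> s = \<phi> r \<otimes>\<^bsub>S\<^esub> s"
  by (auto simp: restr_module_def)

lemma self_module_simps [simp]:
  "carrier (self_module R) = carrier R" "add (self_module R) = add R"
  "zero (self_module R) = zero R" "r \<odot>\<^bsub>self_module R\<^esub> s = r \<otimes>\<^bsub>R\<^esub> s"
  by (auto simp: self_module_def)

lemma ideal_module_simps [simp]:
  "carrier (ideal_module R I) = I" "add (ideal_module R I) = add R"
  "zero (ideal_module R I) = zero R" "r \<odot>\<^bsub>ideal_module R I\<^esub> s = r \<otimes>\<^bsub>R\<^esub> s"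
  by (auto simp: self_module_def restr_module_def ideal_module_def)

lemma ideal_submodule:
  fixes R (structure)
  assumes "cring R" "ideal I R"
  shows "submodule I R (self_module R)"
proof -
  interpret cring R by fact
  interpret ideal I R by fact
  interpret S: module R "self_module R" by (rule self_module_is_module) fact
  show ?thesis
  proof (rule S.submoduleI)
    fix a assume "a \<in> I"
    then have "(\<ominus> \<one>) \<otimes> a \<in> I" by (intro I_l_closed) auto
    moreover have "(\<ominus> \<one>) \<otimes> a = \<ominus>\<^bsub>self_module R\<^esub> a"
      using S.smult_l_minus[of "\<one>" a] \<open>a \<in> I\<close> Icarr by simp
    ultimately show "\<ominus>\<^bsub>self_module R\<^esub> a \<in> I" by simp
  qed (auto intro: I_l_closed Icarr)
qed

lemma ideal_module_is_module: "cring R \<Longrightarrow> ideal I R \<Longrightarrow> module R (ideal_module R I)"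
  unfolding ideal_module_def
  by (rule submodule.submodule_is_module[OF ideal_submodule self_module_is_module])

lemma (in cring) idealI_smult:
  assumes "I \<subseteq> carrier R" "\<zero> \<in> I" "\<And>a b. a \<in> I \<Longrightarrow> b \<in> I \<Longrightarrow> a \<oplus> b \<in> I"
    and m: "\<And>a r. a \<in> I \<Longrightarrow> r \<in> carrier R \<Longrightarrow> r \<otimes> a \<in> I"
  shows "ideal I R"
proof (intro idealI subgroup.intro)
  show "inv\<^bsub>add_monoid R\<^esub> a \<in> I" if "a \<in> I" for a
  proof -
    have "\<ominus> a = (\<ominus> \<one>) \<otimes> a" using that assms(1) by (auto simp: l_minus)
    then show ?thesis using m[OF that, of "\<ominus> \<one>"] by (simp flip: a_inv_def)
  qed
  show "a \<otimes> r \<in> I" if "a \<in> I" "r \<in> carrier R" for a r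
    using m[OF that] that assms(1) by (auto simp: m_comm)
qed (use assms in \<open>auto simp: ring_axioms\<close>)

lemma (in module) colon_ideal:
  assumes H: "submodule H R M" and x: "x \<in> carrier M"
  shows "ideal {r \<in> carrier R. r \<odot>\<^bsub>M\<^esub> x \<in> H} R"
proof -
  interpret H: submodule H R M by fact
  have z: "\<zero>\<^bsub>M\<^esub> \<in> H" using H.one_closed by simp
  show ?thesis
    by (rule R.idealI_smult) (use x z submoduleE(5)[OF H] in \<open>auto simp: smult_l_distr smult_assoc1\<close>)
qed

lemma (in cring) colon_ideal_ideal:
  assumes "ideal I R" "x \<in> carrier R"
  shows "ideal {r \<in> carrier R. r \<otimes> x \<in> I} R"
proof -
  interpret M: module R "self_module R" by (rule self_module_is_module) (rule is_cring)
  show ?thesis using M.colon_ideal[OF ideal_submodule[OF is_cring assms(1)]] assms(2) by simp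
qed

lemma (in module) zero_submodule: "submodule {\<zero>\<^bsub>M\<^esub>} R M"
  by (rule submoduleI) auto

lemma (in module) ann_ideal:
  assumes "x \<in> carrier M"
  shows "ideal (ann R M x) R"
  using colon_ideal[OF zero_submodule assms] by (simp add: ann_def)

section \<open>Idempotent topologizing systems\<close>

text \<open>
  The annihilator of the class of \<open>j\<close> in \<open>J/I\<close> is the colon ideal \<open>(I : j)\<close>. This turns the product of
  systems into a statement about ideals of \<open>R\<close> alone.
\<close>

lemma (in cring) negligible_quot_iff:
  assumes I: "ideal I R" and J: "ideal J R" and IJ: "I \<subseteq> J"
  shows "negligible R \<F> (quot_module (ideal_module R J) I) \<longleftrightarrow>
    (\<forall>j\<in>J. {r \<in> carrier R. r \<otimes> j \<in> I} \<in> \<F>)"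
proof -
  interpret I: ideal I R by fact
  interpret J: ideal J R by fact
  interpret J: module R "ideal_module R J" by (rule ideal_module_is_module[OF is_cring J])
  have sub: "submodule I R (ideal_module R J)"
  proof (rule J.submoduleI)
    fix a assume a: "a \<in> I"
    have "\<ominus>\<^bsub>ideal_module R J\<^esub> a = (\<ominus> \<one>) \<otimes> a"
      using J.smult_l_minus[of \<one> a] a IJ by auto
    then show "\<ominus>\<^bsub>ideal_module R J\<^esub> a \<in> I" using a I.I_l_closed by simp
  qed (use IJ I.I_l_closed in auto)
  interpret Q: module_modulo R "ideal_module R J" I
    by (rule submodule_module_modulo[OF J.module_axioms sub])
  have "r \<odot>\<^bsub>quot_module (ideal_module R J) I\<^esub> (I +>\<^bsub>ideal_module R J\<^esub> j) = \<zero>\<^bsub>quot_module (ideal_module R J) I\<^esub>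
      \<longleftrightarrow> r \<otimes> j \<in> I" if "r \<in> carrier R" "j \<in> J" for r j
  proof -
    have "r \<otimes> j \<in> J" using that J.I_l_closed by blast
    then show ?thesis using that Q.coset_eq_zero_iff[of "r \<otimes> j"] Q.quot_smult[of r j] by simp
  qed
  then have "ann R (quot_module (ideal_module R J) I) (I +>\<^bsub>ideal_module R J\<^esub> j)
      = {r \<in> carrier R. r \<otimes> j \<in> I}" if "j \<in> J" for j
    using that by (auto simp: ann_def)
  then show ?thesis by (simp add: negligible_def Q.carrier_quot)
qed

locale gabriel_system = cring R for R :: "('r, 'p) ring_scheme" (structure) +
  fixes \<F> :: "'r set set"
  assumes top: "topologizing_system R \<F>" and idem: "idempotent_system R \<F>"
begin

lemma mem_ideal: "I \<in> \<F> \<Longrightarrow> ideal I R"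
  using top unfolding topologizing_system_def by blast

lemma mem_up: "I \<in> \<F> \<Longrightarrow> ideal J R \<Longrightarrow> I \<subseteq> J \<Longrightarrow> J \<in> \<F>"
  using top unfolding topologizing_system_def by blast

lemma mem_Int: "I \<in> \<F> \<Longrightarrow> J \<in> \<F> \<Longrightarrow> I \<inter> J \<in> \<F>"
  using top unfolding topologizing_system_def by blast

lemma mem_carrier: "I \<in> \<F> \<Longrightarrow> x \<in> I \<Longrightarrow> x \<in> carrier R"
  using ideal.Icarr[OF mem_ideal] .

lemma carrier_mem: "carrier R \<in> \<F>"
proof -
  obtain I where "I \<in> \<F>" using top by (auto simp: topologizing_system_def)
  then show ?thesis using mem_up oneideal mem_carrier by blast
qed

text \<open>
  Gabriel's condition, the form in which idempotence enters the localization. The quotient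
  \<open>J / (I \<inter> J)\<close> is negligible because \<open>(I \<inter> J : j) = (I : j)\<close> for \<open>j \<in> J\<close>, so \<open>I \<inter> J\<close> lies in
  \<open>\<F>.\<F> = \<F>\<close>.
\<close>

lemma mem_trans:
  assumes I: "ideal I R" and J: "J \<in> \<F>" and c: "\<And>j. j \<in> J \<Longrightarrow> {r \<in> carrier R. r \<otimes> j \<in> I} \<in> \<F>"
  shows "I \<in> \<F>"
proof -
  interpret J: ideal J R by (rule mem_ideal[OF J])
  have IJ: "ideal (I \<inter> J) R" by (rule i_intersect[OF I mem_ideal[OF J]])
  have "{r \<in> carrier R. r \<otimes> j \<in> I \<inter> J} = {r \<in> carrier R. r \<otimes> j \<in> I}" if "j \<in> J" for j
    using J.I_l_closed[OF that] by auto
  then have "I \<inter> J \<in> system_prod R \<F> \<F>"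
    using IJ J c unfolding system_prod_def
    by (auto simp: negligible_quot_iff[OF IJ mem_ideal[OF J]] intro!: bexI[of _ J])
  then have "I \<inter> J \<in> \<F>" using idem by (simp add: idempotent_system_def)
  then show ?thesis by (rule mem_up[OF _ I]) simp
qed

lemma torsionI:
  assumes M: "module R M" and x: "x \<in> carrier M" and J: "J \<in> \<F>"
    and "\<And>r. r \<in> J \<Longrightarrow> r \<odot>\<^bsub>M\<^esub> x = \<zero>\<^bsub>M\<^esub>"
  shows "x \<in> torsion R \<F> M"
proof -
  have "J \<subseteq> ann R M x" using assms(4) mem_carrier[OF J] by (auto simp: ann_def)
  then show ?thesis using mem_up[OF J module.ann_ideal[OF M x]] x by (simp add: torsion_def)
qed

lemma torsion_submodule:
  assumes M: "module R M"
  shows "submodule (torsion R \<F> M) R M"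
proof -
  interpret M: module R M by fact
  have tD: "x \<in> carrier M" "ann R M x \<in> \<F>" if "x \<in> torsion R \<F> M" for x
    using that by (auto simp: torsion_def)
  have smult: "a \<odot>\<^bsub>M\<^esub> x \<in> torsion R \<F> M" if a: "a \<in> carrier R" and x: "x \<in> torsion R \<F> M" for a x
  proof -
    have "r \<odot>\<^bsub>M\<^esub> (a \<odot>\<^bsub>M\<^esub> x) = a \<odot>\<^bsub>M\<^esub> (r \<odot>\<^bsub>M\<^esub> x)" if "r \<in> carrier R" for r
      using a tD(1)[OF x] that by (simp add: m_comm flip: M.smult_assoc1)
    then show ?thesis
      by (intro torsionI[OF M _ tD(2)[OF x]]) (use a tD(1)[OF x] in \<open>auto simp: ann_def\<close>)
  qed
  show ?thesis
  proof (rule M.submoduleI)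
    show "\<zero>\<^bsub>M\<^esub> \<in> torsion R \<F> M"
      by (rule torsionI[OF M _ carrier_mem]) auto
  next
    fix x assume x: "x \<in> torsion R \<F> M"
    show "\<ominus>\<^bsub>M\<^esub> x \<in> torsion R \<F> M"
      using smult[OF _ x, of "\<ominus> \<one>"] tD(1)[OF x] by (simp add: M.smult_l_minus)
  next
    fix x y assume x: "x \<in> torsion R \<F> M" and y: "y \<in> torsion R \<F> M"
    show "x \<oplus>\<^bsub>M\<^esub> y \<in> torsion R \<F> M"
      by (rule torsionI[OF M _ mem_Int[OF tD(2)[OF x] tD(2)[OF y]]])
        (use tD(1)[OF x] tD(1)[OF y] in \<open>auto simp: M.smult_r_distr ann_def\<close>)
  qed (use tD(1) smult in auto)
qed

text \<open>
  Gabriel's condition for elements: \<open>M / \<F>(M)\<close> has no torsion left.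
\<close>

lemma torsion_of_multiples:
  assumes M: "module R M" and x: "x \<in> carrier M" and J: "J \<in> \<F>"
    and t: "\<And>r. r \<in> J \<Longrightarrow> r \<odot>\<^bsub>M\<^esub> x \<in> torsion R \<F> M"
  shows "x \<in> torsion R \<F> M"
proof -
  interpret M: module R M by fact
  have "ann R M x \<in> \<F>"
  proof (rule mem_trans[OF M.ann_ideal[OF x] J])
    fix j assume j: "j \<in> J"
    then have "{r \<in> carrier R. r \<otimes> j \<in> ann R M x} = ann R M (j \<odot>\<^bsub>M\<^esub> x)"
      using x mem_carrier[OF J j] by (auto simp: ann_def M.smult_assoc1)
    then show "{r \<in> carrier R. r \<otimes> j \<in> ann R M x} \<in> \<F>" using t[OF j] by (simp add: torsion_def)
  qed
  then show ?thesis using x by (simp add: torsion_def)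
qed

lemma torsion_modulo: "module R M \<Longrightarrow> module_modulo R M (torsion R \<F> M)"
  by (rule submodule_module_modulo[OF _ torsion_submodule])

lemma torsion_quot_is_module: "module R M \<Longrightarrow> module R (torsion_quot R \<F> M)"
  unfolding torsion_quot_def by (rule module_modulo.quot_is_module[OF torsion_modulo])

end

section \<open>Gabriel localization\<close>

context gabriel_system
begin

abbreviation torsion_coset :: "('r, 'm, 'k) module_scheme \<Rightarrow> 'm \<Rightarrow> 'm set" where
  "torsion_coset M x \<equiv> torsion R \<F> M +>\<^bsub>M\<^esub> x"

lemma carrier_torsion_quot:
  "module R M \<Longrightarrow> carrier (torsion_quot R \<F> M) = torsion_coset M ` carrier M"
  unfolding torsion_quot_def by (rule module_modulo.carrier_quot[OF torsion_modulo])

lemma torsion_quot_add: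
  "module R M \<Longrightarrow> x \<in> carrier M \<Longrightarrow> y \<in> carrier M
    \<Longrightarrow> torsion_coset M x \<oplus>\<^bsub>torsion_quot R \<F> M\<^esub> torsion_coset M y = torsion_coset M (x \<oplus>\<^bsub>M\<^esub> y)"
  unfolding torsion_quot_def by (rule module_modulo.quot_add[OF torsion_modulo])

lemma torsion_quot_smult:
  "module R M \<Longrightarrow> r \<in> carrier R \<Longrightarrow> x \<in> carrier M
    \<Longrightarrow> r \<odot>\<^bsub>torsion_quot R \<F> M\<^esub> torsion_coset M x = torsion_coset M (r \<odot>\<^bsub>M\<^esub> x)"
  unfolding torsion_quot_def by (rule module_modulo.quot_smult[OF torsion_modulo])

lemma torsion_quot_eq_iff:
  "module R M \<Longrightarrow> x \<in> carrier M \<Longrightarrow> y \<in> carrier M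
    \<Longrightarrow> torsion_coset M x = torsion_coset M y \<longleftrightarrow> x \<ominus>\<^bsub>M\<^esub> y \<in> torsion R \<F> M"
  by (rule module_modulo.coset_eq_iff[OF torsion_modulo])

lemma torsion_map:
  assumes "module R M" "module R N" "is_linear R M N u" "x \<in> torsion R \<F> M"
  shows "u x \<in> torsion R \<F> N"
proof (rule torsionI[OF assms(2)])
  have x: "x \<in> carrier M" "ann R M x \<in> \<F>" using assms(4) by (auto simp: torsion_def)
  then show "u x \<in> carrier N" by (simp add: is_linearD[OF assms(3)])
  show "ann R M x \<in> \<F>" by fact
  show "r \<odot>\<^bsub>N\<^esub> u x = \<zero>\<^bsub>N\<^esub>" if "r \<in> ann R M x" for r
    using that x is_linear_zero[OF assms(1-3)] by (auto simp: ann_def simp flip: is_linearD(3)[OF assms(3)])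
qed

lemma torsion_quot_map_coset:
  assumes M: "module R M" and N: "module R N" and u: "is_linear R M N u" and x: "x \<in> carrier M"
  shows "torsion_quot_map R \<F> M N u (torsion_coset M x) = torsion_coset N (u x)"
proof -
  interpret M: module_modulo R M "torsion R \<F> M" by (rule torsion_modulo[OF M])
  have "torsion_coset N (u y) = torsion_coset N (u x)" if "y \<in> torsion_coset M x" for y
  proof -
    have y: "y \<in> carrier M" using that M.a_elemrcos_carrier[OF x] by blast
    have "y \<ominus>\<^bsub>M\<^esub> x \<in> torsion R \<F> M" using M.a_rcos_module_imp[OF x that] by (simp add: a_minus_def)
    then have "u y \<ominus>\<^bsub>N\<^esub> u x \<in> torsion R \<F> N"
      using torsion_map[OF M N u] is_linear_diff[OF M N u y x] by fastforce
    then show ?thesis using torsion_quot_eq_iff[OF N] is_linearD(1)[OF u] x y by simp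
  qed
  then have "(\<Union>y\<in>torsion_coset M x. torsion_coset N (u y)) = (\<Union>y\<in>torsion_coset M x. torsion_coset N (u x))"
    by (intro SUP_cong refl)
  also have "\<dots> = torsion_coset N (u x)"
    using M.a_rcos_self[OF x] by (subst UN_constant) auto
  finally show ?thesis using x by (simp add: torsion_quot_map_def carrier_torsion_quot[OF M])
qed

lemma torsion_quot_map_linear:
  assumes M: "module R M" and N: "module R N" and u: "is_linear R M N u"
  shows "is_linear R (torsion_quot R \<F> M) (torsion_quot R \<F> N) (torsion_quot_map R \<F> M N u)"
proof -
  interpret M: module R M by fact
  show ?thesis
    unfolding is_linear_def
    by (auto simp: carrier_torsion_quot M N torsion_quot_map_coset[OF M N u] torsion_quot_add torsion_quot_smult
        is_linearD[OF u])
qed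

lemma loc_pairs_iff:
  "(I, f) \<in> loc_pairs R \<F> M \<longleftrightarrow>
    I \<in> \<F> \<and> f \<in> extensional I \<and> is_linear R (ideal_module R I) (torsion_quot R \<F> M) f"
  by (auto simp: loc_pairs_def linear_maps_def)

lemma add_loc_pair:
  assumes "module R M" "(I, f) \<in> loc_pairs R \<F> M" "(J, g) \<in> loc_pairs R \<F> M"
  shows "(I \<inter> J, \<lambda>x\<in>I \<inter> J. f x \<oplus>\<^bsub>torsion_quot R \<F> M\<^esub> g x) \<in> loc_pairs R \<F> M"
proof -
  have IJ: "I \<inter> J \<in> \<F>" using assms(2,3) mem_Int by (simp add: loc_pairs_iff)
  interpret K: ideal "I \<inter> J" R by (rule mem_ideal) fact
  interpret Q: module R "torsion_quot R \<F> M" by (rule torsion_quot_is_module) fact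
  have f: "is_linear R (ideal_module R I) (torsion_quot R \<F> M) f"
    and g: "is_linear R (ideal_module R J) (torsion_quot R \<F> M) g"
    using assms(2,3) by (auto simp: loc_pairs_iff)
  note fD = is_linearD[OF f, simplified] and gD = is_linearD[OF g, simplified]
  have cl: "r \<in> carrier R \<Longrightarrow> r \<otimes> x \<in> I" "r \<in> carrier R \<Longrightarrow> r \<otimes> x \<in> J"
    "y \<in> I \<Longrightarrow> y \<in> J \<Longrightarrow> x \<oplus> y \<in> I" "y \<in> I \<Longrightarrow> y \<in> J \<Longrightarrow> x \<oplus> y \<in> J"
    if "x \<in> I" "x \<in> J" for r x y
    using K.I_l_closed[of x r] K.a_closed[of x y] that by auto
  show ?thesis
    unfolding loc_pairs_iff is_linear_def
    by (auto simp: IJ fD gD cl Q.smult_r_distr Q.M.a_ac)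
qed

lemma smult_loc_pair:
  assumes "module R M" "(I, f) \<in> loc_pairs R \<F> M" "r \<in> carrier R"
  shows "(I, \<lambda>x\<in>I. r \<odot>\<^bsub>torsion_quot R \<F> M\<^esub> f x) \<in> loc_pairs R \<F> M"
proof -
  have I: "I \<in> \<F>" using assms(2) by (simp add: loc_pairs_iff)
  interpret I: ideal I R by (rule mem_ideal) fact
  interpret Q: module R "torsion_quot R \<F> M" by (rule torsion_quot_is_module) fact
  have f: "is_linear R (ideal_module R I) (torsion_quot R \<F> M) f"
    using assms(2) by (auto simp: loc_pairs_iff)
  note fD = is_linearD[OF f, simplified]
  have "r \<odot>\<^bsub>torsion_quot R \<F> M\<^esub> (s \<odot>\<^bsub>torsion_quot R \<F> M\<^esub> y) = s \<odot>\<^bsub>torsion_quot R \<F> M\<^esub> (r \<odot>\<^bsub>torsion_quot R \<F> M\<^esub> y)"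
    if "s \<in> carrier R" "y \<in> carrier (torsion_quot R \<F> M)" for s y
    using that assms(3) by (simp add: m_comm flip: Q.smult_assoc1)
  then show ?thesis
    unfolding loc_pairs_iff is_linear_def
    by (auto simp: I fD assms(3) I.I_l_closed Q.smult_r_distr)
qed

lemma map_loc_pair:
  assumes M: "module R M" and N: "module R N" and u: "is_linear R M N u"
    and f: "(I, f) \<in> loc_pairs R \<F> M"
  shows "(I, \<lambda>x\<in>I. torsion_quot_map R \<F> M N u (f x)) \<in> loc_pairs R \<F> N"
proof -
  have I: "I \<in> \<F>" "is_linear R (ideal_module R I) (torsion_quot R \<F> M) f"
    using f by (auto simp: loc_pairs_iff)
  have "is_linear R (ideal_module R I) (torsion_quot R \<F> N) (\<lambda>x. torsion_quot_map R \<F> M N u (f x))"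
    by (rule is_linear_comp[OF I(2) torsion_quot_map_linear[OF M N u]])
  then have "is_linear R (ideal_module R I) (torsion_quot R \<F> N) (\<lambda>x\<in>I. torsion_quot_map R \<F> M N u (f x))"
    by (rule iffD1[OF is_linear_cong[OF ideal_module_is_module[OF is_cring mem_ideal[OF I(1)]]], rotated]) simp
  then show ?thesis using I(1) by (simp add: loc_pairs_iff)
qed

lemma loc_relI:
  assumes "(I, f) \<in> loc_pairs R \<F> M" "(J, g) \<in> loc_pairs R \<F> M"
    and "K \<in> \<F>" "K \<subseteq> I" "K \<subseteq> J" "\<And>x. x \<in> K \<Longrightarrow> f x = g x"
  shows "((I, f), (J, g)) \<in> loc_rel R \<F> M"
  using assms unfolding loc_rel_def by (auto intro!: bexI[of _ K] restrict_ext)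

lemma loc_relE:
  assumes "((I, f), (J, g)) \<in> loc_rel R \<F> M"
  obtains K where "(I, f) \<in> loc_pairs R \<F> M" "(J, g) \<in> loc_pairs R \<F> M"
    "K \<in> \<F>" "K \<subseteq> I" "K \<subseteq> J" "\<And>x. x \<in> K \<Longrightarrow> f x = g x"
  using assms unfolding loc_rel_def by (auto simp: restrict_def fun_eq_iff) metis

text \<open>
  Transitivity uses the closure of \<open>\<F>\<close> under intersections: two agreements hold together on the
  intersection of their ideals.
\<close>

lemma equiv_loc_rel: "equiv (loc_pairs R \<F> M) (loc_rel R \<F> M)"
proof (intro equivI)
  show "loc_rel R \<F> M \<subseteq> loc_pairs R \<F> M \<times> loc_pairs R \<F> M"
    by (auto simp: loc_rel_def)
  show "refl_on (loc_pairs R \<F> M) (loc_rel R \<F> M)"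
  proof (rule refl_onI)
    fix p assume p: "p \<in> loc_pairs R \<F> M"
    obtain I f where "p = (I, f)" by (cases p)
    with p show "(p, p) \<in> loc_rel R \<F> M" by (auto intro!: loc_relI[of I f _ I f I] simp: loc_pairs_iff)
  qed
  show "sym (loc_rel R \<F> M)"
  proof (rule symI)
    fix p q assume pq: "(p, q) \<in> loc_rel R \<F> M"
    obtain I f J g where "p = (I, f)" "q = (J, g)" by (cases p, cases q)
    with pq show "(q, p) \<in> loc_rel R \<F> M" by (auto elim!: loc_relE intro: loc_relI)
  qed
  show "trans (loc_rel R \<F> M)"
  proof (rule transI)
    fix p q s assume pq: "(p, q) \<in> loc_rel R \<F> M" and qs: "(q, s) \<in> loc_rel R \<F> M"
    obtain I f J g L h where eq: "p = (I, f)" "q = (J, g)" "s = (L, h)" by (cases p, cases q, cases s)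
    obtain K where K: "(I, f) \<in> loc_pairs R \<F> M" "K \<in> \<F>" "K \<subseteq> I" "\<And>x. x \<in> K \<Longrightarrow> f x = g x"
      using pq unfolding eq by (elim loc_relE) (rule that; assumption)
    obtain K' where K': "(L, h) \<in> loc_pairs R \<F> M" "K' \<in> \<F>" "K' \<subseteq> L" "\<And>x. x \<in> K' \<Longrightarrow> g x = h x"
      using qs unfolding eq by (elim loc_relE) (rule that; assumption)
    show "(p, s) \<in> loc_rel R \<F> M"
      unfolding eq using K K' by (intro loc_relI[of _ _ _ _ _ "K \<inter> K'"] mem_Int) auto
  qed
qed

lemma loc_class_eq_iff:
  assumes "(I, f) \<in> loc_pairs R \<F> M" "(J, g) \<in> loc_pairs R \<F> M"
  shows "loc_class R \<F> M I f = loc_class R \<F> M J g \<longleftrightarrow> ((I, f), (J, g)) \<in> loc_rel R \<F> M"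
  unfolding loc_class_def using eq_equiv_class_iff[OF equiv_loc_rel assms] .

lemma carrier_loc:
  "carrier (loc R \<F> M) = {loc_class R \<F> M I f | I f. (I, f) \<in> loc_pairs R \<F> M}"
  by (auto simp: loc_def loc_class_def quotient_def)

lemma loc_class_closed: "(I, f) \<in> loc_pairs R \<F> M \<Longrightarrow> loc_class R \<F> M I f \<in> carrier (loc R \<F> M)"
  by (auto simp: carrier_loc)

lemma loc_add:
  assumes M: "module R M" and f: "(I, f) \<in> loc_pairs R \<F> M" and g: "(J, g) \<in> loc_pairs R \<F> M"
  shows "loc_class R \<F> M I f \<oplus>\<^bsub>loc R \<F> M\<^esub> loc_class R \<F> M J g
    = loc_class R \<F> M (I \<inter> J) (\<lambda>x\<in>I \<inter> J. f x \<oplus>\<^bsub>torsion_quot R \<F> M\<^esub> g x)"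
proof -
  let ?F = "\<lambda>(I, f) (J, g). loc_class R \<F> M (I \<inter> J) (\<lambda>x\<in>I \<inter> J. f x \<oplus>\<^bsub>torsion_quot R \<F> M\<^esub> g x)"
  have "congruent2 (loc_rel R \<F> M) (loc_rel R \<F> M) ?F"
  proof (rule congruent2I')
    fix p p' q q' assume pp: "(p, p') \<in> loc_rel R \<F> M" and qq: "(q, q') \<in> loc_rel R \<F> M"
    obtain I f I' f' J g J' g' where eq: "p = (I, f)" "p' = (I', f')" "q = (J, g)" "q' = (J', g')"
      by (cases p, cases p', cases q, cases q')
    obtain K where K: "(I, f) \<in> loc_pairs R \<F> M" "(I', f') \<in> loc_pairs R \<F> M" "K \<in> \<F>" "K \<subseteq> I" "K \<subseteq> I'"
      "\<And>x. x \<in> K \<Longrightarrow> f x = f' x" using pp unfolding eq by (elim loc_relE) (rule that; assumption)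
    obtain L where L: "(J, g) \<in> loc_pairs R \<F> M" "(J', g') \<in> loc_pairs R \<F> M" "L \<in> \<F>" "L \<subseteq> J" "L \<subseteq> J'"
      "\<And>x. x \<in> L \<Longrightarrow> g x = g' x" using qq unfolding eq by (elim loc_relE) (rule that; assumption)
    show "?F p q = ?F p' q'"
      unfolding eq prod.case loc_class_eq_iff[OF add_loc_pair[OF M K(1) L(1)] add_loc_pair[OF M K(2) L(2)]]
      by (rule loc_relI[OF add_loc_pair[OF M K(1) L(1)] add_loc_pair[OF M K(2) L(2)] mem_Int[OF K(3) L(3)]])
        (use K L in auto)
  qed
  from UN_equiv_class2[OF equiv_loc_rel equiv_loc_rel this f g]
  show ?thesis by (simp add: loc_def loc_class_def split_def)
qed

lemma loc_smult:
  assumes M: "module R M" and r: "r \<in> carrier R" and f: "(I, f) \<in> loc_pairs R \<F> M"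
  shows "r \<odot>\<^bsub>loc R \<F> M\<^esub> loc_class R \<F> M I f
    = loc_class R \<F> M I (\<lambda>x\<in>I. r \<odot>\<^bsub>torsion_quot R \<F> M\<^esub> f x)"
proof -
  let ?F = "\<lambda>(I, f). loc_class R \<F> M I (\<lambda>x\<in>I. r \<odot>\<^bsub>torsion_quot R \<F> M\<^esub> f x)"
  have "congruent (loc_rel R \<F> M) ?F"
  proof (rule congruentI)
    fix p p' assume pp: "(p, p') \<in> loc_rel R \<F> M"
    obtain I f I' f' where eq: "p = (I, f)" "p' = (I', f')" by (cases p, cases p')
    obtain K where K: "(I, f) \<in> loc_pairs R \<F> M" "(I', f') \<in> loc_pairs R \<F> M" "K \<in> \<F>" "K \<subseteq> I" "K \<subseteq> I'"
      "\<And>x. x \<in> K \<Longrightarrow> f x = f' x" using pp unfolding eq by (elim loc_relE) (rule that; assumption)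
    show "?F p = ?F p'"
      unfolding eq prod.case loc_class_eq_iff[OF smult_loc_pair[OF M K(1) r] smult_loc_pair[OF M K(2) r]]
      by (rule loc_relI[OF smult_loc_pair[OF M K(1) r] smult_loc_pair[OF M K(2) r] K(3)])
        (use K in auto)
  qed
  from UN_equiv_class[OF equiv_loc_rel this f]
  show ?thesis by (simp add: loc_def loc_class_def)
qed

lemma loc_map_class:
  assumes M: "module R M" and N: "module R N" and u: "is_linear R M N u"
    and f: "(I, f) \<in> loc_pairs R \<F> M"
  shows "loc_map R \<F> M N u (loc_class R \<F> M I f)
    = loc_class R \<F> N I (\<lambda>x\<in>I. torsion_quot_map R \<F> M N u (f x))"
proof -
  let ?F = "\<lambda>(I, f). loc_class R \<F> N I (\<lambda>x\<in>I. torsion_quot_map R \<F> M N u (f x))"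
  note mp = map_loc_pair[OF M N u]
  have "congruent (loc_rel R \<F> M) ?F"
  proof (rule congruentI)
    fix p p' assume pp: "(p, p') \<in> loc_rel R \<F> M"
    obtain I f I' f' where eq: "p = (I, f)" "p' = (I', f')" by (cases p, cases p')
    obtain K where K: "(I, f) \<in> loc_pairs R \<F> M" "(I', f') \<in> loc_pairs R \<F> M" "K \<in> \<F>" "K \<subseteq> I" "K \<subseteq> I'"
      "\<And>x. x \<in> K \<Longrightarrow> f x = f' x" using pp unfolding eq by (elim loc_relE) (rule that; assumption)
    show "?F p = ?F p'"
      unfolding eq prod.case loc_class_eq_iff[OF mp[OF K(1)] mp[OF K(2)]]
      by (rule loc_relI[OF mp[OF K(1)] mp[OF K(2)] K(3)]) (use K in auto)
  qed
  from UN_equiv_class[OF equiv_loc_rel this f]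
  have "(\<Union>p\<in>loc_class R \<F> M I f. ?F p) = ?F (I, f)" by (simp add: loc_class_def)
  with loc_class_closed[OF f] show ?thesis by (simp add: loc_map_def)
qed

lemma loc_map_linear:
  assumes M: "module R M" and N: "module R N" and u: "is_linear R M N u"
  shows "loc_map R \<F> M N u \<in> linear_maps R (loc R \<F> M) (loc R \<F> N)"
proof -
  note mc = loc_map_class[OF M N u] and mp = map_loc_pair[OF M N u]
  note t = is_linearD[OF torsion_quot_map_linear[OF M N u]]
  have val: "f x \<in> carrier (torsion_quot R \<F> M)" if "(I, f) \<in> loc_pairs R \<F> M" "x \<in> I" for I f x
    using that is_linearD(1)[of R "ideal_module R I" _ f x] by (auto simp: loc_pairs_iff)
  show ?thesis
    unfolding linear_maps_def is_linear_def
  proof (intro CollectI conjI funcsetI ballI)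
    show "loc_map R \<F> M N u \<in> extensional (carrier (loc R \<F> M))" by (simp add: loc_map_def)
  next
    fix X assume "X \<in> carrier (loc R \<F> M)"
    then obtain I f where X: "X = loc_class R \<F> M I f" "(I, f) \<in> loc_pairs R \<F> M" by (auto simp: carrier_loc)
    show "loc_map R \<F> M N u X \<in> carrier (loc R \<F> N)"
      unfolding X(1) mc[OF X(2)] by (rule loc_class_closed[OF mp[OF X(2)]])
  next
    fix X Y assume "X \<in> carrier (loc R \<F> M)" "Y \<in> carrier (loc R \<F> M)"
    then obtain I f J g where X: "X = loc_class R \<F> M I f" "(I, f) \<in> loc_pairs R \<F> M"
      and Y: "Y = loc_class R \<F> M J g" "(J, g) \<in> loc_pairs R \<F> M" by (auto simp: carrier_loc)
    have "(\<lambda>x\<in>I \<inter> J. torsion_quot_map R \<F> M N u ((\<lambda>x\<in>I \<inter> J. f x \<oplus>\<^bsub>torsion_quot R \<F> M\<^esub> g x) x))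
      = (\<lambda>x\<in>I \<inter> J. (\<lambda>x\<in>I. torsion_quot_map R \<F> M N u (f x)) x \<oplus>\<^bsub>torsion_quot R \<F> N\<^esub>
          (\<lambda>x\<in>J. torsion_quot_map R \<F> M N u (g x)) x)"
      using val[OF X(2)] val[OF Y(2)] by (intro restrict_ext) (simp add: t)
    then show "loc_map R \<F> M N u (X \<oplus>\<^bsub>loc R \<F> M\<^esub> Y) = loc_map R \<F> M N u X \<oplus>\<^bsub>loc R \<F> N\<^esub> loc_map R \<F> M N u Y"
      by (simp only: X(1) Y(1) loc_add[OF M X(2) Y(2)] mc[OF X(2)] mc[OF Y(2)] mc[OF add_loc_pair[OF M X(2) Y(2)]]
          loc_add[OF N mp[OF X(2)] mp[OF Y(2)]])
  next
    fix r X assume r: "r \<in> carrier R" and "X \<in> carrier (loc R \<F> M)"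
    then obtain I f where X: "X = loc_class R \<F> M I f" "(I, f) \<in> loc_pairs R \<F> M" by (auto simp: carrier_loc)
    have "(\<lambda>x\<in>I. torsion_quot_map R \<F> M N u ((\<lambda>x\<in>I. r \<odot>\<^bsub>torsion_quot R \<F> M\<^esub> f x) x))
      = (\<lambda>x\<in>I. r \<odot>\<^bsub>torsion_quot R \<F> N\<^esub> (\<lambda>x\<in>I. torsion_quot_map R \<F> M N u (f x)) x)"
      using val[OF X(2)] by (intro restrict_ext) (simp add: t r)
    then show "loc_map R \<F> M N u (r \<odot>\<^bsub>loc R \<F> M\<^esub> X) = r \<odot>\<^bsub>loc R \<F> N\<^esub> loc_map R \<F> M N u X"
      by (simp only: X(1) loc_smult[OF M r X(2)] mc[OF X(2)] mc[OF smult_loc_pair[OF M X(2) r]]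
          loc_smult[OF N r mp[OF X(2)]])
  qed
qed

end

context gabriel_system
begin

text \<open>
  If \<open>u x\<close> is torsion, then \<open>u (r x) = 0\<close> for all \<open>r\<close> in a member of \<open>\<F>\<close>; each such \<open>r x\<close> is torsion by
  the hypothesis on the kernel, hence so is \<open>x\<close>.
\<close>

lemma torsion_quot_map_inj:
  assumes M: "module R M" and N: "module R N" and u: "is_linear R M N u"
    and ker: "\<And>x. x \<in> carrier M \<Longrightarrow> u x = \<zero>\<^bsub>N\<^esub> \<Longrightarrow> ann R M x \<in> \<F>"
  shows "inj_on (torsion_quot_map R \<F> M N u) (carrier (torsion_quot R \<F> M))"
proof (rule inj_onI)
  interpret M: module R M by fact
  interpret N: module R N by fact
  fix X Y assume "X \<in> carrier (torsion_quot R \<F> M)" "Y \<in> carrier (torsion_quot R \<F> M)"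
    and eq: "torsion_quot_map R \<F> M N u X = torsion_quot_map R \<F> M N u Y"
  then obtain x y where x: "x \<in> carrier M" "X = torsion_coset M x" and y: "y \<in> carrier M" "Y = torsion_coset M y"
    by (auto simp: carrier_torsion_quot[OF M])
  have xy: "x \<ominus>\<^bsub>M\<^esub> y \<in> carrier M" using x y by simp
  have "u (x \<ominus>\<^bsub>M\<^esub> y) \<in> torsion R \<F> N"
    using eq x y is_linearD(1)[OF u]
    by (simp add: torsion_quot_map_coset[OF M N u] torsion_quot_eq_iff[OF N] is_linear_diff[OF M N u])
  then have J: "ann R N (u (x \<ominus>\<^bsub>M\<^esub> y)) \<in> \<F>" by (simp add: torsion_def)
  have "x \<ominus>\<^bsub>M\<^esub> y \<in> torsion R \<F> M"
  proof (rule torsion_of_multiples[OF M xy J])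
    fix r assume "r \<in> ann R N (u (x \<ominus>\<^bsub>M\<^esub> y))"
    then have r: "r \<in> carrier R" "u (r \<odot>\<^bsub>M\<^esub> (x \<ominus>\<^bsub>M\<^esub> y)) = \<zero>\<^bsub>N\<^esub>"
      using xy by (auto simp: ann_def is_linearD(3)[OF u])
    then show "r \<odot>\<^bsub>M\<^esub> (x \<ominus>\<^bsub>M\<^esub> y) \<in> torsion R \<F> M"
      using ker[of "r \<odot>\<^bsub>M\<^esub> (x \<ominus>\<^bsub>M\<^esub> y)"] xy by (simp add: torsion_def)
  qed
  then show "X = Y" using x y by (simp add: torsion_quot_eq_iff[OF M])
qed

text \<open>
  Localization inverts every map whose kernel and cokernel are torsion. Injectivity is inherited from
  the injective map \<open>v : M / \<F>(M) \<rightarrow> N / \<F>(N)\<close> induced by \<open>u\<close>. For surjectivity, a map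
  \<open>h : I \<rightarrow> N / \<F>(N)\<close> takes values in the image of \<open>v\<close> on the ideal \<open>J = h\<^sup>-\<^sup>1(im v)\<close>, where it lifts through
  \<open>v\<close>. Passing from \<open>I\<close> to \<open>J\<close> does not change the class of \<open>h\<close>, because \<open>J\<close> belongs to \<open>\<F>\<close> by Gabriel's
  condition: for \<open>a \<in> I\<close> with \<open>h a = [y]\<close>, every \<open>r\<close> that moves \<open>y\<close> into the image of \<open>u\<close> lies in \<open>(J : a)\<close>.
\<close>

lemma loc_map_iso:
  assumes M: "module R M" and N: "module R N" and u: "is_linear R M N u"
    and ker: "\<And>x. x \<in> carrier M \<Longrightarrow> u x = \<zero>\<^bsub>N\<^esub> \<Longrightarrow> ann R M x \<in> \<F>"
    and coker: "\<And>y. y \<in> carrier N \<Longrightarrow> \<exists>J\<in>\<F>. \<forall>r\<in>J. r \<odot>\<^bsub>N\<^esub> y \<in> u ` carrier M"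
  shows "linear_iso R (loc R \<F> M) (loc R \<F> N) (loc_map R \<F> M N u)"
proof -
  let ?v = "torsion_quot_map R \<F> M N u"
  let ?M = "torsion_quot R \<F> M" and ?N = "torsion_quot R \<F> N"
  interpret QM: module R ?M by (rule torsion_quot_is_module[OF M])
  interpret QN: module R ?N by (rule torsion_quot_is_module[OF N])
  note mc = loc_map_class[OF M N u] and mp = map_loc_pair[OF M N u]
  note v = torsion_quot_map_linear[OF M N u]
  have inj: "inj_on ?v (carrier ?M)" by (rule torsion_quot_map_inj[OF M N u ker])
  have val: "f x \<in> carrier ?M" if "(I, f) \<in> loc_pairs R \<F> M" "x \<in> I" for I f x
    using that is_linearD(1)[of R "ideal_module R I" _ f x] by (auto simp: loc_pairs_iff)
  have "inj_on (loc_map R \<F> M N u) (carrier (loc R \<F> M))"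
  proof (rule inj_onI)
    fix X Y assume "X \<in> carrier (loc R \<F> M)" "Y \<in> carrier (loc R \<F> M)"
      and eq: "loc_map R \<F> M N u X = loc_map R \<F> M N u Y"
    then obtain I f J g where X: "X = loc_class R \<F> M I f" "(I, f) \<in> loc_pairs R \<F> M"
      and Y: "Y = loc_class R \<F> M J g" "(J, g) \<in> loc_pairs R \<F> M" by (auto simp: carrier_loc)
    have "((I, \<lambda>x\<in>I. ?v (f x)), (J, \<lambda>x\<in>J. ?v (g x))) \<in> loc_rel R \<F> N"
      using eq unfolding X(1) Y(1) mc[OF X(2)] mc[OF Y(2)] loc_class_eq_iff[OF mp[OF X(2)] mp[OF Y(2)]] .
    then obtain K where K: "K \<in> \<F>" "K \<subseteq> I" "K \<subseteq> J"
      "\<And>x. x \<in> K \<Longrightarrow> (\<lambda>x\<in>I. ?v (f x)) x = (\<lambda>x\<in>J. ?v (g x)) x"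
      by (elim loc_relE) (rule that; assumption)
    have "f x = g x" if "x \<in> K" for x
    proof -
      have "x \<in> I" "x \<in> J" using that K(2,3) by auto
      then show ?thesis using K(4)[OF that] by (intro inj_onD[OF inj] val[OF X(2)] val[OF Y(2)]) simp_all
    qed
    then show "X = Y"
      unfolding X(1) Y(1) loc_class_eq_iff[OF X(2) Y(2)] by (intro loc_relI[OF X(2) Y(2) K(1-3)])
  qed
  moreover have "Z \<in> loc_map R \<F> M N u ` carrier (loc R \<F> M)" if ZN: "Z \<in> carrier (loc R \<F> N)" for Z
  proof -
    obtain I h where Z: "Z = loc_class R \<F> N I h" "(I, h) \<in> loc_pairs R \<F> N"
      using ZN by (auto simp: carrier_loc)
    have I: "I \<in> \<F>" and h: "is_linear R (ideal_module R I) ?N h" using Z(2) by (auto simp: loc_pairs_iff)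
    interpret I: ideal I R by (rule mem_ideal[OF I])
    have IR: "x \<in> carrier R" if "x \<in> I" for x using that I.Icarr by simp
    note hD = is_linearD[OF h, simplified]
    \<comment> \<open>The part of \<open>I\<close> on which \<open>h\<close> lifts along the map induced by \<open>u\<close>.\<close>
    define J where "J = {r \<in> I. h r \<in> ?v ` carrier ?M}"
    note im = linear_image_submodule[OF QM.module_axioms QN.module_axioms v]
    have imz: "\<zero>\<^bsub>?N\<^esub> \<in> ?v ` carrier ?M"
      using subgroup.one_closed[OF submodule.axioms(1)[OF im]] by simp
    have hz: "h \<zero> = \<zero>\<^bsub>?N\<^esub>" using hD(3)[of \<zero> \<zero>] hD(1)[of \<zero>] by simp
    have "ideal J R"
    proof (rule idealI_smult)
      show "\<zero> \<in> J" using imz hz by (simp add: J_def)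
    qed (auto simp: J_def hD I.I_l_closed IR intro: QN.submoduleE(4,5)[OF im])
    moreover have "{r \<in> carrier R. r \<otimes> a \<in> J} \<in> \<F>" if a: "a \<in> I" for a
    proof -
      obtain y where y: "y \<in> carrier N" "h a = torsion_coset N y"
        using hD(1)[OF a] by (auto simp: carrier_torsion_quot[OF N])
      obtain K where K: "K \<in> \<F>" "\<And>r. r \<in> K \<Longrightarrow> r \<odot>\<^bsub>N\<^esub> y \<in> u ` carrier M"
        using coker[OF y(1)] by blast
      have "r \<otimes> a \<in> J" if r: "r \<in> K" for r
      proof -
        have rR: "r \<in> carrier R" using mem_carrier[OF K(1) r] .
        obtain x where x: "x \<in> carrier M" "r \<odot>\<^bsub>N\<^esub> y = u x" using K(2)[OF r] by blast
        have "h (r \<otimes> a) = ?v (torsion_coset M x)"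
          using a rR y x by (simp add: hD(3) torsion_quot_smult[OF N] torsion_quot_map_coset[OF M N u])
        then show ?thesis
          using x(1) a rR by (auto simp: J_def I.I_l_closed carrier_torsion_quot[OF M])
      qed
      then show ?thesis
        using \<open>ideal J R\<close> mem_carrier[OF K(1)]
        by (intro mem_up[OF K(1) colon_ideal_ideal[OF \<open>ideal J R\<close> IR[OF a]]]) auto
    qed
    ultimately have J: "J \<in> \<F>" by (rule mem_trans[OF _ I])
    have JI: "J \<subseteq> I" by (auto simp: J_def)
    let ?w = "inv_into (carrier ?M) ?v"
    define f where "f = (\<lambda>r\<in>J. ?w (h r))"
    have w: "?w b \<in> carrier ?M" "?v (?w b) = b" if "b \<in> ?v ` carrier ?M" for b
      using that inv_into_into f_inv_into_f by metis+
    interpret J: ideal J R by (rule mem_ideal[OF J])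
    have f: "f r \<in> carrier ?M" "?v (f r) = h r" if "r \<in> J" for r
      using that w[of "h r"] by (auto simp: f_def J_def)
    have f_ext: "f \<in> extensional J" by (simp add: f_def)
    have "(J, f) \<in> loc_pairs R \<F> M"
      unfolding loc_pairs_iff is_linear_def
    proof (intro conjI ballI)
      fix x y assume "x \<in> carrier (ideal_module R J)" "y \<in> carrier (ideal_module R J)"
      then have xy: "x \<in> J" "y \<in> J" "x \<oplus> y \<in> J" by auto
      have eq: "?v (f (x \<oplus> y)) = ?v (f x \<oplus>\<^bsub>?M\<^esub> f y)"
        using xy subsetD[OF JI] hD(2)[of x y] is_linearD(2)[OF v f(1) f(1), of x y] by (simp add: f(2))
      show "f (x \<oplus>\<^bsub>ideal_module R J\<^esub> y) = f x \<oplus>\<^bsub>?M\<^esub> f y"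
        using inj_onD[OF inj eq] xy f(1) by simp
    next
      fix r x assume r: "r \<in> carrier R" and "x \<in> carrier (ideal_module R J)"
      then have x: "x \<in> J" "r \<otimes> x \<in> J" using J.I_l_closed by auto
      have eq: "?v (f (r \<otimes> x)) = ?v (r \<odot>\<^bsub>?M\<^esub> f x)"
        using x subsetD[OF JI] r hD(3)[of r x] is_linearD(3)[OF v r f(1), of x] by (simp add: f(2))
      show "f (r \<odot>\<^bsub>ideal_module R J\<^esub> x) = r \<odot>\<^bsub>?M\<^esub> f x"
        using inj_onD[OF inj eq] x r f(1) by simp
    qed (auto simp: J f(1) f_ext)
    then have pf: "(J, f) \<in> loc_pairs R \<F> M" .
    have "((J, \<lambda>x\<in>J. ?v (f x)), (I, h)) \<in> loc_rel R \<F> N"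
      by (rule loc_relI[OF mp[OF pf] Z(2) J _ JI]) (auto simp: f)
    then have "loc_map R \<F> M N u (loc_class R \<F> M J f) = Z"
      unfolding mc[OF pf] Z(1) loc_class_eq_iff[OF mp[OF pf] Z(2)] .
    then show ?thesis using loc_class_closed[OF pf] by blast
  qed
  moreover have lin: "loc_map R \<F> M N u \<in> linear_maps R (loc R \<F> M) (loc R \<F> N)"
    by (rule loc_map_linear[OF M N u])
  ultimately show ?thesis
    by (auto simp: linear_iso_def bij_betw_def linear_maps_def is_linear_def)
qed

end

section \<open>The ideals that extend to the unit ideal\<close>

text \<open>
  Stated through all ideals \<open>K\<close> of \<open>S\<close>, so that \<open>I S = S\<close> can be used and proved without writing \<open>1\<close> as
  a linear combination of elements of \<open>\<phi>(I)\<close>.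
\<close>

lemma extension_system_iff:
  assumes S: "cring S"
    and \<phi>: "\<phi> \<in> ring_hom R S"
  shows "I \<in> extension_system R S \<phi> \<longleftrightarrow>
    ideal I R \<and> (\<forall>K. ideal K S \<and> \<phi> ` I \<subseteq> K \<longrightarrow> \<one>\<^bsub>S\<^esub> \<in> K)"
proof -
  interpret S: cring S by fact
  have "Idl\<^bsub>S\<^esub> (\<phi> ` I) = carrier S \<longleftrightarrow> (\<forall>K. ideal K S \<and> \<phi> ` I \<subseteq> K \<longrightarrow> \<one>\<^bsub>S\<^esub> \<in> K)"
    (is "?L \<longleftrightarrow> ?R") if I: "ideal I R"
  proof
    assume ?L
    then have "\<one>\<^bsub>S\<^esub> \<in> Idl\<^bsub>S\<^esub> (\<phi> ` I)" by simp
    then show ?R by (auto simp: genideal_def)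
  next
    assume ?R
    have "\<phi> ` I \<subseteq> carrier S"
      using ideal.Icarr[OF I] ring_hom_closed[OF \<phi>] by auto
    then have "ideal (Idl\<^bsub>S\<^esub> (\<phi> ` I)) S" "\<phi> ` I \<subseteq> Idl\<^bsub>S\<^esub> (\<phi> ` I)"
      by (rule S.genideal_ideal, rule S.genideal_self)
    with \<open>?R\<close> show ?L using ideal.one_imp_carrier by blast
  qed
  then show ?thesis by (auto simp: extension_system_def)
qed

lemma carrier_in_extension_system:
  assumes R: "cring R" and S: "cring S" and \<phi>: "\<phi> \<in> ring_hom R S"
  shows "carrier R \<in> extension_system R S \<phi>"
proof -
  interpret R: cring R by fact
  show ?thesis
    using R.oneideal R.one_closed ring_hom_one[OF \<phi>]
    unfolding extension_system_iff[OF S \<phi>] by (metis image_subset_iff)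
qed

text \<open>
  The elements \<open>s\<close> of \<open>S\<close> with \<open>s \<phi>(j) \<in> K\<close> form an ideal. It contains \<open>\<phi>(C)\<close>, hence \<open>1\<close> because
  \<open>C S = S\<close>. Both closure properties of the system, under intersections and under products, are
  instances of this argument.
\<close>

lemma image_subset_by_colon:
  assumes S: "cring S" and \<phi>: "\<phi> \<in> ring_hom R S" and K: "ideal K S" and j: "j \<in> carrier R"
    and C: "C \<in> extension_system R S \<phi>" and sub: "\<And>c. c \<in> C \<Longrightarrow> \<phi> (c \<otimes>\<^bsub>R\<^esub> j) \<in> K"
  shows "\<phi> j \<in> K"
proof -
  interpret S: cring S by fact
  have Ci: "ideal C R" using C by (simp add: extension_system_def)
  have \<phi>j: "\<phi> j \<in> carrier S" using j \<phi> by (simp add: ring_hom_closed)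
  have "ideal {s \<in> carrier S. s \<otimes>\<^bsub>S\<^esub> \<phi> j \<in> K} S" by (rule S.colon_ideal_ideal[OF K \<phi>j])
  moreover have "\<phi> ` C \<subseteq> {s \<in> carrier S. s \<otimes>\<^bsub>S\<^esub> \<phi> j \<in> K}"
    using sub ideal.Icarr[OF Ci] j ring_hom_closed[OF \<phi>] ring_hom_mult[OF \<phi>] by fastforce
  ultimately have "\<one>\<^bsub>S\<^esub> \<in> {s \<in> carrier S. s \<otimes>\<^bsub>S\<^esub> \<phi> j \<in> K}"
    using C by (auto simp: extension_system_iff[OF S \<phi>])
  then show ?thesis using \<phi>j by simp
qed

lemma extension_system_topologizing:
  fixes R (structure)
  assumes R: "cring R" and S: "cring S" and \<phi>: "\<phi> \<in> ring_hom R S"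
  shows "topologizing_system R (extension_system R S \<phi>)"
proof -
  interpret R: cring R by fact
  let ?F = "extension_system R S \<phi>"
  note iff = extension_system_iff[OF S \<phi>]
  have "carrier R \<in> ?F" by (rule carrier_in_extension_system[OF R S \<phi>])
  moreover have "I \<inter> J \<in> ?F" if I: "I \<in> ?F" and J: "J \<in> ?F" for I J
    unfolding iff
  proof (intro conjI allI impI)
    have Ii: "ideal I R" and Ji: "ideal J R" using I J by (auto simp: iff)
    show "ideal (I \<inter> J) R" by (rule R.i_intersect[OF Ii Ji])
    fix K assume "ideal K S \<and> \<phi> ` (I \<inter> J) \<subseteq> K"
    then have K: "ideal K S" and sub: "\<phi> ` (I \<inter> J) \<subseteq> K" by auto
    have "\<phi> j \<in> K" if j: "j \<in> J" for j
    proof (rule image_subset_by_colon[OF S \<phi> K ideal.Icarr[OF Ji j] I])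
      fix i assume i: "i \<in> I"
      have "i \<otimes> j \<in> I \<inter> J"
        using ideal.I_r_closed[OF Ii i ideal.Icarr[OF Ji j]] ideal.I_l_closed[OF Ji j ideal.Icarr[OF Ii i]]
        by simp
      then show "\<phi> (i \<otimes> j) \<in> K" using sub by blast
    qed
    then show "\<one>\<^bsub>S\<^esub> \<in> K" using J K by (auto simp: iff)
  qed
  moreover have "J \<in> ?F" if "I \<in> ?F" "ideal J R" "I \<subseteq> J" for I J
    using that unfolding iff by (meson image_mono subset_trans)
  moreover have "ideal I R" if "I \<in> ?F" for I using that by (simp add: iff)
  ultimately show ?thesis unfolding topologizing_system_def by blast
qed

lemma extension_system_idempotent:
  fixes R (structure)
  assumes R: "cring R" and S: "cring S" and \<phi>: "\<phi> \<in> ring_hom R S"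
  shows "idempotent_system R (extension_system R S \<phi>)"
proof -
  interpret R: cring R by fact
  let ?F = "extension_system R S \<phi>"
  note iff = extension_system_iff[OF S \<phi>]
  have "I \<in> ?F" if "I \<in> system_prod R ?F ?F" for I
  proof -
    obtain J where I: "ideal I R" and J: "J \<in> ?F" "I \<subseteq> J"
      and n: "negligible R ?F (quot_module (ideal_module R J) I)"
      using \<open>I \<in> system_prod R ?F ?F\<close> unfolding system_prod_def by blast
    have Ji: "ideal J R" using J by (simp add: iff)
    have c: "{r \<in> carrier R. r \<otimes> j \<in> I} \<in> ?F" if "j \<in> J" for j
      using n that R.negligible_quot_iff[OF I Ji J(2)] by blast
    show ?thesis unfolding iff
    proof (intro conjI allI impI)
      fix K assume "ideal K S \<and> \<phi> ` I \<subseteq> K"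
      then have K: "ideal K S" and sub: "\<phi> ` I \<subseteq> K" by auto
      have "\<phi> j \<in> K" if j: "j \<in> J" for j
        using sub by (intro image_subset_by_colon[OF S \<phi> K ideal.Icarr[OF Ji j] c[OF j]]) auto
      then show "\<one>\<^bsub>S\<^esub> \<in> K" using J K by (auto simp: iff)
    qed (rule I)
  qed
  moreover have "I \<in> system_prod R ?F ?F" if I: "I \<in> ?F" for I
  proof -
    have Ii: "ideal I R" using I by (simp add: iff)
    have "{r \<in> carrier R. r \<otimes> i \<in> I} = carrier R" if "i \<in> I" for i
      using ideal.I_l_closed[OF Ii that] by auto
    moreover have "carrier R \<in> ?F" by (rule carrier_in_extension_system[OF R S \<phi>])
    ultimately have "negligible R ?F (quot_module (ideal_module R I) I)"
      by (simp add: R.negligible_quot_iff[OF Ii Ii])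
    then show ?thesis using I Ii unfolding system_prod_def by blast
  qed
  ultimately show ?thesis unfolding idempotent_system_def by blast
qed

lemma extension_system_gabriel:
  "cring R \<Longrightarrow> cring S \<Longrightarrow> \<phi> \<in> ring_hom R S \<Longrightarrow> gabriel_system R (extension_system R S \<phi>)"
  by (intro gabriel_system.intro gabriel_system_axioms.intro extension_system_topologizing
      extension_system_idempotent)

section \<open>Tensor products as modules\<close>

lemma tensor_free_abelian_group: "abelian_group (tensor_free A B)"
proof (rule abelian_groupI)
  fix x assume "x \<in> carrier (tensor_free A B)"
  then show "\<exists>y\<in>carrier (tensor_free A B). y \<oplus>\<^bsub>tensor_free A B\<^esub> x = \<zero>\<^bsub>tensor_free A B\<^esub>"
    by (intro bexI[of _ "- x"]) (auto simp: tensor_free_def)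
qed (use keys_add in \<open>fastforce simp: tensor_free_def\<close>)+

lemma tensor_free_minus:
  assumes "x \<in> carrier (tensor_free A B)" "y \<in> carrier (tensor_free A B)"
  shows "x \<ominus>\<^bsub>tensor_free A B\<^esub> y = x - y"
proof -
  interpret abelian_group "tensor_free A B" by (rule tensor_free_abelian_group)
  have "\<ominus>\<^bsub>tensor_free A B\<^esub> y = - y"
    by (rule minus_equality) (use assms in \<open>auto simp: tensor_free_def\<close>)
  then show ?thesis by (simp add: a_minus_def tensor_free_def)
qed

abbreviation free_scale :: "('r, 'a, 'k) module_scheme \<Rightarrow> 'r \<Rightarrow> ('a \<times> 'b \<Rightarrow>\<^sub>0 int) \<Rightarrow> ('a \<times> 'b \<Rightarrow>\<^sub>0 int)" where
  "free_scale A r \<equiv> frag_extend (\<lambda>(a, b). frag_of (r \<odot>\<^bsub>A\<^esub> a, b))"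

lemma tensor_null_incl: "x \<in> tensor_relators R A B \<Longrightarrow> x \<in> tensor_null R A B"
  unfolding tensor_null_def by (rule generate.incl)

lemma tensor_null_diff:
  assumes "module R A" "module R B" "x \<in> tensor_null R A B" "y \<in> tensor_null R A B"
  shows "x - y \<in> tensor_null R A B"
  using tensor_null_add[OF assms(3) tensor_null_uminus[OF assms(1,2,4)]] by simp

lemma
  shows tensor_null_add_left: "a \<in> carrier A \<Longrightarrow> a' \<in> carrier A \<Longrightarrow> b \<in> carrier B
      \<Longrightarrow> frag_of (a \<oplus>\<^bsub>A\<^esub> a', b) - frag_of (a, b) - frag_of (a', b) \<in> tensor_null R A B"
    and tensor_null_add_right: "a \<in> carrier A \<Longrightarrow> b \<in> carrier B \<Longrightarrow> b' \<in> carrier B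
      \<Longrightarrow> frag_of (a, b \<oplus>\<^bsub>B\<^esub> b') - frag_of (a, b) - frag_of (a, b') \<in> tensor_null R A B"
    and tensor_null_smult: "r \<in> carrier R \<Longrightarrow> a \<in> carrier A \<Longrightarrow> b \<in> carrier B
      \<Longrightarrow> frag_of (r \<odot>\<^bsub>A\<^esub> a, b) - frag_of (a, r \<odot>\<^bsub>B\<^esub> b) \<in> tensor_null R A B"
  by (rule tensor_null_incl; unfold tensor_relators_def; blast)+

lemma free_scale_keys:
  assumes "module R A" "r \<in> carrier R" "Poly_Mapping.keys x \<subseteq> carrier A \<times> L"
  shows "Poly_Mapping.keys (free_scale A r x) \<subseteq> carrier A \<times> L"
proof -
  interpret A: module R A by fact
  have "Poly_Mapping.keys (free_scale A r x)
      \<subseteq> (\<Union>p\<in>Poly_Mapping.keys x. Poly_Mapping.keys (case p of (a, b) \<Rightarrow> frag_of (r \<odot>\<^bsub>A\<^esub> a, b)))"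
    by (rule keys_frag_extend)
  also have "\<dots> \<subseteq> carrier A \<times> L" using assms by fastforce
  finally show ?thesis .
qed

lemma free_scale_null:
  fixes R (structure)
  assumes A: "module R A" and B: "module R B" and r: "r \<in> carrier R" and x: "x \<in> tensor_null R A B"
  shows "free_scale A r x \<in> tensor_null R A B"
  using A B x
proof (induction x rule: tensor_null_induct)
  interpret A: module R A by fact
  case (relator x)
  show ?case
    using relator[unfolded tensor_relators_def]
  proof (elim UnE CollectE exE conjE)
    fix a a' b assume "x = frag_of (a \<oplus>\<^bsub>A\<^esub> a', b) - frag_of (a, b) - frag_of (a', b)"
      and "a \<in> carrier A" "a' \<in> carrier A" "b \<in> carrier B"
    then show ?thesis
      using r tensor_null_add_left[of "r \<odot>\<^bsub>A\<^esub> a" A "r \<odot>\<^bsub>A\<^esub> a'" b B R]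
      by (simp add: frag_extend_diff A.smult_r_distr)
  next
    fix a b b' assume "x = frag_of (a, b \<oplus>\<^bsub>B\<^esub> b') - frag_of (a, b) - frag_of (a, b')"
      and "a \<in> carrier A" "b \<in> carrier B" "b' \<in> carrier B"
    then show ?thesis
      using r tensor_null_add_right[of "r \<odot>\<^bsub>A\<^esub> a" A b B b' R] by (simp add: frag_extend_diff)
  next
    fix s a b assume x: "x = frag_of (s \<odot>\<^bsub>A\<^esub> a, b) - frag_of (a, s \<odot>\<^bsub>B\<^esub> b)"
      and s: "s \<in> carrier R" "a \<in> carrier A" "b \<in> carrier B"
    have "r \<odot>\<^bsub>A\<^esub> (s \<odot>\<^bsub>A\<^esub> a) = s \<odot>\<^bsub>A\<^esub> (r \<odot>\<^bsub>A\<^esub> a)"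
      using r s by (simp add: A.R.m_comm flip: A.smult_assoc1)
    then show ?thesis
      using r s tensor_null_smult[of s R "r \<odot>\<^bsub>A\<^esub> a" A b B] by (simp add: x frag_extend_diff)
  qed
next
  case zero
  then show ?case by (simp add: tensor_null_zero)
next
  case (add x y)
  then show ?case by (simp add: frag_extend_add tensor_null_add)
next
  case (uminus x)
  then show ?case using tensor_null_uminus[OF A B] by (simp add: frag_extend_minus)
qed

text \<open>
  On formal sums the law \<open>(r + s) x = r x + s x\<close> holds only modulo the relators that express additivity
  in the first argument; the other scalar laws hold exactly.
\<close>

lemma tensor_modulo:
  fixes R (structure)
  assumes A: "module R A" and B: "module R B"
  shows "module_modulo R (tensor_free A B) (tensor_null R A B)"
proof -
  interpret A: module R A by fact
  interpret B: module R B by fact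
  interpret F: abelian_group "tensor_free A B" by (rule tensor_free_abelian_group)
  have F: "carrier (tensor_free A B) = {x. Poly_Mapping.keys x \<subseteq> carrier A \<times> carrier B}"
    "add (tensor_free A B) = (+)" "zero (tensor_free A B) = 0"
    "\<And>r x. r \<odot>\<^bsub>tensor_free A B\<^esub> x = free_scale A r x"
    by (auto simp: tensor_free_def)
  have minus: "x \<ominus>\<^bsub>tensor_free A B\<^esub> y = x - y"
    if "Poly_Mapping.keys x \<subseteq> carrier A \<times> carrier B" "Poly_Mapping.keys y \<subseteq> carrier A \<times> carrier B" for x y
    using tensor_free_minus[of x A B y] that by (simp add: F)
  note null = tensor_null_keys[OF A B]
  have "subgroup (tensor_null R A B) (add_monoid (tensor_free A B))"
  proof (rule subgroup.intro)
    fix x assume x: "x \<in> tensor_null R A B"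
    have "\<ominus>\<^bsub>tensor_free A B\<^esub> x = - x"
      by (rule F.minus_equality) (use null[OF x] in \<open>auto simp: F\<close>)
    then show "inv\<^bsub>add_monoid (tensor_free A B)\<^esub> x \<in> tensor_null R A B"
      using tensor_null_uminus[OF A B x] by (simp flip: a_inv_def)
  qed (use null in \<open>auto simp: F tensor_null_zero intro: tensor_null_add\<close>)
  then interpret N: abelian_subgroup "tensor_null R A B" "tensor_free A B"
    by (rule abelian_subgroupI2[OF F.a_comm_group])
  note k = free_scale_keys[OF A]
  have k2: "Poly_Mapping.keys (x + y) \<subseteq> carrier A \<times> carrier B"
    if "Poly_Mapping.keys x \<subseteq> carrier A \<times> carrier B" "Poly_Mapping.keys y \<subseteq> carrier A \<times> carrier B" for x y
    using that keys_add[of x y] by blast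
  show ?thesis
  proof (unfold_locales)
    fix r x assume r: "r \<in> carrier R" and "x \<in> carrier (tensor_free A B)"
    then show "r \<odot>\<^bsub>tensor_free A B\<^esub> x \<in> carrier (tensor_free A B)" using k by (simp add: F)
  next
    fix r x y assume r: "r \<in> carrier R" and "x \<in> carrier (tensor_free A B)" "y \<in> carrier (tensor_free A B)"
    then show "r \<odot>\<^bsub>tensor_free A B\<^esub> (x \<oplus>\<^bsub>tensor_free A B\<^esub> y)
        = r \<odot>\<^bsub>tensor_free A B\<^esub> x \<oplus>\<^bsub>tensor_free A B\<^esub> r \<odot>\<^bsub>tensor_free A B\<^esub> y"
      by (simp add: F frag_extend_add)
  next
    fix r x assume r: "r \<in> carrier R" and "x \<in> tensor_null R A B"
    then show "r \<odot>\<^bsub>tensor_free A B\<^esub> x \<in> tensor_null R A B"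
      using free_scale_null[OF A B] by (simp add: F)
  next
    fix r s x assume r: "r \<in> carrier R" "s \<in> carrier R" and "x \<in> carrier (tensor_free A B)"
    then have x: "Poly_Mapping.keys x \<subseteq> carrier A \<times> carrier B" by (simp add: F)
    then have "free_scale A (r \<oplus> s) x - (free_scale A r x + free_scale A s x) \<in> tensor_null R A B"
    proof (induction x rule: frag_induction)
      case (one p)
      then show ?case
        using tensor_null_add_left[of "r \<odot>\<^bsub>A\<^esub> fst p" A "s \<odot>\<^bsub>A\<^esub> fst p" "snd p" B R] r
        by (auto simp: A.smult_l_distr diff_diff_eq split_beta)
    next
      case (diff x y)
      from tensor_null_diff[OF A B this] show ?case by (simp add: frag_extend_diff algebra_simps)
    qed (simp add: tensor_null_zero)
    then show "(r \<oplus> s) \<odot>\<^bsub>tensor_free A B\<^esub> x \<ominus>\<^bsub>tensor_free A B\<^esub>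
        (r \<odot>\<^bsub>tensor_free A B\<^esub> x \<oplus>\<^bsub>tensor_free A B\<^esub> s \<odot>\<^bsub>tensor_free A B\<^esub> x) \<in> tensor_null R A B"
      unfolding F using minus[OF k[OF A.R.a_closed[OF r] x] k2[OF k[OF r(1) x] k[OF r(2) x]]] by simp
    from x have "free_scale A (r \<otimes> s) x - free_scale A r (free_scale A s x) = 0"
    proof (induction x rule: frag_induction)
      case (diff x y)
      then show ?case by (simp add: frag_extend_diff)
    qed (use r in \<open>auto simp: A.smult_assoc1\<close>)
    then show "(r \<otimes> s) \<odot>\<^bsub>tensor_free A B\<^esub> x \<ominus>\<^bsub>tensor_free A B\<^esub>
        r \<odot>\<^bsub>tensor_free A B\<^esub> (s \<odot>\<^bsub>tensor_free A B\<^esub> x) \<in> tensor_null R A B"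
      using r x by (simp add: F k minus tensor_null_zero)
  next
    fix x assume "x \<in> carrier (tensor_free A B)"
    then have x: "Poly_Mapping.keys x \<subseteq> carrier A \<times> carrier B" by (simp add: F)
    then have "free_scale A \<one> x - x = 0"
    proof (induction x rule: frag_induction)
      case (diff x y)
      then show ?case by (simp add: frag_extend_diff)
    qed auto
    then show "\<one> \<odot>\<^bsub>tensor_free A B\<^esub> x \<ominus>\<^bsub>tensor_free A B\<^esub> x \<in> tensor_null R A B"
      using x by (simp add: F k minus tensor_null_zero)
  qed
qed

lemma tensor_is_module: "module R A \<Longrightarrow> module R B \<Longrightarrow> module R (tensor R A B)"
  unfolding tensor_def by (rule module_modulo.quot_is_module[OF tensor_modulo])

section \<open>Flatness\<close>

text \<open>
  Write \<open>I\<close> for the annihilator of \<open>m\<close>. By flatness, \<open>1 \<otimes> m\<close> already vanishes in \<open>S \<otimes> R m\<close>. Since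
  \<open>R m \<cong> R/I\<close>, this tensor product is \<open>S / I S\<close>, with \<open>s \<otimes> r m\<close> corresponding to the class of \<open>\<phi>(r) s\<close>;
  so \<open>1\<close> lies in \<open>I S\<close>. The proof realizes the map to \<open>S / K\<close>, for an ideal \<open>K\<close> containing \<open>\<phi>(I)\<close>, on
  formal sums: a choice of \<open>c n\<close> with \<open>c n \<cdot> m = n\<close> gives an additive map \<open>h\<close> with values in \<open>S\<close>, and every
  relator goes into \<open>K\<close> because two choices of a coefficient differ by an element of \<open>I\<close>.
\<close>

lemma flat_ann_mem:
  fixes R (structure)
  assumes R: "cring R" and S: "cring S" and \<phi>: "\<phi> \<in> ring_hom R S"
    and flat: "flat_module R (restr_module \<phi> S)"
    and M: "module R M" and m: "m \<in> carrier M"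
    and null: "frag_of (\<one>\<^bsub>S\<^esub>, m) \<in> tensor_null R (restr_module \<phi> S) M"
  shows "ann R M m \<in> extension_system R S \<phi>"
proof -
  let ?A = "restr_module \<phi> S"
  interpret R: cring R by fact
  interpret S: cring S by fact
  interpret M: module R M by fact
  note hom = ring_hom_closed[OF \<phi>] ring_hom_add[OF \<phi>] ring_hom_mult[OF \<phi>] ring_hom_one[OF \<phi>]
  have A: "module R ?A" by (rule restr_module_is_module[OF R S \<phi>])
  define H where "H = (\<lambda>r. r \<odot>\<^bsub>M\<^esub> m) ` carrier R"
  have "is_linear R (self_module R) M (\<lambda>r. r \<odot>\<^bsub>M\<^esub> m)"
    using m by (auto simp: is_linear_def M.smult_l_distr M.smult_assoc1)
  from linear_image_submodule[OF self_module_is_module[OF R] M this]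
  have H: "submodule H R M" by (simp add: H_def)
  let ?N = "M\<lparr>carrier := H\<rparr>"
  have N: "module R ?N" by (rule submodule.submodule_is_module[OF H M])
  have HM: "n \<in> carrier M" if "n \<in> H" for n using that M.submoduleE(1)[OF H] by auto
  have mH: "m \<in> H" unfolding H_def using m by (intro rev_image_eqI[of \<one>]) auto
  have incl: "is_linear R ?N M (\<lambda>n\<in>H. n)"
    using M.submoduleE(4,5)[OF H] HM by (auto simp: is_linear_def)
  have "inj_on (tensor_map R ?A ?N M (\<lambda>n\<in>H. n)) (carrier (tensor R ?A ?N))"
    by (rule flat_module_inj[OF flat A N M]) (use incl in \<open>auto simp: linear_maps_def inj_on_def\<close>)
  then have nullH: "frag_of (\<one>\<^bsub>S\<^esub>, m) \<in> tensor_null R ?A ?N"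
    unfolding tensor_map_inj_iff[OF A N M incl] using mH null by simp
  \<comment> \<open>A coefficient of \<open>n\<close> with respect to \<open>m\<close>; it is determined modulo the annihilator of \<open>m\<close>.\<close>
  define c where "c n = (SOME r. r \<in> carrier R \<and> r \<odot>\<^bsub>M\<^esub> m = n)" for n
  have c: "c n \<in> carrier R" "c n \<odot>\<^bsub>M\<^esub> m = n" if "n \<in> H" for n
    using someI_ex[of "\<lambda>r. r \<in> carrier R \<and> r \<odot>\<^bsub>M\<^esub> m = n"] that by (auto simp: c_def H_def)
  have img: "(\<lambda>(s, n). \<phi> (c n) \<otimes>\<^bsub>S\<^esub> s) ` (carrier S \<times> H) \<subseteq> carrier (add_monoid S)"
    using c(1) hom(1) by auto
  obtain h where h: "h \<in> hom (free_Abelian_group (carrier S \<times> H)) (add_monoid S)"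
    and h_of: "\<And>x. x \<in> carrier S \<times> H \<Longrightarrow> h (frag_of x) = (\<lambda>(s, n). \<phi> (c n) \<otimes>\<^bsub>S\<^esub> s) x"
    using comm_group.free_Abelian_group_universal[OF S.a_comm_group img] by blast
  let ?k = "\<lambda>x. Poly_Mapping.keys x \<subseteq> carrier S \<times> H"
  interpret h: group_hom "free_Abelian_group (carrier S \<times> H)" "add_monoid S" h
    using h S.a_group by (simp add: group_hom_def group_hom_axioms_def)
  have h_cl: "h x \<in> carrier S" if "?k x" for x using h.hom_closed[of x] that by simp
  have h_add: "h (x + y) = h x \<oplus>\<^bsub>S\<^esub> h y" if "?k x" "?k y" for x y using h.hom_mult[of x y] that by simp
  have h_minus: "h (- x) = \<ominus>\<^bsub>S\<^esub> h x" if "?k x" for x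
    using h.hom_inv[of x] that by (simp add: a_inv_def)
  have h_diff: "h (x - y) = h x \<ominus>\<^bsub>S\<^esub> h y" if "?k x" "?k y" for x y
    using h_add[of x "- y"] h_minus[of y] that by (simp add: a_minus_def)
  have kd: "?k (x - y)" if "?k x" "?k y" for x y using keys_diff[of x y] that by blast
  have "\<one>\<^bsub>S\<^esub> \<in> K" if K: "ideal K S" and IK: "\<phi> ` ann R M m \<subseteq> K" for K
  proof -
    interpret K: ideal K S by fact
    have key: "\<phi> r \<otimes>\<^bsub>S\<^esub> s \<in> K" if "r \<in> carrier R" "r \<odot>\<^bsub>M\<^esub> m = \<zero>\<^bsub>M\<^esub>" "s \<in> carrier S" for r s
      using IK that K.I_r_closed[of "\<phi> r" s] by (auto simp: ann_def)
    have "?k x \<and> h x \<in> K" if "x \<in> tensor_null R ?A ?N" for x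
      using A N that
    proof (induction x rule: tensor_null_induct)
      case (relator x)
      have kx: "?k x" using tensor_relators_keys[OF A N relator] by simp
      from relator[unfolded tensor_relators_def] have "h x \<in> K"
      proof (elim UnE CollectE exE conjE)
        fix a a' n assume x: "x = frag_of (a \<oplus>\<^bsub>?A\<^esub> a', n) - frag_of (a, n) - frag_of (a', n)"
          and "a \<in> carrier ?A" "a' \<in> carrier ?A" "n \<in> carrier ?N"
        then have a: "a \<in> carrier S" "a' \<in> carrier S" "n \<in> H" by auto
        then have "h x = \<phi> (c n) \<otimes>\<^bsub>S\<^esub> (a \<oplus>\<^bsub>S\<^esub> a') \<ominus>\<^bsub>S\<^esub> \<phi> (c n) \<otimes>\<^bsub>S\<^esub> a \<ominus>\<^bsub>S\<^esub> \<phi> (c n) \<otimes>\<^bsub>S\<^esub> a'"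
          by (simp add: x h_diff kd h_of)
        also have "\<dots> = \<zero>\<^bsub>S\<^esub>" using a c(1)[of n] hom(1)[of "c n"] by algebra
        finally show ?thesis by simp
      next
        fix a n n' assume x: "x = frag_of (a, n \<oplus>\<^bsub>?N\<^esub> n') - frag_of (a, n) - frag_of (a, n')"
          and "a \<in> carrier ?A" "n \<in> carrier ?N" "n' \<in> carrier ?N"
        then have a: "a \<in> carrier S" "n \<in> H" "n' \<in> H" by auto
        have s: "n \<oplus>\<^bsub>M\<^esub> n' \<in> H" using a M.submoduleE(5)[OF H] by simp
        \<comment> \<open>The defect of additivity of \<open>c\<close> annihilates \<open>m\<close>.\<close>
        let ?r = "c (n \<oplus>\<^bsub>M\<^esub> n') \<ominus> (c n \<oplus> c n')"
        have r: "?r \<in> carrier R" using a s c(1) by simp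
        have "c (n \<oplus>\<^bsub>M\<^esub> n') = ?r \<oplus> c n \<oplus> c n'" using a s c(1)[of "n \<oplus>\<^bsub>M\<^esub> n'"] c(1)[of n] c(1)[of n'] by algebra
        then have e: "\<phi> (c (n \<oplus>\<^bsub>M\<^esub> n')) = \<phi> ?r \<oplus>\<^bsub>S\<^esub> \<phi> (c n) \<oplus>\<^bsub>S\<^esub> \<phi> (c n')"
          using a r c(1) by (metis hom(2) R.a_closed)
        have "h x = \<phi> (c (n \<oplus>\<^bsub>M\<^esub> n')) \<otimes>\<^bsub>S\<^esub> a \<ominus>\<^bsub>S\<^esub> \<phi> (c n) \<otimes>\<^bsub>S\<^esub> a \<ominus>\<^bsub>S\<^esub> \<phi> (c n') \<otimes>\<^bsub>S\<^esub> a"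
          using a s by (simp add: x h_diff kd h_of)
        also have "\<dots> = \<phi> ?r \<otimes>\<^bsub>S\<^esub> a"
          unfolding e using a r hom(1)[OF r] hom(1)[OF c(1)[OF a(2)]] hom(1)[OF c(1)[OF a(3)]] by algebra
        also have "\<dots> \<in> K"
        proof (rule key[OF r _ a(1)])
          have "?r \<odot>\<^bsub>M\<^esub> m = (n \<oplus>\<^bsub>M\<^esub> n') \<oplus>\<^bsub>M\<^esub> \<ominus>\<^bsub>M\<^esub> (n \<oplus>\<^bsub>M\<^esub> n')"
            using a s c m by (simp add: a_minus_def M.smult_l_distr M.smult_l_minus del: R.minus_add)
          then show "?r \<odot>\<^bsub>M\<^esub> m = \<zero>\<^bsub>M\<^esub>" using HM[OF s] by (simp add: M.M.r_neg)
        qed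
        finally show ?thesis .
      next
        fix r a n assume x: "x = frag_of (r \<odot>\<^bsub>?A\<^esub> a, n) - frag_of (a, r \<odot>\<^bsub>?N\<^esub> n)"
          and r: "r \<in> carrier R" and "a \<in> carrier ?A" "n \<in> carrier ?N"
        then have a: "a \<in> carrier S" "n \<in> H" by auto
        have s: "r \<odot>\<^bsub>M\<^esub> n \<in> H" using a r M.submoduleE(4)[OF H] by simp
        \<comment> \<open>Likewise the defect of linearity.\<close>
        let ?r = "r \<otimes> c n \<ominus> c (r \<odot>\<^bsub>M\<^esub> n)"
        have r': "?r \<in> carrier R" using a s r c(1) by simp
        have "r \<otimes> c n = ?r \<oplus> c (r \<odot>\<^bsub>M\<^esub> n)" using a r s c(1)[of "r \<odot>\<^bsub>M\<^esub> n"] c(1)[of n] by algebra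
        then have e: "\<phi> r \<otimes>\<^bsub>S\<^esub> \<phi> (c n) = \<phi> ?r \<oplus>\<^bsub>S\<^esub> \<phi> (c (r \<odot>\<^bsub>M\<^esub> n))"
          using a s r r' c(1) by (metis hom(2,3))
        have "h x = \<phi> (c n) \<otimes>\<^bsub>S\<^esub> (\<phi> r \<otimes>\<^bsub>S\<^esub> a) \<ominus>\<^bsub>S\<^esub> \<phi> (c (r \<odot>\<^bsub>M\<^esub> n)) \<otimes>\<^bsub>S\<^esub> a"
          using a s r hom(1) by (simp add: x h_diff kd h_of)
        also have "\<dots> = (\<phi> r \<otimes>\<^bsub>S\<^esub> \<phi> (c n)) \<otimes>\<^bsub>S\<^esub> a \<ominus>\<^bsub>S\<^esub> \<phi> (c (r \<odot>\<^bsub>M\<^esub> n)) \<otimes>\<^bsub>S\<^esub> a"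
          using a r hom(1)[OF r] hom(1)[OF c(1)[OF a(2)]] by (simp add: S.m_ac)
        also have "\<dots> = \<phi> ?r \<otimes>\<^bsub>S\<^esub> a"
          unfolding e using a hom(1)[OF r'] hom(1)[OF c(1)[OF s]] by algebra
        also have "\<dots> \<in> K"
        proof (rule key[OF r' _ a(1)])
          have "?r \<odot>\<^bsub>M\<^esub> m = (r \<odot>\<^bsub>M\<^esub> n) \<oplus>\<^bsub>M\<^esub> \<ominus>\<^bsub>M\<^esub> (r \<odot>\<^bsub>M\<^esub> n)"
            using a s r c m by (simp add: a_minus_def M.smult_l_distr M.smult_l_minus M.smult_assoc1)
          then show "?r \<odot>\<^bsub>M\<^esub> m = \<zero>\<^bsub>M\<^esub>" using HM[OF s] by (simp add: M.M.r_neg)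
        qed
        finally show ?thesis .
      qed
      with kx show ?case by simp
    next
      case zero
      then show ?case using h.hom_one by simp
    next
      case (add x y)
      then show ?case using keys_add[of x y] by (auto simp: h_add)
    next
      case (uminus x)
      then show ?case by (simp add: h_minus)
    qed
    from this[OF nullH] have "\<phi> (c m) \<in> K" using mH hom(1)[OF c(1)[OF mH]] by (simp add: h_of)
    moreover have "\<phi> (\<one> \<ominus> c m) \<otimes>\<^bsub>S\<^esub> \<one>\<^bsub>S\<^esub> \<in> K"
      using c[OF mH] m by (intro key) (auto simp: a_minus_def M.smult_l_distr M.smult_l_minus M.M.r_neg)
    moreover have "\<phi> (\<one> \<ominus> c m) \<oplus>\<^bsub>S\<^esub> \<phi> (c m) = \<one>\<^bsub>S\<^esub>"
    proof -
      have "(\<one> \<ominus> c m) \<oplus> c m = \<one>" using c(1)[OF mH] by algebra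
      then show ?thesis using c(1)[OF mH] by (metis hom(2,4) R.minus_closed R.one_closed)
    qed
    ultimately show ?thesis
      using K.a_closed[of "\<phi> (\<one> \<ominus> c m)" "\<phi> (c m)"] c(1)[OF mH] hom(1) by simp
  qed
  then show ?thesis using M.ann_ideal[OF m] by (simp add: extension_system_iff[OF S \<phi>])
qed

section \<open>Epimorphisms\<close>

text \<open>
  The multiplication \<open>(a \<otimes> b) (c \<otimes> d) = a c \<otimes> b d\<close> on formal sums of pairs. The formal sums with this
  multiplication are the monoid ring over the integers of the multiplicative monoid of \<open>S \<times> S\<close>, and the
  tensor product of \<open>S\<close> with itself is their quotient by the ideal of relators.
\<close>

definition tensor_times :: "('s, 'q) ring_scheme \<Rightarrow> ('s \<times> 's \<Rightarrow>\<^sub>0 int) \<Rightarrow> ('s \<times> 's \<Rightarrow>\<^sub>0 int) \<Rightarrow> ('s \<times> 's \<Rightarrow>\<^sub>0 int)" where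
  "tensor_times S x y =
     frag_extend (\<lambda>(a, b). frag_extend (\<lambda>(c, d). frag_of (a \<otimes>\<^bsub>S\<^esub> c, b \<otimes>\<^bsub>S\<^esub> d)) y) x"

definition tensor_free_ring :: "('s, 'q) ring_scheme \<Rightarrow> ('s \<times> 's \<Rightarrow>\<^sub>0 int) ring" where
  "tensor_free_ring S =
     \<lparr>carrier = {x. Poly_Mapping.keys x \<subseteq> carrier S \<times> carrier S}, mult = tensor_times S,
      one = frag_of (\<one>\<^bsub>S\<^esub>, \<one>\<^bsub>S\<^esub>), zero = 0, add = (+)\<rparr>"

lemma frag_extend_fun_diff: "frag_extend (\<lambda>p. f p - g p) x = frag_extend f x - frag_extend g x"
proof -
  have "Poly_Mapping.keys x \<subseteq> UNIV" by simp
  then show ?thesis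
    by (induction x rule: frag_induction) (auto simp: frag_extend_diff)
qed

lemma tensor_times_simps [simp]:
  "tensor_times S 0 y = 0" "tensor_times S x 0 = 0"
  "tensor_times S (x - x') y = tensor_times S x y - tensor_times S x' y"
  "tensor_times S x (y - y') = tensor_times S x y - tensor_times S x y'"
  "tensor_times S (frag_of (a, b)) (frag_of (c, d)) = frag_of (a \<otimes>\<^bsub>S\<^esub> c, b \<otimes>\<^bsub>S\<^esub> d)"
  by (auto simp: tensor_times_def frag_extend_diff split_def frag_extend_fun_diff intro: frag_extend_eq_0)

lemma tensor_times_add:
  "tensor_times S (x + x') y = tensor_times S x y + tensor_times S x' y"
  "tensor_times S x (y + y') = tensor_times S x y + tensor_times S x y'"
  using tensor_times_simps(3)[of S x "- x'" y] tensor_times_simps(3)[of S 0 x' y]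
    tensor_times_simps(4)[of S x y "- y'"] tensor_times_simps(4)[of S x 0 y'] by simp_all

lemma tensor_free_ring_cring:
  assumes "cring S"
  shows "cring (tensor_free_ring S)"
proof -
  interpret S: cring S by fact
  let ?C = "carrier S \<times> carrier S"
  have cl: "Poly_Mapping.keys (tensor_times S x y) \<subseteq> ?C"
    if "Poly_Mapping.keys x \<subseteq> ?C" "Poly_Mapping.keys y \<subseteq> ?C" for x y
    using that
  proof (induction x rule: frag_induction)
    case (one p)
    from one(2,1) show ?case
    proof (induction y rule: frag_induction)
      case (diff x y)
      then show ?case using keys_diff[of "tensor_times S (frag_of p) x" "tensor_times S (frag_of p) y"] by auto
    qed (cases p, auto)
  next
    case (diff x x')
    then show ?case using keys_diff[of "tensor_times S x y" "tensor_times S x' y"] by auto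
  qed auto
  have comm: "tensor_times S x y = tensor_times S y x"
    if "Poly_Mapping.keys x \<subseteq> ?C" "Poly_Mapping.keys y \<subseteq> ?C" for x y
    using that
  proof (induction x rule: frag_induction)
    case (one p)
    from one(2,1) show ?case
      by (induction y rule: frag_induction) (cases p, auto simp: S.m_comm)+
  qed auto
  have assoc: "tensor_times S (tensor_times S x y) z = tensor_times S x (tensor_times S y z)"
    if "Poly_Mapping.keys x \<subseteq> ?C" "Poly_Mapping.keys y \<subseteq> ?C" "Poly_Mapping.keys z \<subseteq> ?C" for x y z
    using that
  proof (induction x rule: frag_induction)
    case (one p)
    from one(2,1,3) show ?case
    proof (induction y rule: frag_induction)
      case (one q)
      from one(3,1,2) show ?case
        by (induction z rule: frag_induction) (cases p, cases q, auto simp: S.m_assoc)+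
    qed auto
  qed auto
  have unit: "tensor_times S (frag_of (\<one>\<^bsub>S\<^esub>, \<one>\<^bsub>S\<^esub>)) x = x" if "Poly_Mapping.keys x \<subseteq> ?C" for x
    using that by (induction x rule: frag_induction) auto
  show ?thesis
  proof (rule cringI)
    show "abelian_group (tensor_free_ring S)"
    proof (rule abelian_groupI)
      fix x assume "x \<in> carrier (tensor_free_ring S)"
      then show "\<exists>y\<in>carrier (tensor_free_ring S). y \<oplus>\<^bsub>tensor_free_ring S\<^esub> x = \<zero>\<^bsub>tensor_free_ring S\<^esub>"
        by (intro bexI[of _ "- x"]) (auto simp: tensor_free_ring_def)
    qed (use keys_add in \<open>fastforce simp: tensor_free_ring_def\<close>)+
    show "comm_monoid (tensor_free_ring S)"
      by (rule comm_monoidI) (auto simp: tensor_free_ring_def cl assoc unit intro: comm)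
  qed (simp add: tensor_free_ring_def tensor_times_add)
qed

lemma tensor_null_ideal:
  fixes R (structure)
  assumes R: "cring R" and S: "cring S" and \<phi>: "\<phi> \<in> ring_hom R S"
  shows "ideal (tensor_null R (restr_module \<phi> S) (restr_module \<phi> S)) (tensor_free_ring S)"
proof -
  let ?A = "restr_module \<phi> S"
  let ?C = "carrier S \<times> carrier S"
  interpret S: cring S by fact
  interpret F: cring "tensor_free_ring S" by (rule tensor_free_ring_cring[OF S])
  have A: "module R ?A" by (rule restr_module_is_module[OF R S \<phi>])
  note null = tensor_null_add_left[of _ ?A _ _ ?A R] tensor_null_add_right[of _ ?A _ ?A _ R]
    tensor_null_smult[of _ R _ ?A _ ?A]
  have one: "tensor_times S (frag_of (c, d)) x \<in> tensor_null R ?A ?A"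
    if "c \<in> carrier S" "d \<in> carrier S" "x \<in> tensor_null R ?A ?A" for c d x
    using A A that(3)
  proof (induction x rule: tensor_null_induct)
    case (relator x)
    then show ?case unfolding tensor_relators_def
    proof (elim UnE CollectE exE conjE)
      fix a a' b assume "x = frag_of (a \<oplus>\<^bsub>?A\<^esub> a', b) - frag_of (a, b) - frag_of (a', b)"
        and "a \<in> carrier ?A" "a' \<in> carrier ?A" "b \<in> carrier ?A"
      then show ?thesis using that null(1)[of "c \<otimes>\<^bsub>S\<^esub> a" "c \<otimes>\<^bsub>S\<^esub> a'" "d \<otimes>\<^bsub>S\<^esub> b"] by (simp add: S.r_distr)
    next
      fix a b b' assume "x = frag_of (a, b \<oplus>\<^bsub>?A\<^esub> b') - frag_of (a, b) - frag_of (a, b')"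
        and "a \<in> carrier ?A" "b \<in> carrier ?A" "b' \<in> carrier ?A"
      then show ?thesis using that null(2)[of "c \<otimes>\<^bsub>S\<^esub> a" "d \<otimes>\<^bsub>S\<^esub> b" "d \<otimes>\<^bsub>S\<^esub> b'"] by (simp add: S.r_distr)
    next
      fix r a b assume "x = frag_of (r \<odot>\<^bsub>?A\<^esub> a, b) - frag_of (a, r \<odot>\<^bsub>?A\<^esub> b)"
        and "r \<in> carrier R" "a \<in> carrier ?A" "b \<in> carrier ?A"
      then show ?thesis using that null(3)[of r "c \<otimes>\<^bsub>S\<^esub> a" "d \<otimes>\<^bsub>S\<^esub> b"] ring_hom_closed[OF \<phi>, of r]
        by (simp add: S.m_lcomm)
    qed
  next
    case zero
    then show ?case by (simp add: tensor_null_zero)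
  next
    case (add x y)
    then show ?case by (simp add: tensor_times_add tensor_null_add)
  next
    case (uminus x)
    then show ?case using tensor_null_uminus[OF A A] tensor_times_simps(4)[of S "frag_of (c, d)" 0 x] by simp
  qed
  have mult: "tensor_times S y x \<in> tensor_null R ?A ?A"
    if "Poly_Mapping.keys y \<subseteq> ?C" "x \<in> tensor_null R ?A ?A" for x y
    using that
  proof (induction y rule: frag_induction)
    case (diff a b)
    then show ?case using tensor_null_diff[OF A A] by simp
  qed (auto simp: tensor_null_zero one)
  show ?thesis
    by (rule F.idealI_smult)
      (use tensor_null_keys[OF A A] in \<open>auto simp: tensor_free_ring_def tensor_null_zero mult intro: tensor_null_add\<close>)
qed

text \<open>
  The maps \<open>s \<mapsto> s \<otimes> 1\<close> and \<open>s \<mapsto> 1 \<otimes> s\<close> into the ring \<open>S \<otimes>\<^sub>R S\<close> agree on the image of \<open>R\<close>, hence everywhere.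
\<close>

lemma epi_tensor_symmetric:
  fixes R (structure)
  assumes R: "cring R" and S: "cring S" and epi: "ring_epi R S \<phi>" and s: "s \<in> carrier S"
  shows "frag_of (s, \<one>\<^bsub>S\<^esub>) - frag_of (\<one>\<^bsub>S\<^esub>, s) \<in> tensor_null R (restr_module \<phi> S) (restr_module \<phi> S)"
proof -
  have \<phi>: "\<phi> \<in> ring_hom R S" using epi by (simp add: ring_epi_def)
  let ?A = "restr_module \<phi> S"
  let ?F = "tensor_free_ring S" and ?I = "tensor_null R ?A ?A"
  interpret S: cring S by fact
  interpret F: cring ?F by (rule tensor_free_ring_cring[OF S])
  interpret I: ideal ?I ?F by (rule tensor_null_ideal[OF R S \<phi>])
  have F: "carrier ?F = {x. Poly_Mapping.keys x \<subseteq> carrier S \<times> carrier S}" "add ?F = (+)"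
    "mult ?F = tensor_times S" "one ?F = frag_of (\<one>\<^bsub>S\<^esub>, \<one>\<^bsub>S\<^esub>)" "zero ?F = 0"
    by (auto simp: tensor_free_ring_def)
  have minus: "x \<ominus>\<^bsub>?F\<^esub> y = x - y" if "x \<in> carrier ?F" "y \<in> carrier ?F" for x y
  proof -
    have "\<ominus>\<^bsub>?F\<^esub> y = - y" by (rule F.minus_equality) (use that in \<open>auto simp: F\<close>)
    then show ?thesis by (simp add: a_minus_def F)
  qed
  have eq: "?I +>\<^bsub>?F\<^esub> x = ?I +>\<^bsub>?F\<^esub> y \<longleftrightarrow> x - y \<in> ?I" if "x \<in> carrier ?F" "y \<in> carrier ?F" for x y
    using F.quotient_eq_iff_same_a_r_cos[OF I.is_ideal that] minus[OF that] by simp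
  note q = I.rcos_ring_hom
  note null = tensor_null_add_left[of _ ?A _ _ ?A R] tensor_null_add_right[of _ ?A _ ?A _ R]
    tensor_null_smult[of _ R _ ?A _ ?A]
  have "(\<lambda>s. ?I +>\<^bsub>?F\<^esub> frag_of (s, \<one>\<^bsub>S\<^esub>)) s = (\<lambda>s. ?I +>\<^bsub>?F\<^esub> frag_of (\<one>\<^bsub>S\<^esub>, s)) s"
  proof (rule ring_epi_eq[OF epi S I.quotient_is_cring[OF F.is_cring] _ _ _ s])
    show "(\<lambda>s. ?I +>\<^bsub>?F\<^esub> frag_of (s, \<one>\<^bsub>S\<^esub>)) \<in> ring_hom S (?F Quot ?I)"
    proof (rule ring_hom_memI)
      fix x y assume xy: "x \<in> carrier S" "y \<in> carrier S"
      show "?I +>\<^bsub>?F\<^esub> frag_of (x \<otimes>\<^bsub>S\<^esub> y, \<one>\<^bsub>S\<^esub>)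
          = (?I +>\<^bsub>?F\<^esub> frag_of (x, \<one>\<^bsub>S\<^esub>)) \<otimes>\<^bsub>?F Quot ?I\<^esub> (?I +>\<^bsub>?F\<^esub> frag_of (y, \<one>\<^bsub>S\<^esub>))"
        using xy by (subst ring_hom_mult[OF q, symmetric]) (auto simp: F)
      have "?I +>\<^bsub>?F\<^esub> frag_of (x \<oplus>\<^bsub>S\<^esub> y, \<one>\<^bsub>S\<^esub>)
          = ?I +>\<^bsub>?F\<^esub> (frag_of (x, \<one>\<^bsub>S\<^esub>) + frag_of (y, \<one>\<^bsub>S\<^esub>))"
        using xy null(1)[of x y "\<one>\<^bsub>S\<^esub>"] keys_add[of "frag_of (x, \<one>\<^bsub>S\<^esub>)" "frag_of (y, \<one>\<^bsub>S\<^esub>)"]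
        by (subst eq) (auto simp: F diff_diff_eq)
      then show "?I +>\<^bsub>?F\<^esub> frag_of (x \<oplus>\<^bsub>S\<^esub> y, \<one>\<^bsub>S\<^esub>)
          = (?I +>\<^bsub>?F\<^esub> frag_of (x, \<one>\<^bsub>S\<^esub>)) \<oplus>\<^bsub>?F Quot ?I\<^esub> (?I +>\<^bsub>?F\<^esub> frag_of (y, \<one>\<^bsub>S\<^esub>))"
        using xy by (subst ring_hom_add[OF q, symmetric]) (auto simp: F)
    next
      show "?I +>\<^bsub>?F\<^esub> frag_of (\<one>\<^bsub>S\<^esub>, \<one>\<^bsub>S\<^esub>) = \<one>\<^bsub>?F Quot ?I\<^esub>"
        using ring_hom_one[OF q] by (simp add: F)
    qed (use ring_hom_closed[OF q] in \<open>simp add: F\<close>)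
    show "(\<lambda>s. ?I +>\<^bsub>?F\<^esub> frag_of (\<one>\<^bsub>S\<^esub>, s)) \<in> ring_hom S (?F Quot ?I)"
    proof (rule ring_hom_memI)
      fix x y assume xy: "x \<in> carrier S" "y \<in> carrier S"
      show "?I +>\<^bsub>?F\<^esub> frag_of (\<one>\<^bsub>S\<^esub>, x \<otimes>\<^bsub>S\<^esub> y)
          = (?I +>\<^bsub>?F\<^esub> frag_of (\<one>\<^bsub>S\<^esub>, x)) \<otimes>\<^bsub>?F Quot ?I\<^esub> (?I +>\<^bsub>?F\<^esub> frag_of (\<one>\<^bsub>S\<^esub>, y))"
        using xy by (subst ring_hom_mult[OF q, symmetric]) (auto simp: F)
      have "?I +>\<^bsub>?F\<^esub> frag_of (\<one>\<^bsub>S\<^esub>, x \<oplus>\<^bsub>S\<^esub> y)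
          = ?I +>\<^bsub>?F\<^esub> (frag_of (\<one>\<^bsub>S\<^esub>, x) + frag_of (\<one>\<^bsub>S\<^esub>, y))"
        using xy null(2)[of "\<one>\<^bsub>S\<^esub>" x y] keys_add[of "frag_of (\<one>\<^bsub>S\<^esub>, x)" "frag_of (\<one>\<^bsub>S\<^esub>, y)"]
        by (subst eq) (auto simp: F diff_diff_eq)
      then show "?I +>\<^bsub>?F\<^esub> frag_of (\<one>\<^bsub>S\<^esub>, x \<oplus>\<^bsub>S\<^esub> y)
          = (?I +>\<^bsub>?F\<^esub> frag_of (\<one>\<^bsub>S\<^esub>, x)) \<oplus>\<^bsub>?F Quot ?I\<^esub> (?I +>\<^bsub>?F\<^esub> frag_of (\<one>\<^bsub>S\<^esub>, y))"
        using xy by (subst ring_hom_add[OF q, symmetric]) (auto simp: F)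
    next
      show "?I +>\<^bsub>?F\<^esub> frag_of (\<one>\<^bsub>S\<^esub>, \<one>\<^bsub>S\<^esub>) = \<one>\<^bsub>?F Quot ?I\<^esub>"
        using ring_hom_one[OF q] by (simp add: F)
    qed (use ring_hom_closed[OF q] in \<open>simp add: F\<close>)
    show "?I +>\<^bsub>?F\<^esub> frag_of (\<phi> r, \<one>\<^bsub>S\<^esub>) = ?I +>\<^bsub>?F\<^esub> frag_of (\<one>\<^bsub>S\<^esub>, \<phi> r)" if "r \<in> carrier R" for r
      using that null(3)[of r "\<one>\<^bsub>S\<^esub>" "\<one>\<^bsub>S\<^esub>"] ring_hom_closed[OF \<phi> that] by (subst eq) (auto simp: F)
  qed
  then show ?thesis using s by (simp add: eq F)
qed

text \<open>
  Apply \<open>S \<otimes> _\<close> to the quotient map \<open>S \<rightarrow> S / \<phi>(R)\<close>: in \<open>S \<otimes> S/\<phi>(R)\<close> the element \<open>1 \<otimes> [s]\<close> equals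
  \<open>s \<otimes> [1] = 0\<close>. By flatness the annihilator of \<open>[s]\<close>, which consists of the \<open>r\<close> that multiply \<open>s\<close> into
  \<open>\<phi>(R)\<close>, extends to the unit ideal.
\<close>

lemma flat_epi_fractions:
  fixes R (structure)
  assumes R: "cring R" and S: "cring S" and fe: "flat_epi R S \<phi>" and s: "s \<in> carrier S"
  shows "{r \<in> carrier R. \<phi> r \<otimes>\<^bsub>S\<^esub> s \<in> \<phi> ` carrier R} \<in> extension_system R S \<phi>"
proof -
  let ?A = "restr_module \<phi> S"
  interpret R: cring R by fact
  interpret S: cring S by fact
  have \<phi>: "\<phi> \<in> ring_hom R S" and flat: "flat_module R ?A" and epi: "ring_epi R S \<phi>"
    using fe by (auto simp: flat_epi_def flat_ring_hom_def)
  note hom = ring_hom_closed[OF \<phi>] ring_hom_add[OF \<phi>] ring_hom_mult[OF \<phi>] ring_hom_one[OF \<phi>]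
  have A: "module R ?A" by (rule restr_module_is_module[OF R S \<phi>])
  have "is_linear R (self_module R) ?A \<phi>" using hom by (auto simp: is_linear_def)
  from linear_image_submodule[OF self_module_is_module[OF R] A this]
  have sub: "submodule (\<phi> ` carrier R) R ?A" by simp
  \<comment> \<open>The cokernel of \<open>\<phi>\<close>, as an \<open>R\<close>-module.\<close>
  interpret Q: module_modulo R ?A "\<phi> ` carrier R" by (rule submodule_module_modulo[OF A sub])
  let ?Q = "quot_module ?A (\<phi> ` carrier R)"
  let ?q = "\<lambda>x. \<phi> ` carrier R +>\<^bsub>?A\<^esub> x"
  have Qm: "module R ?Q" by (rule Q.quot_is_module)
  interpret Qm: module R ?Q by (rule Qm)
  have "free_map ?q (frag_of (s, \<one>\<^bsub>S\<^esub>) - frag_of (\<one>\<^bsub>S\<^esub>, s)) \<in> tensor_null R ?A ?Q"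
    by (rule free_map_null[OF A A Qm Q.coset_linear epi_tensor_symmetric[OF R S epi s]])
  then have d: "frag_of (s, ?q \<one>\<^bsub>S\<^esub>) - frag_of (\<one>\<^bsub>S\<^esub>, ?q s) \<in> tensor_null R ?A ?Q"
    by (simp add: frag_extend_diff)
  have "?q \<one>\<^bsub>S\<^esub> = \<zero>\<^bsub>?Q\<^esub>"
    using Q.coset_eq_zero_iff[of "\<one>\<^bsub>S\<^esub>"] hom(4) R.one_closed by (auto intro: rev_image_eqI)
  moreover have "frag_of (s, \<zero>\<^bsub>?Q\<^esub>) \<in> tensor_null R ?A ?Q"
    using tensor_null_uminus[OF A Qm tensor_null_add_right[of s ?A "\<zero>\<^bsub>?Q\<^esub>" ?Q "\<zero>\<^bsub>?Q\<^esub>" R]] s by simp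
  ultimately have "frag_of (\<one>\<^bsub>S\<^esub>, ?q s) \<in> tensor_null R ?A ?Q"
    using tensor_null_diff[OF A Qm _ d, of "frag_of (s, \<zero>\<^bsub>?Q\<^esub>)"] by simp
  then have "ann R ?Q (?q s) \<in> extension_system R S \<phi>"
    using s by (intro flat_ann_mem[OF R S \<phi> flat Qm]) (auto simp: Q.carrier_quot)
  also have "ann R ?Q (?q s) = {r \<in> carrier R. \<phi> r \<otimes>\<^bsub>S\<^esub> s \<in> \<phi> ` carrier R}"
    unfolding ann_def
    by (intro Collect_cong conj_cong refl) (use s hom(1) in \<open>simp add: Q.quot_smult Q.coset_eq_zero_iff\<close>)
  finally show ?thesis .
qed

section \<open>The unit of extension of scalars\<close>

lemma tensor_elem_simps:
  fixes R (structure)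
  assumes A: "module R A" and B: "module R B" and a: "a \<in> carrier A" and b: "b \<in> carrier B"
  shows tensor_elem_closed: "tensor_elem R A B a b \<in> carrier (tensor R A B)"
    and tensor_elem_eq_zero_iff:
      "tensor_elem R A B a b = \<zero>\<^bsub>tensor R A B\<^esub> \<longleftrightarrow> frag_of (a, b) \<in> tensor_null R A B"
    and tensor_elem_smult: "r \<in> carrier R
      \<Longrightarrow> r \<odot>\<^bsub>tensor R A B\<^esub> tensor_elem R A B a b = tensor_elem R A B (r \<odot>\<^bsub>A\<^esub> a) b"
    and tensor_elem_smult_right: "r \<in> carrier R
      \<Longrightarrow> r \<odot>\<^bsub>tensor R A B\<^esub> tensor_elem R A B a b = tensor_elem R A B a (r \<odot>\<^bsub>B\<^esub> b)"
    and tensor_elem_add_right: "b' \<in> carrier B \<Longrightarrow>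
      tensor_elem R A B a b \<oplus>\<^bsub>tensor R A B\<^esub> tensor_elem R A B a b' = tensor_elem R A B a (b \<oplus>\<^bsub>B\<^esub> b')"
proof -
  interpret A: module R A by fact
  interpret B: module R B by fact
  interpret T: module_modulo R "tensor_free A B" "tensor_null R A B" by (rule tensor_modulo[OF A B])
  have k: "frag_of (a, b) \<in> carrier (tensor_free A B)" using a b by (simp add: tensor_free_def)
  show "tensor_elem R A B a b \<in> carrier (tensor R A B)"
    using k unfolding tensor_def tensor_elem_def T.carrier_quot by blast
  show "tensor_elem R A B a b = \<zero>\<^bsub>tensor R A B\<^esub> \<longleftrightarrow> frag_of (a, b) \<in> tensor_null R A B"
    unfolding tensor_def tensor_elem_def by (rule T.coset_eq_zero_iff[OF k])
  show smult: "r \<odot>\<^bsub>tensor R A B\<^esub> tensor_elem R A B a b = tensor_elem R A B (r \<odot>\<^bsub>A\<^esub> a) b"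
    if r: "r \<in> carrier R" for r
    unfolding tensor_def tensor_elem_def T.quot_smult[OF r k] by (simp add: tensor_free_def)
  show "r \<odot>\<^bsub>tensor R A B\<^esub> tensor_elem R A B a b = tensor_elem R A B a (r \<odot>\<^bsub>B\<^esub> b)"
    if r: "r \<in> carrier R" for r
    unfolding smult[OF r] using tensor_null_smult[OF r a b]
    by (simp add: tensor_elem_def tensor_coset_eq_iff[OF A B])
  show "tensor_elem R A B a b \<oplus>\<^bsub>tensor R A B\<^esub> tensor_elem R A B a b' = tensor_elem R A B a (b \<oplus>\<^bsub>B\<^esub> b')"
    if b': "b' \<in> carrier B"
  proof -
    have k': "frag_of (a, b') \<in> carrier (tensor_free A B)" using a b' by (simp add: tensor_free_def)
    have "frag_of (a, b) + frag_of (a, b') - frag_of (a, b \<oplus>\<^bsub>B\<^esub> b') \<in> tensor_null R A B"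
      using tensor_null_uminus[OF A B tensor_null_add_right[OF a b b', of R]] by (simp add: algebra_simps)
    then show ?thesis
      unfolding tensor_def tensor_elem_def T.quot_add[OF k k'] tensor_coset_eq_iff[OF A B]
      by (simp add: tensor_free_def)
  qed
qed

lemma tensor_induct [consumes 3, case_names zero diff elem]:
  assumes A: "module R A" and B: "module R B" and t: "t \<in> carrier (tensor R A B)"
    and z: "P \<zero>\<^bsub>tensor R A B\<^esub>"
    and d: "\<And>t t'. t \<in> carrier (tensor R A B) \<Longrightarrow> t' \<in> carrier (tensor R A B) \<Longrightarrow> P t \<Longrightarrow> P t'
      \<Longrightarrow> P (t \<ominus>\<^bsub>tensor R A B\<^esub> t')"
    and e: "\<And>a b. a \<in> carrier A \<Longrightarrow> b \<in> carrier B \<Longrightarrow> P (tensor_elem R A B a b)"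
  shows "P t"
proof -
  interpret T: module_modulo R "tensor_free A B" "tensor_null R A B" by (rule tensor_modulo[OF A B])
  interpret M: module R "tensor R A B" by (rule tensor_is_module[OF A B])
  let ?q = "\<lambda>x. tensor_null R A B +>\<^bsub>tensor_free A B\<^esub> x"
  have F: "carrier (tensor_free A B) = {x. Poly_Mapping.keys x \<subseteq> carrier A \<times> carrier B}"
    by (auto simp: tensor_free_def)
  obtain x where x: "Poly_Mapping.keys x \<subseteq> carrier A \<times> carrier B" "t = ?q x"
    using t by (auto simp: carrier_tensor)
  have q: "?q y \<in> carrier (tensor R A B)" if "Poly_Mapping.keys y \<subseteq> carrier A \<times> carrier B" for y
    using that by (auto simp: carrier_tensor)
  have "P (?q x)"
  proof (rule free_Abelian_group_induct[OF x(1), where P = "\<lambda>x. P (?q x)"])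
    show "P (?q 0)" using z T.quot_zero by (simp add: tensor_def tensor_free_def)
  next
    fix x y assume k: "Poly_Mapping.keys x \<subseteq> carrier A \<times> carrier B" "Poly_Mapping.keys y \<subseteq> carrier A \<times> carrier B"
      and P: "P (?q x)" "P (?q y)"
    have kd: "Poly_Mapping.keys (x - y) \<subseteq> carrier A \<times> carrier B" using k keys_diff[of x y] by blast
    have "?q (x - y) \<oplus>\<^bsub>tensor R A B\<^esub> ?q y = ?q x"
      using T.quot_add[of "x - y" y] k kd by (simp add: F tensor_def) (simp add: tensor_free_def)
    then have "?q (x - y) = ?q x \<ominus>\<^bsub>tensor R A B\<^esub> ?q y"
      using q[OF kd] q[OF k(1)] q[OF k(2)]
      by (simp add: a_minus_def M.M.a_assoc M.M.r_neg flip: \<open>?q (x - y) \<oplus>\<^bsub>tensor R A B\<^esub> ?q y = ?q x\<close>)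
    then show "P (?q (x - y))" using d[OF q[OF k(1)] q[OF k(2)] P] by simp
  next
    show "P (?q (frag_of p))" if "p \<in> carrier A \<times> carrier B" for p
      using e that by (auto simp: tensor_elem_def)
  qed
  then show ?thesis using x(2) by simp
qed

lemma ext_unit_linear:
  fixes R (structure)
  assumes R: "cring R" and S: "cring S" and \<phi>: "\<phi> \<in> ring_hom R S" and M: "module R M"
  shows "is_linear R M (ext_scalars R S \<phi> M) (ext_unit R S \<phi> M)"
proof -
  interpret S: cring S by fact
  interpret M: module R M by fact
  have A: "module R (restr_module \<phi> S)" by (rule restr_module_is_module[OF R S \<phi>])
  show ?thesis
    unfolding is_linear_def ext_scalars_def ext_unit_def
    by (auto simp: tensor_elem_closed[OF A M] tensor_elem_add_right[OF A M] tensor_elem_smult_right[OF A M])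
qed

lemma ext_unit_kernel:
  fixes R (structure)
  assumes R: "cring R" and S: "cring S" and \<phi>: "\<phi> \<in> ring_hom R S"
    and flat: "flat_module R (restr_module \<phi> S)" and M: "module R M" and m: "m \<in> carrier M"
    and z: "ext_unit R S \<phi> M m = \<zero>\<^bsub>ext_scalars R S \<phi> M\<^esub>"
  shows "ann R M m \<in> extension_system R S \<phi>"
proof -
  interpret S: cring S by fact
  have A: "module R (restr_module \<phi> S)" by (rule restr_module_is_module[OF R S \<phi>])
  show ?thesis
    using z m by (intro flat_ann_mem[OF R S \<phi> flat M m])
      (simp add: ext_unit_def ext_scalars_def tensor_elem_eq_zero_iff[OF A M])
qed

text \<open>
  For a pure tensor, \<open>\<phi>(r) s = \<phi>(r')\<close> gives \<open>r (s \<otimes> m) = \<phi>(r') \<otimes> m = 1 \<otimes> r' m\<close>. The elements that some member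
  of the system multiplies into the image of \<open>M\<close> are closed under differences, as the system is closed
  under intersections.
\<close>

lemma ext_unit_cokernel:
  fixes R (structure)
  assumes R: "cring R" and S: "cring S" and fe: "flat_epi R S \<phi>" and M: "module R M"
    and t: "t \<in> carrier (ext_scalars R S \<phi> M)"
  shows "\<exists>J\<in>extension_system R S \<phi>. \<forall>r\<in>J. r \<odot>\<^bsub>ext_scalars R S \<phi> M\<^esub> t \<in> ext_unit R S \<phi> M ` carrier M"
proof -
  let ?A = "restr_module \<phi> S" and ?T = "tensor R (restr_module \<phi> S) M"
  let ?im = "ext_unit R S \<phi> M ` carrier M"
  interpret R: cring R by fact
  interpret S: cring S by fact
  interpret M: module R M by fact
  have \<phi>: "\<phi> \<in> ring_hom R S" using fe by (simp add: flat_epi_def flat_ring_hom_def)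
  interpret G: gabriel_system R "extension_system R S \<phi>" by (rule extension_system_gabriel[OF R S \<phi>])
  have A: "module R ?A" by (rule restr_module_is_module[OF R S \<phi>])
  have Tm: "module R ?T" by (rule tensor_is_module[OF A M])
  interpret T: module R ?T by (rule Tm)
  have sub: "submodule ?im R ?T"
    by (rule linear_image_submodule[OF M Tm ext_unit_linear[OF R S \<phi> M, unfolded ext_scalars_def]])
  note im = T.submoduleE[OF sub]
  have "t \<in> carrier ?T" using t by (simp add: ext_scalars_def)
  with A M show ?thesis
    unfolding ext_scalars_def
  proof (induction t rule: tensor_induct)
    case zero
    have "\<zero>\<^bsub>?T\<^esub> \<in> ?im" using subgroup.one_closed[OF submodule.axioms(1)[OF sub]] by simp
    then show ?case by (intro bexI[OF _ G.carrier_mem]) simp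
  next
    case (diff t t')
    then obtain J J' where J: "J \<in> extension_system R S \<phi>" "\<And>r. r \<in> J \<Longrightarrow> r \<odot>\<^bsub>?T\<^esub> t \<in> ?im"
      "J' \<in> extension_system R S \<phi>" "\<And>r. r \<in> J' \<Longrightarrow> r \<odot>\<^bsub>?T\<^esub> t' \<in> ?im" by blast
    have "r \<odot>\<^bsub>?T\<^esub> (t \<ominus>\<^bsub>?T\<^esub> t') \<in> ?im" if r: "r \<in> J" "r \<in> J'" for r
    proof -
      have "r \<odot>\<^bsub>?T\<^esub> (t \<ominus>\<^bsub>?T\<^esub> t') = r \<odot>\<^bsub>?T\<^esub> t \<oplus>\<^bsub>?T\<^esub> \<ominus>\<^bsub>?T\<^esub> (r \<odot>\<^bsub>?T\<^esub> t')"
        using diff(1,2) G.mem_carrier[OF J(1) r(1)] by (simp add: a_minus_def T.smult_r_distr T.smult_r_minus)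
      then show ?thesis using im(3,5) J(2)[OF r(1)] J(4)[OF r(2)] by simp
    qed
    then show ?case by (intro bexI[OF _ G.mem_Int[OF J(1,3)]]) simp
  next
    case (elem s m)
    then have s: "s \<in> carrier S" by simp
    have "r \<odot>\<^bsub>?T\<^esub> tensor_elem R ?A M s m \<in> ?im"
      if r: "r \<in> carrier R" and rs: "\<phi> r \<otimes>\<^bsub>S\<^esub> s \<in> \<phi> ` carrier R" for r
    proof -
      obtain r' where r': "r' \<in> carrier R" "\<phi> r \<otimes>\<^bsub>S\<^esub> s = \<phi> r'" using rs by blast
      have "r \<odot>\<^bsub>?T\<^esub> tensor_elem R ?A M s m = tensor_elem R ?A M (r' \<odot>\<^bsub>?A\<^esub> \<one>\<^bsub>S\<^esub>) m"
        using r r' s elem ring_hom_closed[OF \<phi> r'(1)]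
        by (simp add: tensor_elem_smult[OF A M])
      also have "\<dots> = ext_unit R S \<phi> M (r' \<odot>\<^bsub>M\<^esub> m)"
        using r' elem tensor_elem_smult[OF A M, of "\<one>\<^bsub>S\<^esub>" m r'] tensor_elem_smult_right[OF A M, of "\<one>\<^bsub>S\<^esub>" m r']
        by (simp add: ext_unit_def)
      finally show ?thesis using r' elem by simp
    qed
    then show ?case by (intro bexI[OF _ flat_epi_fractions[OF R S fe s]]) simp
  qed
qed

theorem theorem3p2:
  fixes R :: "('r, 'p) ring_scheme" and S :: "('s, 'q) ring_scheme"
    and \<phi> :: "'r \<Rightarrow> 's" and \<F> :: "'r set set"
  assumes "cring R" and "cring S" and "\<phi> \<in> ring_hom R S"
    and "\<F> = extension_system R S \<phi>"
  shows "(topologizing_system R \<F> \<and> idempotent_system R \<F>) \<and>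
    (flat_epi R S \<phi> \<longrightarrow>
       (\<forall>M :: ('r, 'm, 'k) module_scheme. module R M \<longrightarrow>
          linear_iso R (loc R \<F> M) (loc R \<F> (ext_scalars R S \<phi> M))
            (loc_map R \<F> M (ext_scalars R S \<phi> M) (ext_unit R S \<phi> M))) \<and>
       bij_betw (loc_map R \<F> (self_module R) (restr_module \<phi> S) \<phi>)
         (carrier (loc R \<F> (self_module R))) (carrier (loc R \<F> (restr_module \<phi> S))))"
proof (intro conjI impI allI)
  note R = assms(1) and S = assms(2) and \<phi> = assms(3) and \<F> = assms(4)
  show "topologizing_system R \<F>" "idempotent_system R \<F>"
    unfolding \<F> by (rule extension_system_topologizing[OF R S \<phi>], rule extension_system_idempotent[OF R S \<phi>])
  interpret gabriel_system R \<F> unfolding \<F> by (rule extension_system_gabriel[OF R S \<phi>])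
  interpret S: cring S by (rule S)
  have A: "module R (restr_module \<phi> S)" by (rule restr_module_is_module[OF R S \<phi>])
  assume fe: "flat_epi R S \<phi>"
  then have flat: "flat_module R (restr_module \<phi> S)" by (simp add: flat_epi_def flat_ring_hom_def)
  show "linear_iso R (loc R \<F> M) (loc R \<F> (ext_scalars R S \<phi> M))
      (loc_map R \<F> M (ext_scalars R S \<phi> M) (ext_unit R S \<phi> M))"
    if M: "module R M" for M :: "('r, 'm, 'k) module_scheme"
  proof (rule loc_map_iso[OF M _ ext_unit_linear[OF R S \<phi> M]])
    show "module R (ext_scalars R S \<phi> M)" unfolding ext_scalars_def by (rule tensor_is_module[OF A M])
  qed (unfold \<F>, rule ext_unit_kernel[OF R S \<phi> flat M], assumption+,
      rule ext_unit_cokernel[OF R S fe M])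
  note hom = ring_hom_closed[OF \<phi>] ring_hom_add[OF \<phi>] ring_hom_mult[OF \<phi>] ring_hom_one[OF \<phi>]
  have Rm: "module R (self_module R)" by (rule self_module_is_module[OF R])
  have "linear_iso R (loc R \<F> (self_module R)) (loc R \<F> (restr_module \<phi> S))
      (loc_map R \<F> (self_module R) (restr_module \<phi> S) \<phi>)"
  proof (rule loc_map_iso[OF Rm A])
    show "is_linear R (self_module R) (restr_module \<phi> S) \<phi>" using hom by (auto simp: is_linear_def)
  next
    fix x assume "x \<in> carrier (self_module R)" and "\<phi> x = \<zero>\<^bsub>restr_module \<phi> S\<^esub>"
    then have x: "x \<in> carrier R" "\<phi> x = \<zero>\<^bsub>S\<^esub>" by auto
    interpret T: module R "ext_scalars R S \<phi> (self_module R)"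
      unfolding ext_scalars_def by (rule tensor_is_module[OF A Rm])
    let ?e = "tensor_elem R (restr_module \<phi> S) (self_module R)"
    \<comment> \<open>Under \<open>S \<otimes> R \<cong> S\<close> the element \<open>1 \<otimes> x\<close> corresponds to \<open>\<phi>(x)\<close>, so the kernel of \<open>\<phi>\<close> is that of the unit.\<close>
    have "ext_unit R S \<phi> (self_module R) x = ?e (x \<odot>\<^bsub>restr_module \<phi> S\<^esub> \<one>\<^bsub>S\<^esub>) \<one>\<^bsub>R\<^esub>"
      using x(1) tensor_elem_smult[OF A Rm, of "\<one>\<^bsub>S\<^esub>" "\<one>\<^bsub>R\<^esub>" x]
        tensor_elem_smult_right[OF A Rm, of "\<one>\<^bsub>S\<^esub>" "\<one>\<^bsub>R\<^esub>" x] by (simp add: ext_unit_def)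
    also have "\<dots> = ?e (\<zero>\<^bsub>R\<^esub> \<odot>\<^bsub>restr_module \<phi> S\<^esub> \<one>\<^bsub>S\<^esub>) \<one>\<^bsub>R\<^esub>"
      using x module.smult_l_null[OF A, of "\<one>\<^bsub>S\<^esub>"] by simp
    also have "\<dots> = \<zero>\<^bsub>ext_scalars R S \<phi> (self_module R)\<^esub>"
      using tensor_elem_smult[OF A Rm, of "\<one>\<^bsub>S\<^esub>" "\<one>\<^bsub>R\<^esub>" "\<zero>\<^bsub>R\<^esub>"] T.smult_l_null
        tensor_elem_closed[OF A Rm, of "\<one>\<^bsub>S\<^esub>" "\<one>\<^bsub>R\<^esub>"] by (simp add: ext_scalars_def)
    finally show "ann R (self_module R) x \<in> \<F>"
      unfolding \<F> using x(1) by (intro ext_unit_kernel[OF R S \<phi> flat Rm]) auto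
  next
    fix s assume "s \<in> carrier (restr_module \<phi> S)"
    then have "s \<in> carrier S" by simp
    from flat_epi_fractions[OF R S fe this]
    show "\<exists>J\<in>\<F>. \<forall>r\<in>J. r \<odot>\<^bsub>restr_module \<phi> S\<^esub> s \<in> \<phi> ` carrier (self_module R)"
      unfolding \<F> by (intro bexI) auto
  qed
  then show "bij_betw (loc_map R \<F> (self_module R) (restr_module \<phi> S) \<phi>)
      (carrier (loc R \<F> (self_module R))) (carrier (loc R \<F> (restr_module \<phi> S)))"
    by (simp add: linear_iso_def)
qed

end
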